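(* Let $(M,g)$ be a compact, oriented Riemannian manifold of dimension $2$, $(N,h,J)$ a compact Kähler manifold with Kähler form $\omega=h(J\cdot,\cdot)$, and $\phi:M\to N$ a smooth map. Then $$E(\phi)\geq\frac{1}{2\,\mathrm{Vol}(M)}\Big(\int_M\phi^*\omega\Big)^2,$$ where $E(\phi)=\frac12\int_M|\phi^*\omega|^2\,{\ast 1}$. The right hand side is a homotopy invariant of $\phi$. If $\phi$ attains this lower bound (i.e. equality holds), then $\phi$ is either isotropic (that is, $\phi^*\omega=0$ everywhere, so $E(\phi)=0$) or has no critical points (that is, $d\phi_x$ has maximal rank for every $x\in M$).
   Context: $\ast 1$ is the volume form of $M$ and $\mathrm{Vol}(M)=\int_M{\ast 1}$; the pointwise norm on $p$-forms is induced by $\langle\alpha,\beta\rangle=\frac1{p!}\sum_{i_1,\dots,i_p}\alpha(e_{i_1},\dots,e_{i_p})\beta(e_{i_1},\dots,e_{i_p})$ for a local orthonormal frame. *)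

theory Defs
  imports "HOL-Analysis.Analysis"
begin

section \<open>Smooth maps between open subsets of Euclidean spaces\<close>

fun differentiable_upto_on ::
  "nat \<Rightarrow> ('a::euclidean_space \<Rightarrow> 'b::real_normed_vector) \<Rightarrow> 'a set \<Rightarrow> bool" where
  "differentiable_upto_on 0 f S \<longleftrightarrow> continuous_on S f"
| "differentiable_upto_on (Suc k) f S \<longleftrightarrow>
     (\<forall>x\<in>S. f differentiable (at x)) \<and>
     (\<forall>v. differentiable_upto_on k (\<lambda>x. frechet_derivative f (at x) v) S)"

text \<open>Only meant for open \<open>S\<close>.\<close>

definition smooth_on :: "('a::euclidean_space \<Rightarrow> 'b::real_normed_vector) \<Rightarrow> 'a set \<Rightarrow> bool" where
  "smooth_on f S \<longleftrightarrow> (\<forall>k. differentiable_upto_on k f S)"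


section \<open>Smooth manifolds\<close>

text \<open>A chart is a pair of its domain and its coordinate map (whose values outside the domain
  are irrelevant). The model space is the type \<open>'e\<close>, so the dimension of the manifold
  is \<open>DIM('e)\<close>. Atlases need not be maximal.\<close>

type_synonym ('a, 'e) chart = "'a set \<times> ('a \<Rightarrow> 'e)"

abbreviation chart_dom :: "('a, 'e) chart \<Rightarrow> 'a set" where
  "chart_dom c \<equiv> fst c"

abbreviation chart_map :: "('a, 'e) chart \<Rightarrow> 'a \<Rightarrow> 'e" where
  "chart_map c \<equiv> snd c"

definition chart_image :: "('a, 'e) chart \<Rightarrow> 'e set" where
  "chart_image c = chart_map c ` chart_dom c"

definition chart_inv :: "('a, 'e) chart \<Rightarrow> 'e \<Rightarrow> 'a" where
  "chart_inv c = inv_into (chart_dom c) (chart_map c)"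

definition is_chart :: "'a topology \<Rightarrow> ('a, 'e::euclidean_space) chart \<Rightarrow> bool" where
  "is_chart X c \<longleftrightarrow>
     openin X (chart_dom c) \<and> open (chart_image c) \<and>
     homeomorphic_map (subtopology X (chart_dom c)) (top_of_set (chart_image c)) (chart_map c)"

definition coord_change :: "('a, 'e) chart \<Rightarrow> ('a, 'f) chart \<Rightarrow> 'e \<Rightarrow> 'f" where
  "coord_change c c' = chart_map c' \<circ> chart_inv c"

definition coord_change_deriv ::
  "('a, 'e::euclidean_space) chart \<Rightarrow> ('a, 'e) chart \<Rightarrow> 'a \<Rightarrow> 'e \<Rightarrow> 'e" where
  "coord_change_deriv c c' x = frechet_derivative (coord_change c c') (at (chart_map c x))"

definition compatible_charts ::
  "('a, 'e::euclidean_space) chart \<Rightarrow> ('a, 'e) chart \<Rightarrow> bool" where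
  "compatible_charts c c' \<longleftrightarrow>
     smooth_on (coord_change c c') (chart_map c ` (chart_dom c \<inter> chart_dom c')) \<and>
     smooth_on (coord_change c' c) (chart_map c' ` (chart_dom c \<inter> chart_dom c'))"

definition smooth_manifold ::
  "'a topology \<Rightarrow> ('a, 'e::euclidean_space) chart set \<Rightarrow> bool" where
  "smooth_manifold X A \<longleftrightarrow>
     Hausdorff_space X \<and> second_countable X \<and>
     (\<forall>c\<in>A. is_chart X c) \<and> (\<Union>c\<in>A. chart_dom c) = topspace X \<and>
     (\<forall>c\<in>A. \<forall>c'\<in>A. compatible_charts c c')"

text \<open>Charts belonging to the maximal atlas generated by \<open>A\<close>.\<close>

definition smooth_chart ::
  "'a topology \<Rightarrow> ('a, 'e::euclidean_space) chart set \<Rightarrow> ('a, 'e) chart \<Rightarrow> bool" where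
  "smooth_chart X A c \<longleftrightarrow> is_chart X c \<and> (\<forall>c'\<in>A. compatible_charts c c')"

text \<open>An orientation is given by an atlas whose coordinate changes all have
  positive Jacobian determinant.\<close>

definition oriented_manifold :: "'a topology \<Rightarrow> ('a, real^'d) chart set \<Rightarrow> bool" where
  "oriented_manifold X A \<longleftrightarrow>
     smooth_manifold X A \<and>
     (\<forall>c\<in>A. \<forall>c'\<in>A. \<forall>x\<in>chart_dom c \<inter> chart_dom c'.
        0 < det (matrix (coord_change_deriv c c' x)))"

definition smooth_map ::
  "'a topology \<Rightarrow> ('a, 'e::euclidean_space) chart set \<Rightarrow>
   'b topology \<Rightarrow> ('b, 'f::euclidean_space) chart set \<Rightarrow> ('a \<Rightarrow> 'b) \<Rightarrow> bool" where
  "smooth_map X A Y B f \<longleftrightarrow>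
     continuous_map X Y f \<and>
     (\<forall>c\<in>A. \<forall>c'\<in>B.
        smooth_on (chart_map c' \<circ> f \<circ> chart_inv c)
          (chart_map c ` (chart_dom c \<inter> f -` chart_dom c')))"

definition smooth_function ::
  "('a, 'e::euclidean_space) chart set \<Rightarrow> ('a \<Rightarrow> real) \<Rightarrow> bool" where
  "smooth_function A f \<longleftrightarrow> (\<forall>c\<in>A. smooth_on (f \<circ> chart_inv c) (chart_image c))"


section \<open>Tangent spaces and covariant 2-tensors\<close>

text \<open>A tangent vector at \<open>x\<close> assigns to every chart of the atlas around \<open>x\<close> its component vector
  in that chart, the components being related by the derivatives of the coordinate changes;
  it is 0 on everything that is not a chart around \<open>x\<close>. The vector space operations are pointwise.\<close>

type_synonym ('a, 'e) tangent = "('a, 'e) chart \<Rightarrow> 'e"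

definition tangent_space ::
  "('a, 'e::euclidean_space) chart set \<Rightarrow> 'a \<Rightarrow> ('a, 'e) tangent set" where
  "tangent_space A x =
     {v. (\<forall>c\<in>A. \<forall>c'\<in>A. x \<in> chart_dom c \<inter> chart_dom c' \<longrightarrow>
            v c' = coord_change_deriv c c' x (v c)) \<and>
         (\<forall>c. \<not> (c \<in> A \<and> x \<in> chart_dom c) \<longrightarrow> v c = 0)}"

text \<open>The tangent vector at \<open>x\<close> with components \<open>w\<close> in the chart \<open>c\<close>; here \<open>c\<close> may be any
  chart around \<open>x\<close> of the maximal atlas, not only one in \<open>A\<close>. For fixed \<open>c\<close> and \<open>x\<close> this is
  the linear isomorphism from the model space to the tangent space at \<open>x\<close>.\<close>

definition coord_vector ::
  "('a, 'e::euclidean_space) chart set \<Rightarrow> ('a, 'e) chart \<Rightarrow> 'a \<Rightarrow> 'e \<Rightarrow> ('a, 'e) tangent" where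
  "coord_vector A c x w =
     (\<lambda>c'. if c' \<in> A \<and> x \<in> chart_dom c' then coord_change_deriv c c' x w else 0)"

definition chart_at :: "('a, 'e) chart set \<Rightarrow> 'a \<Rightarrow> ('a, 'e) chart" where
  "chart_at A x = (SOME c. c \<in> A \<and> x \<in> chart_dom c)"

definition differential ::
  "('a, 'e::euclidean_space) chart set \<Rightarrow> ('b, 'f::euclidean_space) chart set \<Rightarrow>
   ('a \<Rightarrow> 'b) \<Rightarrow> 'a \<Rightarrow> ('a, 'e) tangent \<Rightarrow> ('b, 'f) tangent" where
  "differential A B f x v =
     (\<lambda>c'. if c' \<in> B \<and> f x \<in> chart_dom c'
           then let c = chart_at A x in
             frechet_derivative (chart_map c' \<circ> f \<circ> chart_inv c) (at (chart_map c x)) (v c)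
           else 0)"

text \<open>The dimension of the image of the differential, which may be measured in any chart
  around \<open>f x\<close>.\<close>

definition differential_rank ::
  "('a, 'e::euclidean_space) chart set \<Rightarrow> ('b, 'f::euclidean_space) chart set \<Rightarrow>
   ('a \<Rightarrow> 'b) \<Rightarrow> 'a \<Rightarrow> nat" where
  "differential_rank A B f x =
     dim ((\<lambda>v. differential A B f x v (chart_at B (f x))) ` tangent_space A x)"

definition critical_point ::
  "('a, 'e::euclidean_space) chart set \<Rightarrow> ('b, 'f::euclidean_space) chart set \<Rightarrow>
   ('a \<Rightarrow> 'b) \<Rightarrow> 'a \<Rightarrow> bool" where
  "critical_point A B f x \<longleftrightarrow> differential_rank A B f x \<noteq> min DIM('e) DIM('f)"

type_synonym ('a, 'e) tensor2 = "'a \<Rightarrow> ('a, 'e) tangent \<Rightarrow> ('a, 'e) tangent \<Rightarrow> real"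

definition tensor_coord ::
  "('a, 'e::euclidean_space) chart set \<Rightarrow> ('a, 'e) tensor2 \<Rightarrow>
   ('a, 'e) chart \<Rightarrow> 'e \<Rightarrow> 'e \<Rightarrow> 'e \<Rightarrow> real" where
  "tensor_coord A T c p v w =
     T (chart_inv c p) (coord_vector A c (chart_inv c p) v) (coord_vector A c (chart_inv c p) w)"

definition smooth_tensor2 ::
  "('a, 'e::euclidean_space) chart set \<Rightarrow> ('a, 'e) tensor2 \<Rightarrow> bool" where
  "smooth_tensor2 A T \<longleftrightarrow>
     (\<forall>c\<in>A. (\<forall>p\<in>chart_image c. bilinear (tensor_coord A T c p)) \<and>
             (\<forall>v w. smooth_on (\<lambda>p. tensor_coord A T c p v w) (chart_image c)))"

definition pullback2 ::
  "('a, 'e::euclidean_space) chart set \<Rightarrow> ('b, 'f::euclidean_space) chart set \<Rightarrow>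
   ('a \<Rightarrow> 'b) \<Rightarrow> ('b, 'f) tensor2 \<Rightarrow> ('a, 'e) tensor2" where
  "pullback2 A B f T x u v = T (f x) (differential A B f x u) (differential A B f x v)"

text \<open>Closedness of an alternating 2-form, by the coordinate formula
  \<open>d\<omega>(u,v,w) = u(\<omega>(v,w)) - v(\<omega>(u,w)) + w(\<omega>(u,v))\<close> for constant coordinate fields.\<close>

definition closed_2form ::
  "('a, 'e::euclidean_space) chart set \<Rightarrow> ('a, 'e) tensor2 \<Rightarrow> bool" where
  "closed_2form A \<omega> \<longleftrightarrow>
     (\<forall>c\<in>A. \<forall>p\<in>chart_image c. \<forall>u v w.
        frechet_derivative (\<lambda>q. tensor_coord A \<omega> c q v w) (at p) u
      - frechet_derivative (\<lambda>q. tensor_coord A \<omega> c q u w) (at p) v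
      + frechet_derivative (\<lambda>q. tensor_coord A \<omega> c q u v) (at p) w = 0)"


section \<open>Riemannian metrics and Kaehler structures\<close>

definition riemannian_metric ::
  "'a topology \<Rightarrow> ('a, 'e::euclidean_space) chart set \<Rightarrow> ('a, 'e) tensor2 \<Rightarrow> bool" where
  "riemannian_metric X A g \<longleftrightarrow>
     smooth_tensor2 A g \<and>
     (\<forall>x\<in>topspace X. \<forall>u\<in>tangent_space A x. \<forall>v\<in>tangent_space A x. g x u v = g x v u) \<and>
     (\<forall>x\<in>topspace X. \<forall>u\<in>tangent_space A x. u \<noteq> (\<lambda>c. 0) \<longrightarrow> 0 < g x u u)"

definition almost_complex_structure ::
  "'a topology \<Rightarrow> ('a, 'e::euclidean_space) chart set \<Rightarrow>
   ('a \<Rightarrow> ('a, 'e) tangent \<Rightarrow> ('a, 'e) tangent) \<Rightarrow> bool" where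
  "almost_complex_structure X A J \<longleftrightarrow>
     (\<forall>x\<in>topspace X. \<forall>u\<in>tangent_space A x.
        J x u \<in> tangent_space A x \<and> J x (J x u) = (\<lambda>c. - u c)) \<and>
     (\<forall>c\<in>A. (\<forall>x\<in>chart_dom c. linear (\<lambda>w. J x (coord_vector A c x w) c)) \<and>
             (\<forall>w. smooth_on (\<lambda>p. J (chart_inv c p) (coord_vector A c (chart_inv c p) w) c)
                    (chart_image c)))"

text \<open>\<open>J\<close> comes from a complex manifold structure: around every point there are coordinates
  in which \<open>J\<close> is a constant linear map \<open>J0\<close>. As \<open>J0\<close> squares to minus the identity, it is
  linearly conjugate to multiplication by \<open>i\<close>, and the changes between such coordinates
  are then holomorphic.\<close>

definition complex_structure ::
  "'a topology \<Rightarrow> ('a, 'e::euclidean_space) chart set \<Rightarrow>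
   ('a \<Rightarrow> ('a, 'e) tangent \<Rightarrow> ('a, 'e) tangent) \<Rightarrow> bool" where
  "complex_structure X A J \<longleftrightarrow>
     almost_complex_structure X A J \<and>
     (\<forall>x\<in>topspace X. \<exists>c J0. smooth_chart X A c \<and> x \<in> chart_dom c \<and> linear J0 \<and>
        (\<forall>y\<in>chart_dom c. \<forall>w. J y (coord_vector A c y w) = coord_vector A c y (J0 w)))"

definition kaehler_form ::
  "('a, 'e) tensor2 \<Rightarrow> ('a \<Rightarrow> ('a, 'e) tangent \<Rightarrow> ('a, 'e) tangent) \<Rightarrow> ('a, 'e) tensor2" where
  "kaehler_form h J x u v = h x (J x u) v"

definition kaehler_manifold ::
  "'a topology \<Rightarrow> ('a, 'e::euclidean_space) chart set \<Rightarrow> ('a, 'e) tensor2 \<Rightarrow>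
   ('a \<Rightarrow> ('a, 'e) tangent \<Rightarrow> ('a, 'e) tangent) \<Rightarrow> bool" where
  "kaehler_manifold X A h J \<longleftrightarrow>
     smooth_manifold X A \<and> riemannian_metric X A h \<and> complex_structure X A J \<and>
     (\<forall>x\<in>topspace X. \<forall>u\<in>tangent_space A x. \<forall>v\<in>tangent_space A x.
        h x (J x u) (J x v) = h x u v) \<and>
     closed_2form A (kaehler_form h J)"


section \<open>Norm of 2-forms, volume form and integration\<close>

definition orthonormal_frame ::
  "('a, real^'d) chart set \<Rightarrow> ('a, real^'d) tensor2 \<Rightarrow> 'a \<Rightarrow> ('d \<Rightarrow> ('a, real^'d) tangent) \<Rightarrow> bool"
  where
  "orthonormal_frame A g x e \<longleftrightarrow>
     (\<forall>i. e i \<in> tangent_space A x) \<and> (\<forall>i j. g x (e i) (e j) = (if i = j then 1 else 0))"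

definition positive_frame ::
  "('a, real^'d) chart set \<Rightarrow> 'a \<Rightarrow> ('d \<Rightarrow> ('a, real^'d) tangent) \<Rightarrow> bool" where
  "positive_frame A x e \<longleftrightarrow> (\<forall>c\<in>A. x \<in> chart_dom c \<longrightarrow> 0 < det (\<chi> i. e i c))"

text \<open>The values of the next two definitions do not depend on the choice of the frame.\<close>

definition form2_inner ::
  "('a, real^'d) chart set \<Rightarrow> ('a, real^'d) tensor2 \<Rightarrow>
   ('a, real^'d) tensor2 \<Rightarrow> ('a, real^'d) tensor2 \<Rightarrow> 'a \<Rightarrow> real" where
  "form2_inner A g \<alpha> \<beta> x =
     (let e = (SOME e. orthonormal_frame A g x e)
      in 1 / fact 2 * (\<Sum>i\<in>UNIV. \<Sum>j\<in>UNIV. \<alpha> x (e i) (e j) * \<beta> x (e i) (e j)))"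

text \<open>The volume form of an oriented surface is \<open>\<theta>\<^sub>1 \<and> \<theta>\<^sub>2\<close> for the coframe \<open>\<theta>\<close> dual to a
  positively oriented orthonormal frame.\<close>

definition volume_form ::
  "('a, real^2) chart set \<Rightarrow> ('a, real^2) tensor2 \<Rightarrow> ('a, real^2) tensor2" where
  "volume_form A g x u v =
     (let e = (SOME e. orthonormal_frame A g x e \<and> positive_frame A x e)
      in g x (e 1) u * g x (e 2) v - g x (e 1) v * g x (e 2) u)"

definition form2_norm ::
  "('a, real^'d) chart set \<Rightarrow> ('a, real^'d) tensor2 \<Rightarrow> ('a, real^'d) tensor2 \<Rightarrow> 'a \<Rightarrow> real" where
  "form2_norm A g \<alpha> x = sqrt (form2_inner A g \<alpha> \<alpha> x)"

text \<open>Partitions of unity subordinate to the atlas, indexed by its charts. Only finitely many of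
  the functions are nonzero, which is the appropriate notion on a compact manifold.\<close>

definition active_charts :: "('a, 'e) chart set \<Rightarrow> (('a, 'e) chart \<Rightarrow> 'a \<Rightarrow> real) \<Rightarrow> ('a, 'e) chart set"
  where
  "active_charts A \<rho> = {c \<in> A. \<exists>x\<in>chart_dom c. \<rho> c x \<noteq> 0}"

definition partition_of_unity ::
  "'a topology \<Rightarrow> ('a, 'e::euclidean_space) chart set \<Rightarrow> (('a, 'e) chart \<Rightarrow> 'a \<Rightarrow> real) \<Rightarrow> bool" where
  "partition_of_unity X A \<rho> \<longleftrightarrow>
     finite (active_charts A \<rho>) \<and>
     (\<forall>c\<in>A. smooth_function A (\<rho> c) \<and> (\<forall>x\<in>topspace X. 0 \<le> \<rho> c x) \<and>
             X closure_of {x \<in> topspace X. \<rho> c x \<noteq> 0} \<subseteq> chart_dom c) \<and>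
     (\<forall>x\<in>topspace X. (\<Sum>c\<in>active_charts A \<rho>. \<rho> c x) = 1)"

text \<open>Integral of a 2-form over a compact surface oriented by the atlas \<open>A\<close>; it does not depend
  on the choice of the partition of unity.\<close>

definition integral_2form ::
  "'a topology \<Rightarrow> ('a, real^2) chart set \<Rightarrow> ('a, real^2) tensor2 \<Rightarrow> real" where
  "integral_2form X A \<alpha> =
     (let \<rho> = (SOME \<rho>. partition_of_unity X A \<rho>)
      in \<Sum>c\<in>active_charts A \<rho>.
           integral (chart_image c)
             (\<lambda>p. \<rho> c (chart_inv c p) * tensor_coord A \<alpha> c p (axis 1 1) (axis 2 1)))"

definition total_volume :: "'a topology \<Rightarrow> ('a, real^2) chart set \<Rightarrow> ('a, real^2) tensor2 \<Rightarrow> real" where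
  "total_volume X A g = integral_2form X A (volume_form A g)"

definition energy ::
  "'a topology \<Rightarrow> ('a, real^2) chart set \<Rightarrow> ('a, real^2) tensor2 \<Rightarrow>
   ('b, 'f::euclidean_space) chart set \<Rightarrow> ('b, 'f) tensor2 \<Rightarrow> ('a \<Rightarrow> 'b) \<Rightarrow> real" where
  "energy X A g B \<omega> \<phi> =
     1 / 2 * integral_2form X A
       (\<lambda>x u v. (form2_norm A g (pullback2 A B \<phi> \<omega>) x)\<^sup>2 * volume_form A g x u v)"

definition energy_bound ::
  "'a topology \<Rightarrow> ('a, real^2) chart set \<Rightarrow> ('a, real^2) tensor2 \<Rightarrow>
   ('b, 'f::euclidean_space) chart set \<Rightarrow> ('b, 'f) tensor2 \<Rightarrow> ('a \<Rightarrow> 'b) \<Rightarrow> real" where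
  "energy_bound X A g B \<omega> \<phi> =
     1 / (2 * total_volume X A g) * (integral_2form X A (pullback2 A B \<phi> \<omega>))\<^sup>2"

definition isotropic ::
  "'a topology \<Rightarrow> ('a, 'e::euclidean_space) chart set \<Rightarrow>
   ('b, 'f::euclidean_space) chart set \<Rightarrow> ('b, 'f) tensor2 \<Rightarrow> ('a \<Rightarrow> 'b) \<Rightarrow> bool" where
  "isotropic X A B \<omega> \<phi> \<longleftrightarrow>
     (\<forall>x\<in>topspace X. \<forall>u\<in>tangent_space A x. \<forall>v\<in>tangent_space A x. pullback2 A B \<phi> \<omega> x u v = 0)"

end

theory Submission
  imports Defs
begin

text \<open>The pullback \<open>\<phi>\<^sup>*\<omega>\<close> is a function \<open>u\<close> times the volume form and \<open>|\<phi>\<^sup>*\<omega>|\<^sup>2 = u\<^sup>2\<close>, so the inequality is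
  Cauchy-Schwarz for \<open>u\<close> and the constant 1. Equality forces \<open>u\<close> to be a constant \<open>k\<close>: either \<open>k = 0\<close>
  and \<open>\<phi>\<close> is isotropic, or \<open>\<phi>\<^sup>*\<omega>\<close> vanishes nowhere, and then \<open>d\<phi>\<close> is injective everywhere.

  For the homotopy invariance, a continuous homotopy between smooth maps is first replaced by a
  smooth map \<open>F\<close> on \<open>\<real> \<times> M\<close>, by polynomial approximation in finitely many charts. The form
  \<open>F\<^sup>*\<omega>\<close> on \<open>\<real> \<times> M\<close> is closed, so the time derivative of its restriction to the slices is \<open>d\<beta>\<close>
  with the 1-form \<open>\<beta> = F\<^sup>*\<omega>(\<partial>\<^sub>t, \<sqdot>)\<close>. With a partition of unity \<open>\<rho>\<close>,
  \<open>\<integral> d\<beta> = \<Sum>\<^sub>c \<integral> \<rho>\<^sub>c d\<beta> = - \<Sum>\<^sub>c \<integral> d\<rho>\<^sub>c \<and> \<beta> = 0\<close>. Only first derivatives of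
  objects on \<open>M\<close> have to be compared between charts in this argument.\<close>

section \<open>Smooth functions on Euclidean spaces\<close>

text \<open>Volume form and norm are defined by frames that are picked pointwise with SOME, so their
  continuity cannot be read off. In a chart the frame contributes only a sign, which the orientation
  fixes, and everything else is the Gram determinant of the metric. The constant \<open>k\<close> is
  the mean value of \<open>u\<close>, and energy minus bound is half the integral of
  \<open>(u - k)^2\<close>.

  The route through \<open>d\<rho>\<close> avoids second derivatives of coordinate changes: that
  \<open>d\<beta>\<close> agrees in two charts rests on their symmetry, whereas
  \<open>\<beta>\<close> and \<open>d\<rho>\<close> transform by the Jacobian alone. Inserting the
  partition of unity a second time moves each \<open>d\<rho>\<close> term into the other charts, and
  there the differentials \<open>d\<rho>\<close> add up to 0. Second derivatives enter only for the
  local representations of \<open>F\<close> in a fixed pair of charts, when \<open>F\<close> pulls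
  back a closed form.

  Time runs over the whole line so that the cylinder has no boundary. The homotopy is continued
  constantly past both ends and is altered only in small boxes, so sufficiently early and late
  slices remain the given maps.\<close>

abbreviation (input) dir_deriv :: "('a::euclidean_space \<Rightarrow> 'b::real_normed_vector) \<Rightarrow> 'a \<Rightarrow> 'a \<Rightarrow> 'b" where
  "dir_deriv f v x \<equiv> frechet_derivative f (at x) v"

lemma frechet_derivative_eqI:
  "(f has_derivative f') (at x) \<Longrightarrow> frechet_derivative f (at x) = f'"
  by (metis frechet_derivative_at)

lemma frechet_derivative_worksI:
  "f differentiable at x \<Longrightarrow> (f has_derivative frechet_derivative f (at x)) (at x)"
  by (simp add: frechet_derivative_works)

text \<open>Differentiability plays no part: both functions have the same candidates for a
  derivative at \<open>x\<close>, and \<open>frechet_derivative\<close> chooses among these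
  candidates by SOME.\<close>

lemma frechet_cong:
  assumes "open S" "x \<in> S" "\<And>y. y \<in> S \<Longrightarrow> f y = g y"
  shows "frechet_derivative f (at x) = frechet_derivative g (at x)"
proof -
  have "(f has_derivative D) (at x) \<longleftrightarrow> (g has_derivative D) (at x)" for D
    using assms has_derivative_transform_within_open[of f D x UNIV S g]
      has_derivative_transform_within_open[of g D x UNIV S f] by auto
  then show ?thesis by (simp add: frechet_derivative_def)
qed

lemma differentiable_cong:
  assumes "open S" "x \<in> S" "\<And>y. y \<in> S \<Longrightarrow> f y = g y" "f differentiable at x"
  shows "g differentiable at x"
  using assms has_derivative_transform_within_open[of f _ x UNIV S g]
  unfolding differentiable_def by metis

lemma differentiable_upto_on_cong:
  assumes "open S" "\<And>x. x \<in> S \<Longrightarrow> f x = g x"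
  shows "differentiable_upto_on k f S \<longleftrightarrow> differentiable_upto_on k g S"
  using assms(2)
proof (induction k arbitrary: f g)
  case 0
  then show ?case by (simp cong: continuous_on_cong)
next
  case (Suc k)
  have "differentiable_upto_on k (dir_deriv f v) S \<longleftrightarrow> differentiable_upto_on k (dir_deriv g v) S" for v
    by (rule Suc.IH) (simp add: frechet_cong[OF assms(1) _ Suc.prems])
  moreover have "(\<forall>x\<in>S. f differentiable at x) \<longleftrightarrow> (\<forall>x\<in>S. g differentiable at x)"
    using differentiable_cong[OF assms(1)] Suc.prems by metis
  ultimately show ?case by simp
qed

lemma differentiable_upto_on_subset:
  "differentiable_upto_on k f S \<Longrightarrow> T \<subseteq> S \<Longrightarrow> differentiable_upto_on k f T"
  by (induction k arbitrary: f) (auto intro: continuous_on_subset)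

lemma differentiable_upto_on_SucD:
  "differentiable_upto_on (Suc k) f S \<Longrightarrow> differentiable_upto_on k f S"
proof (induction k arbitrary: f)
  case 0
  then show ?case
    by (auto intro!: differentiable_imp_continuous_on differentiable_at_imp_differentiable_on)
next
  case (Suc k)
  have "\<forall>x\<in>S. f differentiable at x"
    using Suc.prems unfolding differentiable_upto_on.simps(2)[of "Suc k"] by blast
  moreover have "differentiable_upto_on k (dir_deriv f v) S" for v
    using Suc.prems by (intro Suc.IH) (unfold differentiable_upto_on.simps(2)[of "Suc k"], blast)
  ultimately show ?case by simp
qed

text \<open>All derivatives in the definition are taken \<open>at x\<close> and not within the set,
  so they do not see which open set around \<open>x\<close> is used. Smoothness is glued over chart
  overlaps with this.\<close>

lemma differentiable_upto_on_local:
  assumes "\<And>x. x \<in> S \<Longrightarrow> \<exists>T. open T \<and> x \<in> T \<and> differentiable_upto_on k f T"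
  shows "differentiable_upto_on k f S"
  using assms
proof (induction k arbitrary: f)
  case 0
  then show ?case
    by (auto intro!: continuous_at_imp_continuous_on) (metis continuous_on_eq_continuous_at)
next
  case (Suc k)
  have "f differentiable at x" if "x \<in> S" for x
    using Suc.prems[OF that] by auto
  moreover have "differentiable_upto_on k (dir_deriv f v) S" for v
  proof (rule Suc.IH)
    fix x assume "x \<in> S"
    from Suc.prems[OF this] obtain T where "open T" "x \<in> T" "differentiable_upto_on (Suc k) f T" by auto
    then show "\<exists>T. open T \<and> x \<in> T \<and> differentiable_upto_on k (dir_deriv f v) T"
      by (intro exI[of _ T]) simp
  qed
  ultimately show ?case by simp
qed

lemma differentiable_upto_on_bounded_linear:
  assumes "bounded_linear L" "open S" "differentiable_upto_on k f S"
  shows "differentiable_upto_on k (\<lambda>x. L (f x)) S"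
  using assms(3)
proof (induction k arbitrary: f)
  case 0
  then show ?case
    using bounded_linear.continuous_on[OF assms(1)] by auto
next
  case (Suc k)
  have D: "((\<lambda>x. L (f x)) has_derivative (\<lambda>v. L (frechet_derivative f (at x) v))) (at x)" if "x \<in> S" for x
    using Suc.prems that
    by (intro bounded_linear.has_derivative[OF assms(1)]) (auto simp: frechet_derivative_worksI)
  have "differentiable_upto_on k (dir_deriv (\<lambda>x. L (f x)) v) S
      \<longleftrightarrow> differentiable_upto_on k (\<lambda>x. L (dir_deriv f v x)) S" for v
    by (rule differentiable_upto_on_cong[OF assms(2)]) (simp add: frechet_derivative_eqI[OF D])
  then show ?case using Suc D by (auto simp: differentiable_def)
qed

lemma differentiable_upto_on_const: "differentiable_upto_on k (\<lambda>x. c) S"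
  by (induction k arbitrary: c) auto

lemma differentiable_upto_on_id: "differentiable_upto_on k (\<lambda>x. x) S"
  by (cases k) (auto simp: frechet_derivative_eqI[OF has_derivative_ident] differentiable_upto_on_const)

lemma differentiable_upto_on_add:
  assumes "open S" "differentiable_upto_on k f S" "differentiable_upto_on k g S"
  shows "differentiable_upto_on k (\<lambda>x. f x + g x) S"
  using assms(2,3)
proof (induction k arbitrary: f g)
  case 0
  then show ?case by (auto intro: continuous_intros)
next
  case (Suc k)
  have D: "((\<lambda>x. f x + g x) has_derivative (\<lambda>v. dir_deriv f v x + dir_deriv g v x)) (at x)" if "x \<in> S" for x
    using Suc.prems that
    by (intro derivative_intros) (auto simp: frechet_derivative_worksI)
  have "differentiable_upto_on k (dir_deriv (\<lambda>x. f x + g x) v) S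
      \<longleftrightarrow> differentiable_upto_on k (\<lambda>x. dir_deriv f v x + dir_deriv g v x) S" for v
    by (rule differentiable_upto_on_cong[OF assms(1)]) (simp add: frechet_derivative_eqI[OF D])
  moreover have "(\<lambda>x. f x + g x) differentiable at x" if "x \<in> S" for x
    using D[OF that] by (auto simp: differentiable_def)
  ultimately show ?case using Suc by simp
qed

lemma differentiable_upto_on_sum:
  assumes "open S" "\<And>i. i \<in> I \<Longrightarrow> differentiable_upto_on k (f i) S"
  shows "differentiable_upto_on k (\<lambda>x. \<Sum>i\<in>I. f i x) S"
proof (cases "finite I")
  case True
  then show ?thesis using assms(2)
    by (induction I rule: finite_induct)
      (auto simp: differentiable_upto_on_const intro: differentiable_upto_on_add[OF assms(1)])
qed (simp add: differentiable_upto_on_const)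

lemma differentiable_upto_on_scaleR:
  fixes f :: "'a::euclidean_space \<Rightarrow> real"
  assumes "open S" "differentiable_upto_on k f S" "differentiable_upto_on k g S"
  shows "differentiable_upto_on k (\<lambda>x. f x *\<^sub>R g x) S"
  using assms(2,3)
proof (induction k arbitrary: f g)
  case 0
  then show ?case by (auto intro: continuous_intros)
next
  case (Suc k)
  have D: "((\<lambda>x. f x *\<^sub>R g x) has_derivative (\<lambda>v. f x *\<^sub>R dir_deriv g v x + dir_deriv f v x *\<^sub>R g x)) (at x)"
    if "x \<in> S" for x
    using Suc.prems that
    by (intro derivative_intros) (auto simp: frechet_derivative_worksI)
  have "differentiable_upto_on k (dir_deriv (\<lambda>x. f x *\<^sub>R g x) v) S
      \<longleftrightarrow> differentiable_upto_on k (\<lambda>x. f x *\<^sub>R dir_deriv g v x + dir_deriv f v x *\<^sub>R g x) S" for v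
    by (rule differentiable_upto_on_cong[OF assms(1)]) (simp add: frechet_derivative_eqI[OF D])
  moreover have "(\<lambda>x. f x *\<^sub>R g x) differentiable at x" if "x \<in> S" for x
    using D[OF that] by (auto simp: differentiable_def)
  \<comment> \<open>Each summand of the product rule keeps one undifferentiated factor, whose order
    is lowered from \<open>Suc k\<close> to \<open>k\<close> for the induction hypothesis.\<close>
  ultimately show ?case
    using Suc differentiable_upto_on_SucD[OF Suc.prems(1)] differentiable_upto_on_SucD[OF Suc.prems(2)]
    by (auto intro!: differentiable_upto_on_add[OF assms(1)])
qed

text \<open>Separates the direction from the point: smoothness controls the derivative of
  \<open>g\<close> in a fixed direction, but the chain rule inserts a direction that varies with the
  point.\<close>

lemma frechet_derivative_Basis_sum:
  fixes g :: "'b::euclidean_space \<Rightarrow> 'c::real_normed_vector"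
  assumes "g differentiable at y"
  shows "frechet_derivative g (at y) w = (\<Sum>b\<in>Basis. (w \<bullet> b) *\<^sub>R frechet_derivative g (at y) b)"
proof -
  have lin: "linear (frechet_derivative g (at y))"
    using assms by (rule linear_frechet_derivative)
  have "frechet_derivative g (at y) w = frechet_derivative g (at y) (\<Sum>b\<in>Basis. (w \<bullet> b) *\<^sub>R b)"
    by (simp add: euclidean_representation)
  then show ?thesis by (simp add: linear_sum[OF lin] linear_cmul[OF lin])
qed

lemma frechet_derivative_compose:
  assumes "f differentiable at x" "g differentiable at (f x)"
  shows "frechet_derivative (\<lambda>x. g (f x)) (at x) v = frechet_derivative g (at (f x)) (frechet_derivative f (at x) v)"
  using diff_chain_at[OF frechet_derivative_worksI[OF assms(1)] frechet_derivative_worksI[OF assms(2)]]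
  by (simp add: frechet_derivative_eqI o_def)

text \<open>After expansion in the basis the derivative of the composite contains the functions
  \<open>dir_deriv g b\<close> composed with the same \<open>f\<close>. Hence only \<open>g\<close>
  is generalised in the induction.\<close>

lemma differentiable_upto_on_compose:
  fixes f :: "'a::euclidean_space \<Rightarrow> 'b::euclidean_space" and g :: "'b \<Rightarrow> 'c::real_normed_vector"
  assumes "open S" "open T" "f ` S \<subseteq> T" "differentiable_upto_on k f S" "differentiable_upto_on k g T"
  shows "differentiable_upto_on k (\<lambda>x. g (f x)) S"
  using assms(4,5)
proof (induction k arbitrary: g)
  case 0
  then show ?case using assms(3) by (auto intro: continuous_on_compose2)
next
  case (Suc k)
  have fT: "f x \<in> T" if "x \<in> S" for x using assms(3) that by auto
  have df: "f differentiable at x" if "x \<in> S" for x using Suc.prems that by simp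
  have dg: "g differentiable at (f x)" if "x \<in> S" for x using Suc.prems fT that by simp
  have eq: "dir_deriv (\<lambda>x. g (f x)) v x = (\<Sum>b\<in>Basis. (dir_deriv f v x \<bullet> b) *\<^sub>R dir_deriv g b (f x))"
    if "x \<in> S" for x v
    by (rule trans[OF frechet_derivative_compose[OF df[OF that] dg[OF that]]
          frechet_derivative_Basis_sum[OF dg[OF that]]])
  have "differentiable_upto_on k (\<lambda>x. \<Sum>b\<in>Basis. (dir_deriv f v x \<bullet> b) *\<^sub>R dir_deriv g b (f x)) S" for v
    using Suc.prems differentiable_upto_on_SucD[OF Suc.prems(1)]
    by (intro differentiable_upto_on_sum differentiable_upto_on_scaleR assms(1) Suc.IH
         differentiable_upto_on_bounded_linear[OF bounded_linear_inner_left]) auto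
  then have "differentiable_upto_on k (dir_deriv (\<lambda>x. g (f x)) v) S" for v
    by (subst differentiable_upto_on_cong[OF assms(1) eq])
  moreover have "(\<lambda>x. g (f x)) differentiable at x" if "x \<in> S" for x
    using differentiable_chain_at[OF df[OF that] dg[OF that]] by (simp add: o_def)
  ultimately show ?case by simp
qed

lemma smooth_on_cong:
  "open S \<Longrightarrow> (\<And>x. x \<in> S \<Longrightarrow> f x = g x) \<Longrightarrow> smooth_on f S \<longleftrightarrow> smooth_on g S"
  unfolding smooth_on_def using differentiable_upto_on_cong by blast

lemma smooth_on_subset: "smooth_on f S \<Longrightarrow> T \<subseteq> S \<Longrightarrow> smooth_on f T"
  unfolding smooth_on_def using differentiable_upto_on_subset by blast

lemma smooth_on_local:
  "(\<And>x. x \<in> S \<Longrightarrow> \<exists>T. open T \<and> x \<in> T \<and> smooth_on f T) \<Longrightarrow> smooth_on f S"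
  unfolding smooth_on_def using differentiable_upto_on_local by metis

lemma smooth_on_imp_differentiable: "smooth_on f S \<Longrightarrow> x \<in> S \<Longrightarrow> f differentiable at x"
  unfolding smooth_on_def by (drule spec[of _ "Suc 0"]) simp

lemma smooth_on_imp_continuous_on: "smooth_on f S \<Longrightarrow> continuous_on S f"
  unfolding smooth_on_def by (drule spec[of _ 0]) simp

lemma smooth_on_dir_deriv: "smooth_on f S \<Longrightarrow> smooth_on (dir_deriv f v) S"
  unfolding smooth_on_def by (metis differentiable_upto_on.simps(2))

lemma smooth_on_bounded_linear:
  "bounded_linear L \<Longrightarrow> open S \<Longrightarrow> smooth_on f S \<Longrightarrow> smooth_on (\<lambda>x. L (f x)) S"
  unfolding smooth_on_def using differentiable_upto_on_bounded_linear by blast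

lemma smooth_on_const: "smooth_on (\<lambda>x. c) S"
  by (simp add: smooth_on_def differentiable_upto_on_const)

lemma smooth_on_id: "smooth_on (\<lambda>x. x) S"
  by (simp add: smooth_on_def differentiable_upto_on_id)

lemma smooth_on_add: "open S \<Longrightarrow> smooth_on f S \<Longrightarrow> smooth_on g S \<Longrightarrow> smooth_on (\<lambda>x. f x + g x) S"
  by (simp add: smooth_on_def differentiable_upto_on_add)

lemma smooth_on_sum:
  "open S \<Longrightarrow> (\<And>i. i \<in> I \<Longrightarrow> smooth_on (f i) S) \<Longrightarrow> smooth_on (\<lambda>x. \<Sum>i\<in>I. f i x) S"
  by (simp add: smooth_on_def differentiable_upto_on_sum)

lemma smooth_on_scaleR:
  "open S \<Longrightarrow> smooth_on f S \<Longrightarrow> smooth_on g S \<Longrightarrow> smooth_on (\<lambda>x. f x *\<^sub>R g x) S"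
  by (simp add: smooth_on_def differentiable_upto_on_scaleR)

lemma smooth_on_mult:
  fixes f g :: "'a::euclidean_space \<Rightarrow> real"
  shows "open S \<Longrightarrow> smooth_on f S \<Longrightarrow> smooth_on g S \<Longrightarrow> smooth_on (\<lambda>x. f x * g x) S"
  using smooth_on_scaleR[of S f g] by simp

lemma smooth_on_diff: "open S \<Longrightarrow> smooth_on f S \<Longrightarrow> smooth_on g S \<Longrightarrow> smooth_on (\<lambda>x. f x - g x) S"
  using smooth_on_add[of S f "\<lambda>x. - g x"] smooth_on_bounded_linear[OF bounded_linear_minus[OF bounded_linear_ident], of S g]
  by simp

lemma smooth_on_compose:
  fixes f :: "'a::euclidean_space \<Rightarrow> 'b::euclidean_space" and g :: "'b \<Rightarrow> 'c::real_normed_vector"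
  shows "open S \<Longrightarrow> open T \<Longrightarrow> f ` S \<subseteq> T \<Longrightarrow> smooth_on f S \<Longrightarrow> smooth_on g T \<Longrightarrow> smooth_on (\<lambda>x. g (f x)) S"
  unfolding smooth_on_def using differentiable_upto_on_compose by blast

lemma smooth_on_Pair:
  assumes "open S" "smooth_on f S" "smooth_on g S"
  shows "smooth_on (\<lambda>x. (f x, g x)) S"
proof -
  have "smooth_on (\<lambda>x. (f x, 0) + (0, g x)) S"
    by (intro smooth_on_add assms smooth_on_bounded_linear[of "\<lambda>a. (a, 0)"] smooth_on_bounded_linear[of "\<lambda>a. (0, a)"]
         bounded_linear_Pair bounded_linear_ident bounded_linear_zero)
  then show ?thesis by simp
qed

lemma smooth_on_fst: "open S \<Longrightarrow> smooth_on fst S"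
  and smooth_on_snd: "open S \<Longrightarrow> smooth_on snd S"
  using smooth_on_bounded_linear[OF bounded_linear_fst _ smooth_on_id] smooth_on_bounded_linear[OF bounded_linear_snd _ smooth_on_id]
  by auto

lemma smooth_on_inner:
  fixes f g :: "'a::euclidean_space \<Rightarrow> 'b::euclidean_space"
  assumes "open S" "smooth_on f S" "smooth_on g S"
  shows "smooth_on (\<lambda>x. f x \<bullet> g x) S"
proof -
  have "smooth_on (\<lambda>x. \<Sum>b\<in>Basis. (f x \<bullet> b) * (g x \<bullet> b)) S"
    by (intro smooth_on_sum smooth_on_mult assms smooth_on_bounded_linear[OF bounded_linear_inner_left])
  moreover have "f x \<bullet> g x = (\<Sum>b\<in>Basis. (f x \<bullet> b) * (g x \<bullet> b))" for x
    by (rule euclidean_inner)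
  ultimately show ?thesis by simp
qed

text \<open>A family closed under differentiation replaces explicit formulas for all higher
  derivatives: the induction on the order moves inside the family.\<close>

lemma smooth_on_real_family:
  fixes F :: "(real \<Rightarrow> real) set"
  assumes "\<And>f. f \<in> F \<Longrightarrow> \<exists>f'\<in>F. \<forall>x\<in>S. (f has_real_derivative f' x) (at x)" "open S" "f \<in> F"
  shows "smooth_on f S"
  unfolding smooth_on_def
proof
  fix k
  show "differentiable_upto_on k f S" using assms(3)
  proof (induction k arbitrary: f)
    case 0
    from assms(1)[OF 0] show ?case
      by (auto intro!: continuous_at_imp_continuous_on DERIV_isCont)
  next
    case (Suc k)
    from assms(1)[OF Suc.prems] obtain f' where f': "f' \<in> F" "\<And>x. x \<in> S \<Longrightarrow> (f has_real_derivative f' x) (at x)"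
      by auto
    have eq: "dir_deriv f v x = v *\<^sub>R f' x" if "x \<in> S" for x v
      using f'(2)[OF that] frechet_derivative_eqI[of f "(*) (f' x)" x] by (simp add: has_field_derivative_def)
    have "differentiable_upto_on k (\<lambda>x. v *\<^sub>R f' x) S" for v
      by (intro differentiable_upto_on_bounded_linear[OF bounded_linear_scaleR_right assms(2)] Suc.IH f'(1))
    then have "differentiable_upto_on k (dir_deriv f v) S" for v
      by (subst differentiable_upto_on_cong[OF assms(2) eq])
    then show ?case
      using f'(2) real_differentiable_def by (auto simp: field_differentiable_imp_differentiable field_differentiable_def)
  qed
qed

lemma smooth_on_inverse: "smooth_on (inverse :: real \<Rightarrow> real) {0<..}"
proof (rule smooth_on_real_family[where F = "{\<lambda>x. c * inverse x ^ n |c n. True}"])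
  fix f :: "real \<Rightarrow> real" assume "f \<in> {\<lambda>x. c * inverse x ^ n |c n. True}"
  then obtain c n where f: "f = (\<lambda>x. c * inverse x ^ n)" by auto
  have "(f has_real_derivative (- (c * real n)) * inverse x ^ Suc n) (at x)" if "x \<in> {0<..}" for x
  proof -
    have "(f has_real_derivative c * (real n * inverse x ^ (n - Suc 0) * - (inverse x * 1 * inverse x))) (at x)"
      unfolding f using that by (auto intro!: derivative_eq_intros)
    then show ?thesis using that by (cases n) (simp_all add: mult_ac)
  qed
  then show "\<exists>f'\<in>{\<lambda>x. c * inverse x ^ n |c n. True}. \<forall>x\<in>{0<..}. (f has_real_derivative f' x) (at x)"
    by (intro bexI[of _ "\<lambda>x. (- (c * real n)) * inverse x ^ Suc n"]) blast+
qed (auto intro!: exI[of _ 1])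

lemma smooth_on_divide:
  fixes f g :: "'a::euclidean_space \<Rightarrow> real"
  assumes "open S" "smooth_on f S" "smooth_on g S" "\<And>x. x \<in> S \<Longrightarrow> 0 < g x"
  shows "smooth_on (\<lambda>x. f x / g x) S"
  unfolding divide_inverse
  by (intro smooth_on_mult assms smooth_on_compose[OF _ _ _ assms(3) smooth_on_inverse]) (use assms(4) in auto)

lemma smooth_on_polynomial_function:
  fixes f :: "'a::euclidean_space \<Rightarrow> 'b::euclidean_space"
  assumes "polynomial_function f"
  shows "smooth_on f UNIV"
proof -
  have real: "smooth_on p UNIV" if "real_polynomial_function p" for p :: "'a \<Rightarrow> real"
    using that
    by (induction rule: real_polynomial_function.induct)
      (auto intro: smooth_on_add smooth_on_mult smooth_on_const smooth_on_bounded_linear[OF _ _ smooth_on_id])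
  have "smooth_on (\<lambda>x. \<Sum>b\<in>Basis. (f x \<bullet> b) *\<^sub>R b) UNIV"
    using assms by (intro smooth_on_sum smooth_on_scaleR smooth_on_const real)
      (auto simp: polynomial_function_iff_Basis_inner)
  then show ?thesis by (simp add: euclidean_representation)
qed

section \<open>Flat functions and smooth bumps\<close>

definition flat_exp :: "real poly \<Rightarrow> real \<Rightarrow> real" where
  "flat_exp p x = (if 0 < x then poly p (inverse x) * exp (- inverse x) else 0)"

lemma poly_exp_minus_tendsto_0: "((\<lambda>y. poly p y * exp (- y)) \<longlongrightarrow> 0) at_top" for p :: "real poly"
proof -
  have "((\<lambda>y. \<Sum>i\<le>degree p. coeff p i * (y ^ i / exp y)) \<longlongrightarrow> (\<Sum>i\<le>degree p. coeff p i * 0)) at_top"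
    by (intro tendsto_intros tendsto_power_div_exp_0)
  then show ?thesis
    by (simp add: poly_altdef sum_distrib_right exp_minus divide_inverse mult.assoc)
qed

text \<open>With \<open>y = 1/x\<close>, the derivative of \<open>p(y) exp(-y)\<close> in
  \<open>x\<close> is \<open>y^2 (p(y) - p'(y)) exp(-y)\<close>, and \<open>[:0,0,1:]\<close> is the
  factor \<open>y^2\<close>. At 0 the right difference quotient is \<open>y p(y) exp(-y)\<close>,
  which tends to 0 as \<open>y\<close> grows. So all \<open>flat_exp p\<close> together form a
  family closed under differentiation.\<close>

lemma flat_exp_has_derivative:
  "(flat_exp p has_real_derivative flat_exp ([:0,0,1:] * (p - pderiv p)) x) (at x)"
proof -
  consider "x > 0" | "x < 0" | "x = 0" by linarith
  then show ?thesis
  proof cases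
    case 1
    have "((\<lambda>x. poly p (inverse x) * exp (- inverse x)) has_real_derivative
        flat_exp ([:0,0,1:] * (p - pderiv p)) x) (at x)"
      using 1 by (auto intro!: derivative_eq_intros DERIV_chain2[OF poly_DERIV]
          simp: flat_exp_def field_simps power2_eq_square)
    then show ?thesis
    proof (rule has_field_derivative_transform_within_open)
      show "poly p (inverse y) * exp (- inverse y) = flat_exp p y" if "y \<in> {0<..}" for y
        using that by (simp add: flat_exp_def)
    qed (use 1 in auto)
  next
    case 2
    have "((\<lambda>x. 0) has_real_derivative flat_exp ([:0,0,1:] * (p - pderiv p)) x) (at x)"
      using 2 by (auto simp: flat_exp_def)
    then show ?thesis
    proof (rule has_field_derivative_transform_within_open)
      show "0 = flat_exp p y" if "y \<in> {..<0}" for y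
        using that by (simp add: flat_exp_def)
    qed (use 2 in auto)
  next
    case 3
    have "((\<lambda>y. flat_exp p y / y) \<longlongrightarrow> 0) (at_right 0)"
    proof (rule Lim_transform_eventually)
      show "((\<lambda>y. poly ([:0,1:] * p) (inverse y) * exp (- inverse y)) \<longlongrightarrow> 0) (at_right 0)"
        by (rule filterlim_compose[OF poly_exp_minus_tendsto_0 filterlim_inverse_at_top_right])
      show "\<forall>\<^sub>F y in at_right 0. poly ([:0,1:] * p) (inverse y) * exp (- inverse y) = flat_exp p y / y"
        using eventually_at_right_less[of "0::real"]
        by eventually_elim (simp add: flat_exp_def field_simps)
    qed
    moreover have "((\<lambda>y. flat_exp p y / y) \<longlongrightarrow> 0) (at_left 0)"
      by (rule tendsto_eventually, rule eventually_mono[OF eventually_at_left_real[of "-1" 0]])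
        (auto simp: flat_exp_def)
    ultimately have "((\<lambda>y. flat_exp p y / y) \<longlongrightarrow> 0) (at 0)"
      by (simp add: filterlim_at_split)
    then show ?thesis using 3 by (simp add: has_field_derivative_iff flat_exp_def)
  qed
qed

lemma smooth_on_flat_exp: "smooth_on (flat_exp p) UNIV"
  by (rule smooth_on_real_family[where F = "range flat_exp"]) (use flat_exp_has_derivative in blast)+

text \<open>The usual transition from 0 to 1 over the unit interval. The denominator is positive
  because \<open>x\<close> and \<open>1 - x\<close> are never both at most 0.\<close>

definition smooth_step :: "real \<Rightarrow> real" where
  "smooth_step x = flat_exp 1 x / (flat_exp 1 x + flat_exp 1 (1 - x))"

lemma flat_exp_sum_pos: "0 < flat_exp 1 x + flat_exp 1 (1 - x)"
  by (auto simp: flat_exp_def add_pos_pos)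

lemma smooth_on_smooth_step: "smooth_on smooth_step UNIV"
  unfolding smooth_step_def
  by (intro smooth_on_divide smooth_on_add smooth_on_flat_exp flat_exp_sum_pos
      smooth_on_compose[OF _ _ _ _ smooth_on_flat_exp] smooth_on_diff smooth_on_const smooth_on_id) auto

lemma smooth_step_simps:
  "x \<le> 0 \<Longrightarrow> smooth_step x = 0" "1 \<le> x \<Longrightarrow> smooth_step x = 1" "0 \<le> smooth_step x" "smooth_step x \<le> 1"
  using flat_exp_sum_pos[of x] by (auto simp: smooth_step_def flat_exp_def)

lemma smooth_bump:
  fixes a :: "'a::euclidean_space"
  assumes "0 < r"
  obtains \<eta> :: "'a \<Rightarrow> real" where "smooth_on \<eta> UNIV" "\<And>x. 0 \<le> \<eta> x" "\<And>x. \<eta> x \<le> 1"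
    "\<And>x. x \<in> ball a (r/2) \<Longrightarrow> \<eta> x = 1" "\<And>x. x \<notin> ball a r \<Longrightarrow> \<eta> x = 0"
proof
  \<comment> \<open>The squared distance is smooth also at the centre \<open>a\<close>. The
    coefficients make \<open>?q\<close> at least 1 up to distance \<open>r/2\<close> and at most 0
    from distance \<open>r\<close> on, which are the ranges where \<open>smooth_step\<close> is
    constant.\<close>
  let ?q = "\<lambda>x. 2 - (2 / r\<^sup>2) * ((x - a) \<bullet> (x - a))"
  show "smooth_on (\<lambda>x. smooth_step (?q x)) UNIV"
    by (intro smooth_on_compose[OF _ _ _ _ smooth_on_smooth_step] smooth_on_diff smooth_on_mult
        smooth_on_const smooth_on_inner smooth_on_id) auto
  fix x
  have q: "?q x = 2 - 2 * (dist a x / r)\<^sup>2"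
    by (simp add: power2_norm_eq_inner[symmetric] dist_norm norm_minus_commute power_divide)
  show "smooth_step (?q x) = 1" if "x \<in> ball a (r/2)"
  proof -
    have "dist a x / r \<le> 1/2" using that assms by (simp add: field_simps)
    then have "(dist a x / r)\<^sup>2 \<le> (1/2)\<^sup>2" using assms by (intro power_mono) auto
    moreover have "(1/2)\<^sup>2 \<le> (1/2::real)" by (simp add: power2_eq_square)
    ultimately have "(dist a x / r)\<^sup>2 \<le> 1/2" by (rule order_trans)
    then show ?thesis unfolding q by (intro smooth_step_simps) linarith
  qed
  show "smooth_step (?q x) = 0" if "x \<notin> ball a r"
  proof -
    have "1 \<le> dist a x / r" using that assms by (simp add: field_simps)
    then have "1\<^sup>2 \<le> (dist a x / r)\<^sup>2" by (intro power_mono) auto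
    then show ?thesis unfolding q by (intro smooth_step_simps) simp
  qed
qed (auto simp: smooth_step_simps)

section \<open>Symmetry of second derivatives\<close>

lemma has_real_derivative_along_line:
  fixes f :: "'a::euclidean_space \<Rightarrow> real"
  assumes "f differentiable at (w + a *\<^sub>R u)"
  shows "((\<lambda>a. f (w + a *\<^sub>R u)) has_real_derivative dir_deriv f u (w + a *\<^sub>R u)) (at a)"
proof -
  have "((\<lambda>a. w + a *\<^sub>R u) has_derivative (\<lambda>h. h *\<^sub>R u)) (at a)"
    by (auto intro!: derivative_eq_intros)
  from diff_chain_at[OF this frechet_derivative_worksI[OF assms]]
  have "((\<lambda>a. f (w + a *\<^sub>R u)) has_derivative (\<lambda>h. dir_deriv f (h *\<^sub>R u) (w + a *\<^sub>R u))) (at a)"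
    by (simp add: o_def)
  then show ?thesis
    by (simp add: has_field_derivative_def linear_cmul[OF linear_frechet_derivative[OF assms]] mult.commute
        mult_commute_abs)
qed

text \<open>Two applications of the mean value theorem: along \<open>u\<close> to the increment of
  \<open>f\<close> in direction \<open>v\<close>, then along \<open>v\<close> to the resulting
  derivative. The left hand side is symmetric in \<open>u\<close> and \<open>v\<close>, which is the
  source of the symmetry of mixed derivatives.\<close>

lemma second_difference:
  fixes f :: "'a::euclidean_space \<Rightarrow> real"
  assumes "ball x e \<subseteq> S" "smooth_on f S" "0 < s" "s * (norm u + norm v) < e"
  obtains y where "norm (y - x) \<le> s * (norm u + norm v)"
    "f (x + s *\<^sub>R u + s *\<^sub>R v) - f (x + s *\<^sub>R u) - f (x + s *\<^sub>R v) + f x = s\<^sup>2 * dir_deriv (dir_deriv f u) v y"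
proof -
  have inS: "x + a *\<^sub>R u + b *\<^sub>R v \<in> S \<and> norm ((x + a *\<^sub>R u + b *\<^sub>R v) - x) \<le> s * (norm u + norm v)"
    if "0 \<le> a" "a \<le> s" "0 \<le> b" "b \<le> s" for a b
  proof -
    have "norm (a *\<^sub>R u + b *\<^sub>R v) \<le> a * norm u + b * norm v"
      using norm_triangle_ineq[of "a *\<^sub>R u" "b *\<^sub>R v"] that by simp
    also have "\<dots> \<le> s * (norm u + norm v)"
      using that by (simp add: distrib_left add_mono mult_right_mono)
    finally show ?thesis using assms(1,4) by (auto simp: subset_iff dist_norm norm_minus_commute[of x] add.assoc)
  qed
  have d: "f differentiable at (x + a *\<^sub>R u + b *\<^sub>R v)" "dir_deriv f u differentiable at (x + a *\<^sub>R u + b *\<^sub>R v)"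
    if "0 \<le> a" "a \<le> s" "0 \<le> b" "b \<le> s" for a b
    using inS[OF that] smooth_on_imp_differentiable assms(2) smooth_on_dir_deriv by blast+
  let ?g = "\<lambda>a. f ((x + s *\<^sub>R v) + a *\<^sub>R u) - f (x + a *\<^sub>R u)"
  have "\<exists>z>0. z < s \<and> ?g s - ?g 0 = (s - 0) * (dir_deriv f u ((x + s *\<^sub>R v) + z *\<^sub>R u) - dir_deriv f u (x + z *\<^sub>R u))"
  proof (rule MVT2[OF assms(3)])
    fix z assume "0 \<le> z" "z \<le> s"
    then show "(?g has_real_derivative dir_deriv f u ((x + s *\<^sub>R v) + z *\<^sub>R u) - dir_deriv f u (x + z *\<^sub>R u)) (at z)"
      using d(1)[of z s] d(1)[of z 0] assms(3)
      by (intro DERIV_diff has_real_derivative_along_line) (simp_all add: algebra_simps)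
  qed
  then obtain z where z: "0 < z" "z < s"
    "?g s - ?g 0 = s * (dir_deriv f u ((x + s *\<^sub>R v) + z *\<^sub>R u) - dir_deriv f u (x + z *\<^sub>R u))"
    by auto
  let ?h = "\<lambda>b. dir_deriv f u ((x + z *\<^sub>R u) + b *\<^sub>R v)"
  have "\<exists>t>0. t < s \<and> ?h s - ?h 0 = (s - 0) * dir_deriv (dir_deriv f u) v ((x + z *\<^sub>R u) + t *\<^sub>R v)"
    using d(2)[of z] z by (intro MVT2[OF assms(3)] has_real_derivative_along_line) simp
  then obtain t where t: "0 < t" "t < s" "?h s - ?h 0 = s * dir_deriv (dir_deriv f u) v ((x + z *\<^sub>R u) + t *\<^sub>R v)"
    by auto
  show thesis
  proof
    show "norm (((x + z *\<^sub>R u) + t *\<^sub>R v) - x) \<le> s * (norm u + norm v)"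
      using inS[of z t] z t by simp
    show "f (x + s *\<^sub>R u + s *\<^sub>R v) - f (x + s *\<^sub>R u) - f (x + s *\<^sub>R v) + f x
        = s\<^sup>2 * dir_deriv (dir_deriv f u) v ((x + z *\<^sub>R u) + t *\<^sub>R v)"
      using z(3) t(3) by (simp add: power2_eq_square algebra_simps)
  qed
qed

text \<open>The second difference equals \<open>s\<^sup>2\<close> times either mixed derivative,
  each at some point near \<open>x\<close>. Continuity of both mixed derivatives brings these values
  within any \<open>\<epsilon>\<close> of those at \<open>x\<close>, and exchanging \<open>u\<close>
  and \<open>v\<close> gives the reverse inequality.\<close>

lemma dir_deriv_commute_real:
  fixes f :: "'a::euclidean_space \<Rightarrow> real"
  assumes "open S" "x \<in> S" "smooth_on f S"
  shows "dir_deriv (dir_deriv f u) v x = dir_deriv (dir_deriv f v) u x"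
proof (rule field_le_epsilon[THEN antisym[OF _ field_le_epsilon]])
  have le: "dir_deriv (dir_deriv f u) v x \<le> dir_deriv (dir_deriv f v) u x + \<epsilon>" if e0: "\<epsilon> > 0" for \<epsilon> u v
  proof -
    have c: "isCont (dir_deriv (dir_deriv f u) v) x" for u v
      by (intro continuous_on_eq_continuous_at[OF assms(1), THEN iffD1, rule_format, OF _ assms(2)]
          smooth_on_imp_continuous_on smooth_on_dir_deriv assms(3))
    obtain d1 where d1: "d1 > 0" "\<And>y. dist y x < d1 \<Longrightarrow> dist (dir_deriv (dir_deriv f u) v y) (dir_deriv (dir_deriv f u) v x) < \<epsilon>/2"
      using continuous_at_eps_delta[THEN iffD1, OF c[of u v], rule_format, OF half_gt_zero[OF e0]] by blast
    obtain d2 where d2: "d2 > 0" "\<And>y. dist y x < d2 \<Longrightarrow> dist (dir_deriv (dir_deriv f v) u y) (dir_deriv (dir_deriv f v) u x) < \<epsilon>/2"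
      using continuous_at_eps_delta[THEN iffD1, OF c[of v u], rule_format, OF half_gt_zero[OF e0]] by blast
    obtain e where e: "e > 0" "ball x e \<subseteq> S" using assms openE by blast
    \<comment> \<open>\<open>m\<close> is a radius good for both continuity estimates and for
      staying in \<open>S\<close>; \<open>s\<close> makes every point in play closer than
      \<open>m\<close>. The summand 1 keeps the denominator positive when \<open>u\<close> and
      \<open>v\<close> are both 0.\<close>
    define m where "m = min e (min d1 d2)"
    define s where "s = m / (2 * (norm u + norm v + 1))"
    have m: "m > 0" using e d1 d2 by (simp add: m_def)
    have n: "norm u + norm v + 1 > 0" using norm_ge_zero[of u] norm_ge_zero[of v] by linarith
    have s: "s > 0" using m n by (simp add: s_def)
    have "s * (norm u + norm v) \<le> s * (norm u + norm v + 1)" using s by simp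
    also have "\<dots> = m / 2" using n by (simp add: s_def field_simps)
    also have "\<dots> < m" using m by simp
    finally have sm: "s * (norm u + norm v) < m" .
    then have se: "s * (norm u + norm v) < e" "s * (norm v + norm u) < e" by (auto simp: m_def add.commute)
    obtain y where y: "norm (y - x) \<le> s * (norm u + norm v)"
      "f (x + s *\<^sub>R u + s *\<^sub>R v) - f (x + s *\<^sub>R u) - f (x + s *\<^sub>R v) + f x = s\<^sup>2 * dir_deriv (dir_deriv f u) v y"
      using second_difference[OF e(2) assms(3) s se(1)] .
    obtain z where z: "norm (z - x) \<le> s * (norm v + norm u)"
      "f (x + s *\<^sub>R v + s *\<^sub>R u) - f (x + s *\<^sub>R v) - f (x + s *\<^sub>R u) + f x = s\<^sup>2 * dir_deriv (dir_deriv f v) u z"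
      using second_difference[OF e(2) assms(3) s se(2)] .
    have "s\<^sup>2 * dir_deriv (dir_deriv f u) v y = s\<^sup>2 * dir_deriv (dir_deriv f v) u z"
      using y(2) z(2) by (simp add: algebra_simps)
    then have "dir_deriv (dir_deriv f u) v y = dir_deriv (dir_deriv f v) u z" using s by simp
    moreover have "dist y x < d1" "dist z x < d2"
      using y(1) z(1) sm by (auto simp: dist_norm m_def add.commute)
    ultimately show ?thesis using d1(2)[of y] d2(2)[of z] unfolding dist_real_def by linarith
  qed
  show "\<And>e. 0 < e \<Longrightarrow> dir_deriv (dir_deriv f u) v x \<le> dir_deriv (dir_deriv f v) u x + e" using le .
  show "\<And>e. 0 < e \<Longrightarrow> dir_deriv (dir_deriv f v) u x \<le> dir_deriv (dir_deriv f u) v x + e" using le .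
qed

lemma dir_deriv_inner:
  fixes f :: "'a::euclidean_space \<Rightarrow> 'b::euclidean_space"
  assumes "f differentiable at x"
  shows "dir_deriv (\<lambda>x. f x \<bullet> b) v x = dir_deriv f v x \<bullet> b"
  using frechet_derivative_eqI[OF has_derivative_inner_left[OF frechet_derivative_worksI[OF assms]]] by simp

lemma dir_deriv_commute:
  fixes f :: "'a::euclidean_space \<Rightarrow> 'b::euclidean_space"
  assumes "open S" "x \<in> S" "smooth_on f S"
  shows "dir_deriv (dir_deriv f u) v x = dir_deriv (dir_deriv f v) u x"
proof (rule euclidean_eqI)
  fix b :: 'b
  have *: "dir_deriv (dir_deriv (\<lambda>x. f x \<bullet> b) u) v x = dir_deriv (dir_deriv f u) v x \<bullet> b" for u v
  proof -
    have "dir_deriv (dir_deriv (\<lambda>x. f x \<bullet> b) u) v x = dir_deriv (\<lambda>x. dir_deriv f u x \<bullet> b) v x"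
      using assms dir_deriv_inner[OF smooth_on_imp_differentiable[OF assms(3)]]
      by (intro fun_cong[OF frechet_cong[OF assms(1,2)]]) auto
    also have "\<dots> = dir_deriv (dir_deriv f u) v x \<bullet> b"
      by (intro dir_deriv_inner smooth_on_imp_differentiable[OF smooth_on_dir_deriv[OF assms(3)] assms(2)])
    finally show ?thesis .
  qed
  have "smooth_on (\<lambda>x. f x \<bullet> b) S"
    using smooth_on_bounded_linear[OF bounded_linear_inner_left assms(1,3)] .
  from dir_deriv_commute_real[OF assms(1,2) this, of u v] show
    "dir_deriv (dir_deriv f u) v x \<bullet> b = dir_deriv (dir_deriv f v) u x \<bullet> b" unfolding * .
qed

section \<open>Charts and partitions of unity\<close>

lemma chart_inv_map:
  assumes "is_chart X c" "x \<in> chart_dom c"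
  shows "chart_inv c (chart_map c x) = x"
proof -
  have "inj_on (chart_map c) (topspace (subtopology X (chart_dom c)))"
    using assms(1) unfolding is_chart_def by (metis homeomorphic_imp_injective_map)
  moreover have "topspace (subtopology X (chart_dom c)) = chart_dom c"
    using assms(1) openin_subset unfolding is_chart_def by fastforce
  ultimately show ?thesis using assms(2) by (simp add: chart_inv_def)
qed

lemma chart_map_inv: "p \<in> chart_image c \<Longrightarrow> chart_map c (chart_inv c p) = p"
  by (simp add: chart_inv_def chart_image_def f_inv_into_f)

lemma chart_inv_in_dom: "p \<in> chart_image c \<Longrightarrow> chart_inv c p \<in> chart_dom c"
  by (simp add: chart_inv_def chart_image_def inv_into_into)

lemma chart_map_in_image: "x \<in> chart_dom c \<Longrightarrow> chart_map c x \<in> chart_image c"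
  by (simp add: chart_image_def)

lemma chart_dom_subset: "is_chart X c \<Longrightarrow> chart_dom c \<subseteq> topspace X"
  by (simp add: is_chart_def openin_subset)

lemma open_chart_image: "is_chart X c \<Longrightarrow> open (chart_image c)"
  by (simp add: is_chart_def)

lemma continuous_chart_map:
  "is_chart X c \<Longrightarrow> continuous_map (subtopology X (chart_dom c)) euclidean (chart_map c)"
  unfolding is_chart_def using homeomorphic_imp_continuous_map continuous_map_into_fulltopology by blast

lemma continuous_chart_inv:
  assumes "is_chart X c"
  shows "continuous_map (top_of_set (chart_image c)) X (chart_inv c)"
proof -
  from assms obtain g where g: "homeomorphic_maps (subtopology X (chart_dom c)) (top_of_set (chart_image c)) (chart_map c) g"
    unfolding is_chart_def homeomorphic_map_maps by auto
  then have cg: "continuous_map (top_of_set (chart_image c)) (subtopology X (chart_dom c)) g"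
    and id: "\<And>p. p \<in> chart_image c \<Longrightarrow> chart_map c (g p) = p"
    by (auto simp: homeomorphic_maps_def)
  have "chart_inv c p = g p" if "p \<in> chart_image c" for p
  proof -
    have "g p \<in> chart_dom c"
      using cg that by (auto simp: continuous_map_in_subtopology)
    then show ?thesis using chart_inv_map[OF assms] id[OF that] by metis
  qed
  then show ?thesis
    using continuous_map_into_fulltopology[OF cg]
    by (subst continuous_map_eq) auto
qed

lemma open_chart_map_image:
  assumes "is_chart X c" "openin X U" "U \<subseteq> chart_dom c"
  shows "open (chart_map c ` U)"
proof -
  have "openin (subtopology X (chart_dom c)) U"
    using assms by (meson openin_subtopology_alt is_chart_def openin_open_subtopology)
  then have "openin (top_of_set (chart_image c)) (chart_map c ` U)"
    using assms(1) unfolding is_chart_def by (meson homeomorphic_imp_open_map open_map_def)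
  then show ?thesis
    using assms(1) unfolding is_chart_def by (meson openin_open_trans)
qed

lemma openin_chart_vimage:
  assumes "is_chart X c" "open S"
  shows "openin X {y \<in> chart_dom c. chart_map c y \<in> S}"
proof -
  have "openin (subtopology X (chart_dom c)) {y \<in> topspace (subtopology X (chart_dom c)). chart_map c y \<in> S}"
    using continuous_chart_map[OF assms(1)] assms(2)
    by (intro openin_continuous_map_preimage) auto
  moreover have "{y \<in> topspace (subtopology X (chart_dom c)). chart_map c y \<in> S} = {y \<in> chart_dom c. chart_map c y \<in> S}"
    using chart_dom_subset[OF assms(1)] by auto
  ultimately show ?thesis
    using assms(1) unfolding is_chart_def by (metis openin_trans_full)
qed

lemma compactin_chart_vimage:
  assumes "is_chart X c" "compact K" "K \<subseteq> chart_image c"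
  shows "compactin X {y \<in> chart_dom c. chart_map c y \<in> K}"
proof -
  have "compactin X (chart_inv c ` K)"
    using assms by (intro image_compactin[OF _ continuous_chart_inv]) (auto simp: compactin_subtopology)
  moreover have "chart_inv c ` K = {y \<in> chart_dom c. chart_map c y \<in> K}"
  proof (intro equalityI subsetI)
    fix y assume "y \<in> chart_inv c ` K"
    then obtain p where p: "p \<in> K" "y = chart_inv c p" by auto
    then have "p \<in> chart_image c" using assms(3) by auto
    then show "y \<in> {y \<in> chart_dom c. chart_map c y \<in> K}"
      using p by (simp add: chart_map_inv chart_inv_in_dom)
  next
    fix y assume "y \<in> {y \<in> chart_dom c. chart_map c y \<in> K}"
    then show "y \<in> chart_inv c ` K"
      using chart_inv_map[OF assms(1), of y] by (auto intro!: image_eqI[of _ _ "chart_map c y"])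
  qed
  ultimately show ?thesis by simp
qed

section \<open>Tangent vectors and tensors in an atlas\<close>

locale manifold =
  fixes X :: "'a topology" and A :: "('a, 'e::euclidean_space) chart set"
  assumes Hausdorff: "Hausdorff_space X"
    and is_chart: "c \<in> A \<Longrightarrow> is_chart X c"
    and chart_domains: "(\<Union>c\<in>A. chart_dom c) = topspace X"
    and compatible: "c \<in> A \<Longrightarrow> c' \<in> A \<Longrightarrow> compatible_charts c c'"
begin

lemma chart_cover: "x \<in> topspace X \<longleftrightarrow> (\<exists>c\<in>A. x \<in> chart_dom c)"
  unfolding chart_domains[symmetric] by blast

lemma chart_at: "x \<in> topspace X \<Longrightarrow> chart_at A x \<in> A \<and> x \<in> chart_dom (chart_at A x)"
  unfolding chart_at_def using chart_cover[of x] by (intro someI_ex[of "\<lambda>c. c \<in> A \<and> x \<in> chart_dom c"]) auto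

lemma openin_chart_dom: "c \<in> A \<Longrightarrow> openin X (chart_dom c)"
  using is_chart by (simp add: is_chart_def)

lemma open_overlap: "c \<in> A \<Longrightarrow> c' \<in> A \<Longrightarrow> open (chart_map c ` (chart_dom c \<inter> chart_dom c'))"
  by (intro open_chart_map_image[OF is_chart] openin_Int openin_chart_dom Int_lower1)

lemma smooth_coord_change:
  "c \<in> A \<Longrightarrow> c' \<in> A \<Longrightarrow> smooth_on (coord_change c c') (chart_map c ` (chart_dom c \<inter> chart_dom c'))"
  using compatible[of c c'] by (simp add: compatible_charts_def)

lemma coord_change_has_derivative:
  assumes "c \<in> A" "c' \<in> A" "x \<in> chart_dom c" "x \<in> chart_dom c'"
  shows "(coord_change c c' has_derivative coord_change_deriv c c' x) (at (chart_map c x))"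
  unfolding coord_change_deriv_def
  using smooth_on_imp_differentiable[OF smooth_coord_change[OF assms(1,2)]] assms(3,4)
  by (intro frechet_derivative_worksI) auto

lemma linear_coord_change_deriv:
  assumes "c \<in> A" "c' \<in> A" "x \<in> chart_dom c" "x \<in> chart_dom c'"
  shows "linear (coord_change_deriv c c' x)"
  using coord_change_has_derivative[OF assms] has_derivative_linear by blast

text \<open>The cocycle rule, by differentiating the corresponding identity of coordinate changes on
  the overlap of \<open>c\<close> and \<open>c'\<close>. It puts \<open>coord_vector\<close> into
  the tangent space and makes tensor components comparable between charts.\<close>

lemma coord_change_deriv_chain:
  assumes "c \<in> A" "c' \<in> A" "c'' \<in> A" "x \<in> chart_dom c" "x \<in> chart_dom c'" "x \<in> chart_dom c''"
  shows "coord_change_deriv c' c'' x (coord_change_deriv c c' x w) = coord_change_deriv c c'' x w"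
proof -
  have [simp]: "coord_change c c' (chart_map c x) = chart_map c' x"
    using assms by (simp add: coord_change_def chart_inv_map[OF is_chart])
  have "((coord_change c' c'' \<circ> coord_change c c') has_derivative
      (coord_change_deriv c' c'' x \<circ> coord_change_deriv c c' x)) (at (chart_map c x))"
    using coord_change_has_derivative assms
    by (intro diff_chain_at) auto
  moreover have "coord_change c c'' p = (coord_change c' c'' \<circ> coord_change c c') p"
    if "p \<in> chart_map c ` (chart_dom c \<inter> chart_dom c')" for p
    using that assms by (auto simp: coord_change_def chart_inv_map[OF is_chart])
  then have "frechet_derivative (coord_change c c'') (at (chart_map c x)) =
      frechet_derivative (coord_change c' c'' \<circ> coord_change c c') (at (chart_map c x))"
    using assms by (intro frechet_cong[OF open_overlap[of c c']]) auto
  ultimately show ?thesis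
    by (simp add: coord_change_deriv_def[of c c''] frechet_derivative_eqI)
qed

lemma coord_change_deriv_refl:
  assumes "c \<in> A" "x \<in> chart_dom c"
  shows "coord_change_deriv c c x w = w"
proof -
  have "frechet_derivative (coord_change c c) (at (chart_map c x)) = frechet_derivative (\<lambda>x. x) (at (chart_map c x))"
    using assms by (intro frechet_cong[OF open_overlap[of c c]])
      (auto simp: coord_change_def chart_inv_map[OF is_chart])
  then show ?thesis by (simp add: coord_change_deriv_def frechet_derivative_eqI[OF has_derivative_ident])
qed

lemma coord_vector_in_tangent_space:
  assumes "c \<in> A" "x \<in> chart_dom c"
  shows "coord_vector A c x w \<in> tangent_space A x"
  using assms by (auto simp: coord_vector_def tangent_space_def coord_change_deriv_chain)

lemma coord_vector_same:
  assumes "c \<in> A" "x \<in> chart_dom c"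
  shows "coord_vector A c x w c = w"
  using assms by (simp add: coord_vector_def coord_change_deriv_refl)

lemma tangent_space_eq_coord_vector:
  assumes "c \<in> A" "x \<in> chart_dom c" "v \<in> tangent_space A x"
  shows "coord_vector A c x (v c) = v"
proof
  fix c'
  have "v c' = coord_change_deriv c c' x (v c)" if "c' \<in> A" "x \<in> chart_dom c'"
    using assms that unfolding tangent_space_def by blast
  moreover have "v c' = 0" if "\<not> (c' \<in> A \<and> x \<in> chart_dom c')"
    using assms that unfolding tangent_space_def by blast
  ultimately show "coord_vector A c x (v c) c' = v c'"
    by (simp add: coord_vector_def)
qed

lemma tensor_coord_eq:
  assumes "c \<in> A" "x \<in> chart_dom c" "u \<in> tangent_space A x" "v \<in> tangent_space A x"
  shows "T x u v = tensor_coord A T c (chart_map c x) (u c) (v c)"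
  using assms by (simp add: tensor_coord_def chart_inv_map[OF is_chart] tangent_space_eq_coord_vector)

lemma coord_vector_change:
  assumes "c \<in> A" "c' \<in> A" "x \<in> chart_dom c" "x \<in> chart_dom c'"
  shows "coord_vector A c' x (coord_change_deriv c c' x w) = coord_vector A c x w"
  using assms by (auto simp: coord_vector_def coord_change_deriv_chain)

lemma tensor_coord_change:
  assumes "c \<in> A" "c' \<in> A" "x \<in> chart_dom c" "x \<in> chart_dom c'"
  shows "tensor_coord A T c (chart_map c x) u v =
    tensor_coord A T c' (chart_map c' x) (coord_change_deriv c c' x u) (coord_change_deriv c c' x v)"
  using assms by (simp add: tensor_coord_def chart_inv_map[OF is_chart] coord_vector_change)

text \<open>A bump in the coordinates, extended by 0. The extension is smooth because the support is
  closed in all of \<open>X\<close> and not merely in the chart domain: it is the image of a compact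
  ball, and \<open>X\<close> is Hausdorff.\<close>

lemma chart_bump:
  assumes "c \<in> A" "x \<in> chart_dom c"
  obtains b U K where "smooth_function A b" "\<And>y. 0 \<le> b y" "openin X U" "x \<in> U" "\<And>y. y \<in> U \<Longrightarrow> b y = 1"
    "closedin X K" "K \<subseteq> chart_dom c" "\<And>y. y \<notin> K \<Longrightarrow> b y = 0"
proof -
  note chart = is_chart[OF assms(1)]
  obtain r where r: "r > 0" "cball (chart_map c x) r \<subseteq> chart_image c"
    using open_chart_image[OF chart] chart_map_in_image[OF assms(2)] open_contains_cball by blast
  obtain \<eta> :: "'e \<Rightarrow> real" where \<eta>: "smooth_on \<eta> UNIV" "\<And>p. 0 \<le> \<eta> p" "\<And>p. \<eta> p \<le> 1"
    "\<And>p. p \<in> ball (chart_map c x) (r/2) \<Longrightarrow> \<eta> p = 1" "\<And>p. p \<notin> ball (chart_map c x) r \<Longrightarrow> \<eta> p = 0"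
    using smooth_bump[OF r(1)] by metis
  define K where "K = {y \<in> chart_dom c. chart_map c y \<in> cball (chart_map c x) r}"
  define b where "b = (\<lambda>y. if y \<in> chart_dom c then \<eta> (chart_map c y) else 0)"
  have K: "closedin X K" "K \<subseteq> chart_dom c"
    unfolding K_def using compactin_chart_vimage[OF chart _ r(2)] compactin_imp_closedin[OF Hausdorff] by auto
  have b0: "b y = 0" if "y \<notin> K" for y
    using that \<eta>(5) by (auto simp: b_def K_def)
  have "smooth_on (b \<circ> chart_inv c') (chart_image c')" if c': "c' \<in> A" for c'
  proof (rule smooth_on_local)
    fix p assume p: "p \<in> chart_image c'"
    define y where "y = chart_inv c' p"
    have y: "y \<in> chart_dom c'" "p = chart_map c' y"
      using p by (auto simp: y_def chart_inv_in_dom chart_map_inv)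
    show "\<exists>T. open T \<and> p \<in> T \<and> smooth_on (b \<circ> chart_inv c') T"
    proof (cases "y \<in> chart_dom c")
      case True
      let ?T = "chart_map c' ` (chart_dom c' \<inter> chart_dom c)"
      have "smooth_on (\<lambda>q. \<eta> (coord_change c' c q)) ?T"
        by (rule smooth_on_compose[OF open_overlap[OF c' assms(1)] open_UNIV _ smooth_coord_change[OF c' assms(1)] \<eta>(1)]) simp
      moreover have "(b \<circ> chart_inv c') q = \<eta> (coord_change c' c q)" if "q \<in> ?T" for q
        using that by (auto simp: b_def coord_change_def chart_inv_map[OF is_chart[OF c']])
      ultimately have "smooth_on (b \<circ> chart_inv c') ?T"
        using smooth_on_cong[OF open_overlap[OF c' assms(1)]] by metis
      then show ?thesis
        using True y open_overlap[OF c' assms(1)] by blast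
    next
      case False
      \<comment> \<open>A point outside the domain of \<open>c\<close> lies in the open complement
        of \<open>K\<close>, where \<open>b\<close> vanishes identically.\<close>
      let ?T = "chart_map c' ` (chart_dom c' \<inter> (topspace X - K))"
      have o: "open ?T"
        using K(1) is_chart[OF c'] by (intro open_chart_map_image[OF is_chart[OF c']]) (auto simp: is_chart_def)
      have "(b \<circ> chart_inv c') q = 0" if "q \<in> ?T" for q
        using that b0 by (auto simp: chart_inv_map[OF is_chart[OF c']])
      then have "smooth_on (b \<circ> chart_inv c') ?T"
        using smooth_on_cong[OF o] smooth_on_const by metis
      moreover have "p \<in> ?T"
        using False y K(2) chart_dom_subset[OF is_chart[OF c']] by blast
      ultimately show ?thesis using o by blast
    qed
  qed
  then have "smooth_function A b" by (simp add: smooth_function_def)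
  then show thesis
  proof (rule that)
    show "openin X {y \<in> chart_dom c. chart_map c y \<in> ball (chart_map c x) (r/2)}"
      by (rule openin_chart_vimage[OF chart]) simp
    show "b y = 0" if "y \<notin> K" for y using b0[OF that] .
  qed (use assms r \<eta>(2,4) K in \<open>auto simp: b_def\<close>)
qed

text \<open>By compactness finitely many bumps have a sum \<open>S\<close> that is at least 1
  everywhere, so division by \<open>S\<close> is smooth.\<close>

lemma partition_of_unity_exists:
  assumes "compact_space X"
  shows "\<exists>\<rho>. partition_of_unity X A \<rho>"
proof -
  have "\<exists>c b U K. c \<in> A \<and> smooth_function A b \<and> (\<forall>y. 0 \<le> b y) \<and> openin X U \<and> x \<in> U \<and> (\<forall>y\<in>U. b y = 1) \<and>
    closedin X K \<and> K \<subseteq> chart_dom c \<and> (\<forall>y. y \<notin> K \<longrightarrow> b y = 0)" if "x \<in> topspace X" for x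
  proof -
    from that obtain c where c: "c \<in> A" "x \<in> chart_dom c" using chart_cover by blast
    obtain b U K where "smooth_function A b" "\<And>y. 0 \<le> b y" "openin X U" "x \<in> U" "\<And>y. y \<in> U \<Longrightarrow> b y = 1"
      "closedin X K" "K \<subseteq> chart_dom c" "\<And>y. y \<notin> K \<Longrightarrow> b y = 0"
      using chart_bump[OF c] by metis
    then show ?thesis using c(1) by (intro exI[of _ c] exI[of _ b] exI[of _ U] exI[of _ K]) simp
  qed
  then obtain ch b U K where *: "\<And>x. x \<in> topspace X \<Longrightarrow> ch x \<in> A \<and> smooth_function A (b x) \<and> (\<forall>y. 0 \<le> b x y) \<and>
    openin X (U x) \<and> x \<in> U x \<and> (\<forall>y\<in>U x. b x y = 1) \<and> closedin X (K x) \<and> K x \<subseteq> chart_dom (ch x) \<and> (\<forall>y. y \<notin> K x \<longrightarrow> b x y = 0)"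
    by metis
  obtain F where F: "finite F" "F \<subseteq> topspace X" "topspace X \<subseteq> (\<Union>x\<in>F. U x)"
  proof -
    have "\<exists>\<F>. finite \<F> \<and> \<F> \<subseteq> U ` topspace X \<and> topspace X \<subseteq> \<Union>\<F>"
      using assms * unfolding compact_space_alt by (elim allE[of _ "U ` topspace X"]) blast
    then show thesis using that by (metis finite_subset_image)
  qed
  define S where "S = (\<lambda>y. \<Sum>x\<in>F. b x y)"
  have S1: "1 \<le> S y" if "y \<in> topspace X" for y
  proof -
    from that F(3) obtain x where x: "x \<in> F" "y \<in> U x" by auto
    then have "b x y = 1" using * F(2) by auto
    moreover have "b x y \<le> S y"
      unfolding S_def using F(1,2) x(1) * by (intro member_le_sum) auto
    ultimately show ?thesis by simp
  qed
  \<comment> \<open>The functions are indexed by charts and not by points, so bumps that were built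
    in the same chart are added up.\<close>
  define \<rho> where "\<rho> = (\<lambda>c y. (\<Sum>x\<in>{x\<in>F. ch x = c}. b x y) / S y)"
  have sub: "active_charts A \<rho> \<subseteq> ch ` F"
  proof
    fix c assume "c \<in> active_charts A \<rho>"
    then obtain y where "\<rho> c y \<noteq> 0" by (auto simp: active_charts_def)
    then have "{x\<in>F. ch x = c} \<noteq> {}" by (auto simp: \<rho>_def simp del: Collect_empty_eq)
    then show "c \<in> ch ` F" by auto
  qed
  have zero: "\<rho> c y = 0" if "c \<in> A" "y \<notin> (\<Union>x\<in>{x\<in>F. ch x = c}. K x)" for c y
    using that * F(2) by (auto simp: \<rho>_def intro!: sum.neutral)
  have dom: "(\<Union>x\<in>{x\<in>F. ch x = c}. K x) \<subseteq> chart_dom c" for c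
    using * F(2) by auto
  have "partition_of_unity X A \<rho>"
    unfolding partition_of_unity_def
  proof (intro conjI ballI)
    show "finite (active_charts A \<rho>)" using sub F(1) finite_subset by blast
    fix c assume c: "c \<in> A"
    show "smooth_function A (\<rho> c)"
      unfolding smooth_function_def
    proof
      fix c' assume c': "c' \<in> A"
      note o = open_chart_image[OF is_chart[OF c']]
      have b: "smooth_on (\<lambda>p. b x (chart_inv c' p)) (chart_image c')" if "x \<in> F" for x
        using *[of x] that F(2) c' by (auto simp: smooth_function_def o_def)
      have "0 < S (chart_inv c' p)" if "p \<in> chart_image c'" for p
        using S1[of "chart_inv c' p"] chart_inv_in_dom[OF that] chart_dom_subset[OF is_chart[OF c']]
        by (auto simp: subset_iff intro: less_le_trans[of 0 1])
      then have "smooth_on (\<lambda>p. (\<Sum>x\<in>{x\<in>F. ch x = c}. b x (chart_inv c' p)) / S (chart_inv c' p)) (chart_image c')"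
        using b unfolding S_def by (intro smooth_on_divide smooth_on_sum o) auto
      then show "smooth_on (\<rho> c \<circ> chart_inv c') (chart_image c')"
        by (simp add: \<rho>_def o_def)
    qed
    show "X closure_of {x \<in> topspace X. \<rho> c x \<noteq> 0} \<subseteq> chart_dom c"
    proof -
      have "closedin X (\<Union>x\<in>{x\<in>F. ch x = c}. K x)"
        using * F(1,2) by (intro closedin_Union) auto
      moreover have "{x \<in> topspace X. \<rho> c x \<noteq> 0} \<subseteq> (\<Union>x\<in>{x\<in>F. ch x = c}. K x)"
        using zero[OF c] by blast
      ultimately have "X closure_of {x \<in> topspace X. \<rho> c x \<noteq> 0} \<subseteq> (\<Union>x\<in>{x\<in>F. ch x = c}. K x)"
        by (rule closure_of_minimal[rotated])
      then show ?thesis using dom by blast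
    qed
  next
    fix c y assume "c \<in> A" "y \<in> topspace X"
    then show "0 \<le> \<rho> c y"
      unfolding \<rho>_def using * F(2) S1[of y] by (intro divide_nonneg_nonneg sum_nonneg) auto
  next
    fix y assume y: "y \<in> topspace X"
    have "(\<Sum>c\<in>active_charts A \<rho>. \<rho> c y) = (\<Sum>c\<in>ch ` F. \<rho> c y)"
    proof (rule sum.mono_neutral_left[OF _ sub])
      show "\<forall>c\<in>ch ` F - active_charts A \<rho>. \<rho> c y = 0"
      proof
        fix c assume c: "c \<in> ch ` F - active_charts A \<rho>"
        then have cA: "c \<in> A" using * F(2) by auto
        \<comment> \<open>\<open>active_charts\<close> tests \<open>\<rho> c\<close> only on the
          domain of \<open>c\<close>; outside this domain the support condition gives 0.\<close>
        show "\<rho> c y = 0"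
        proof (cases "y \<in> chart_dom c")
          case True
          then show ?thesis using c cA by (auto simp: active_charts_def)
        next
          case False
          then show ?thesis using zero[OF cA] dom by blast
        qed
      qed
    qed (use F in auto)
    also have "\<dots> = (\<Sum>c\<in>ch ` F. \<Sum>x\<in>{x\<in>F. ch x = c}. b x y) / S y"
      by (simp add: \<rho>_def sum_divide_distrib)
    also have "(\<Sum>c\<in>ch ` F. \<Sum>x\<in>{x\<in>F. ch x = c}. b x y) = S y"
      unfolding S_def by (rule sum.group) (use F in auto)
    finally show "(\<Sum>c\<in>active_charts A \<rho>. \<rho> c y) = 1" using S1[OF y] by simp
  qed
  then show ?thesis by (rule exI[of _ \<rho>])
qed

end

lemma smooth_manifold_imp_manifold: "smooth_manifold X A \<Longrightarrow> manifold X A"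
  unfolding smooth_manifold_def by unfold_locales blast+

section \<open>Integration over a compact Riemannian surface\<close>

lemma continuous_on_zero_extension:
  fixes f :: "'a::t2_space \<Rightarrow> 'b::real_normed_vector"
  assumes "open S" "closed K" "K \<subseteq> S" "continuous_on S f" "\<And>x. x \<in> S - K \<Longrightarrow> f x = 0"
  shows "continuous_on UNIV (\<lambda>x. if x \<in> S then f x else 0)"
proof -
  have "continuous_on (S \<union> - K) (\<lambda>x. if x \<in> S then f x else 0)"
  proof (rule continuous_on_open_Un[OF assms(1)])
    show "open (- K)" using assms(2) by (simp add: open_Compl)
    show "continuous_on S (\<lambda>x. if x \<in> S then f x else 0)"
      using assms(4) by (rule continuous_on_eq) simp
    show "continuous_on (- K) (\<lambda>x. if x \<in> S then f x else 0)"
      by (rule continuous_on_eq[OF continuous_on_const[of _ 0]]) (use assms(5) in auto)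
  qed
  moreover have "S \<union> - K = UNIV" using assms(3) by auto
  ultimately show ?thesis by simp
qed

text \<open>A chart image is just an open set, possibly unbounded. Extension by zero yields a
  continuous function on a box, where integrability is automatic.\<close>

lemma compact_support_integral:
  fixes f :: "'a::euclidean_space \<Rightarrow> real"
  assumes "open S" "compact K" "K \<subseteq> S" "continuous_on S f" "\<And>x. x \<in> S - K \<Longrightarrow> f x = 0" "K \<subseteq> cbox a b"
  shows "integral S f = integral (cbox a b) (\<lambda>x. if x \<in> S then f x else 0)"
    and "f absolutely_integrable_on S"
proof -
  let ?g = "\<lambda>x. if x \<in> S then f x else 0"
  have eq: "(\<lambda>x. if x \<in> cbox a b then ?g x else 0) = ?g"
    using assms(5,6) by fastforce
  have "integral S f = integral UNIV ?g" by (simp add: integral_restrict_UNIV)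
  also have "\<dots> = integral UNIV (\<lambda>x. if x \<in> cbox a b then ?g x else 0)" by (simp only: eq)
  also have "\<dots> = integral (cbox a b) ?g" by (simp only: integral_restrict_UNIV)
  finally show "integral S f = integral (cbox a b) ?g" .
  have "?g absolutely_integrable_on cbox a b"
    using continuous_on_zero_extension[OF assms(1) compact_imp_closed[OF assms(2)] assms(3-5)]
    by (intro absolutely_integrable_continuous) (auto intro: continuous_on_subset)
  then have "(\<lambda>x. if x \<in> cbox a b then ?g x else 0) absolutely_integrable_on UNIV"
    by (simp only: absolutely_integrable_restrict_UNIV)
  then show "f absolutely_integrable_on S" by (simp only: eq absolutely_integrable_restrict_UNIV)
qed

lemma compact_support_absolutely_integrable:
  fixes f :: "'a::euclidean_space \<Rightarrow> real"
  assumes "open S" "compact K" "K \<subseteq> S" "continuous_on S f" "\<And>x. x \<in> S - K \<Longrightarrow> f x = 0"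
  shows "f absolutely_integrable_on S"
proof -
  obtain a b where "K \<subseteq> cbox a b"
    using bounded_subset_cbox_symmetric[OF compact_imp_bounded[OF assms(2)]] by metis
  from compact_support_integral(2)[OF assms this] show ?thesis .
qed

lemma compact_support_integral_eq_0:
  fixes f :: "'a::euclidean_space \<Rightarrow> real"
  assumes S: "open S" and K: "compact K" "K \<subseteq> S" and f: "continuous_on S f" "\<And>x. x \<in> S - K \<Longrightarrow> f x = 0"
    and nonneg: "\<And>x. x \<in> S \<Longrightarrow> 0 \<le> f x" and "integral S f = 0" and "x \<in> S"
  shows "f x = 0"
proof -
  \<comment> \<open>Including \<open>x\<close> makes the open box nonempty even if \<open>K\<close>
    is empty, and keeps \<open>x\<close> inside it.\<close>
  obtain a b where ab: "insert x K \<subseteq> box a b"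
    using bounded_subset_box_symmetric[OF compact_imp_bounded[of "insert x K"]] K(1) by (metis compact_insert)
  then have Kc: "K \<subseteq> cbox a b" using box_subset_cbox by blast
  let ?g = "\<lambda>x. if x \<in> S then f x else 0"
  have c: "continuous_on (cbox a b) ?g"
    using continuous_on_zero_extension[OF S compact_imp_closed[OF K(1)] K(2) f] continuous_on_subset by blast
  have "(?g has_integral integral (cbox a b) ?g) (cbox a b)"
    using c by (intro integrable_integral integrable_continuous)
  then have "(?g has_integral 0) (cbox a b)"
    using compact_support_integral(1)[OF S K f Kc] assms(7) by simp
  from _ this have "?g x = 0"
  proof (rule has_integral_0_cbox_imp_0[OF c])
    show "box a b \<noteq> {}" "x \<in> cbox a b" using ab box_subset_cbox[of a b] by blast+
  qed (use nonneg in auto)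
  then show ?thesis using assms(8) by simp
qed

section \<open>Inner products and alternating forms on the plane\<close>

lemma bilinear_real2:
  fixes B :: "real^2 \<Rightarrow> real^2 \<Rightarrow> real"
  assumes "bilinear B"
  shows "B u v = u$1 * v$1 * B (axis 1 1) (axis 1 1) + u$1 * v$2 * B (axis 1 1) (axis 2 1)
    + u$2 * v$1 * B (axis 2 1) (axis 1 1) + u$2 * v$2 * B (axis 2 1) (axis 2 1)"
proof -
  have rep: "w = w$1 *\<^sub>R axis 1 1 + w$2 *\<^sub>R axis 2 1" for w :: "real^2"
    by (simp add: vec_eq_iff axis_def forall_2)
  have "B u v = B (u$1 *\<^sub>R axis 1 1 + u$2 *\<^sub>R axis 2 1) (v$1 *\<^sub>R axis 1 1 + v$2 *\<^sub>R axis 2 1)"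
    using rep by metis
  then show ?thesis
    by (simp add: bilinear_ladd[OF assms] bilinear_radd[OF assms] bilinear_lmul[OF assms] bilinear_rmul[OF assms] algebra_simps)
qed

lemma bilinear_alternating:
  fixes a :: "'a::real_vector \<Rightarrow> 'a \<Rightarrow> real"
  assumes "bilinear a" "\<And>v. a v v = 0"
  shows "a u v = - a v u"
proof -
  have "a (u + v) (u + v) = (a u u + a u v) + (a v u + a v v)"
    by (simp only: bilinear_ladd[OF assms(1)] bilinear_radd[OF assms(1)])
  then show ?thesis using assms(2)[of u] assms(2)[of v] assms(2)[of "u + v"] by linarith
qed

text \<open>\<open>d\<close> is the determinant of the frame, \<open>D\<close> the Gram determinant
  of \<open>G\<close>, and \<open>W\<close> the wedge of the dual coframe on the standard basis.
  Expanding gives \<open>W = d * D\<close>, and the Gram determinant of the frame itself gives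
  \<open>d\<^sup>2 * D = 1\<close>. Thus \<open>W\<close> depends on the frame only through its
  sign, the sign of \<open>d\<close>.\<close>

lemma orthonormal_frame_real2:
  fixes G :: "real^2 \<Rightarrow> real^2 \<Rightarrow> real" and E :: "2 \<Rightarrow> real^2"
  assumes G: "bilinear G" "\<And>u v. G u v = G v u" and E: "\<And>i j. G (E i) (E j) = (if i = j then 1 else 0)"
  defines "d \<equiv> E 1$1 * E 2$2 - E 1$2 * E 2$1"
    and "W \<equiv> G (E 1) (axis 1 1) * G (E 2) (axis 2 1) - G (E 1) (axis 2 1) * G (E 2) (axis 1 1)"
    and "D \<equiv> G (axis 1 1) (axis 1 1) * G (axis 2 1) (axis 2 1) - (G (axis 1 1) (axis 2 1))\<^sup>2"
  shows "W * d = 1" "W\<^sup>2 = D"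
    "\<lbrakk>bilinear a; \<And>v. a v v = 0\<rbrakk> \<Longrightarrow> a (axis 1 1) (axis 2 1) = a (E 1) (E 2) * W"
proof -
  have comp: "(axis 1 1 :: real^2) $ 1 = 1" "(axis 1 1 :: real^2) $ 2 = 0" "(axis 2 1 :: real^2) $ 1 = 0" "(axis 2 1 :: real^2) $ 2 = 1"
    by (simp_all add: axis_def)
  have sym: "G (axis 2 1) (axis 1 1) = G (axis 1 1) (axis 2 1)" by (rule G(2))
  have ex: "G u (axis 1 1) = u$1 * G (axis 1 1) (axis 1 1) + u$2 * G (axis 1 1) (axis 2 1)"
      "G u (axis 2 1) = u$1 * G (axis 1 1) (axis 2 1) + u$2 * G (axis 2 1) (axis 2 1)" for u
    by (subst bilinear_real2[OF G(1)], simp add: comp sym)+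
  have WD: "W = d * D"
    unfolding W_def d_def D_def ex[of "E 1"] ex[of "E 2"] by algebra
  have "d\<^sup>2 * D = G (E 1) (E 1) * G (E 2) (E 2) - (G (E 1) (E 2))\<^sup>2"
    unfolding d_def D_def bilinear_real2[OF G(1), of "E 1"] bilinear_real2[OF G(1), of "E 2"] sym
    by algebra
  then have dD: "d\<^sup>2 * D = 1" by (simp add: E)
  then show Wd: "W * d = 1" by (simp add: WD power2_eq_square mult_ac)
  have "W\<^sup>2 = (d\<^sup>2 * D) * D" unfolding WD by algebra
  then show "W\<^sup>2 = D" by (simp add: dD)
  assume a: "bilinear a" "\<And>v. a v v = 0"
  note anti = bilinear_alternating[OF a, of "axis 2 1" "axis 1 1"]
  have "a (E 1) (E 2) = d * a (axis 1 1) (axis 2 1)"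
    unfolding d_def bilinear_real2[OF a(1), of "E 1"] anti a(2) by (simp add: algebra_simps)
  then show "a (axis 1 1) (axis 2 1) = a (E 1) (E 2) * W"
    using Wd by (simp add: mult_ac)
qed

text \<open>Positive orientation comes for free: the first vector is a positive multiple of
  \<open>axis 1 1\<close>, and orthogonalising \<open>axis 2 1\<close> against it leaves the second
  coordinate equal to 1.\<close>

lemma gram_schmidt_real2:
  fixes G :: "real^2 \<Rightarrow> real^2 \<Rightarrow> real"
  assumes G: "bilinear G" "\<And>u v. G u v = G v u" "\<And>u. u \<noteq> 0 \<Longrightarrow> 0 < G u u"
  obtains E :: "2 \<Rightarrow> real^2" where "\<And>i j. G (E i) (E j) = (if i = j then 1 else 0)"
    "0 < E 1$1 * E 2$2 - E 1$2 * E 2$1"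
proof -
  let ?e = "axis 1 1 :: real^2" and ?f = "axis 2 1 :: real^2"
  note bl = bilinear_ladd[OF G(1)] bilinear_radd[OF G(1)] bilinear_lmul[OF G(1)] bilinear_rmul[OF G(1)]
    bilinear_lsub[OF G(1)] bilinear_rsub[OF G(1)]
  define r where "r = sqrt (G ?e ?e)"
  have r: "0 < r" "r * r = G ?e ?e" using G(3)[of ?e] by (simp_all add: r_def axis_eq_0_iff)
  define n where "n = (1/r) *\<^sub>R ?e"
  have nn: "G n n = 1" using r(1) by (simp add: n_def bl r(2)[symmetric])
  define m where "m = ?f - G n ?f *\<^sub>R n"
  have nm: "G n m = 0" by (simp add: m_def bl nn)
  have "m $ 2 = 1" by (simp add: m_def n_def axis_def)
  then have "m \<noteq> 0" by (metis zero_index zero_neq_one)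
  define s where "s = sqrt (G m m)"
  have s: "0 < s" "s * s = G m m" using G(3)[OF \<open>m \<noteq> 0\<close>] by (simp_all add: s_def)
  define E where "E = (\<lambda>i::2. if i = 1 then n else (1/s) *\<^sub>R m)"
  show thesis
  proof
    show "0 < E 1$1 * E 2$2 - E 1$2 * E 2$1"
      using r s \<open>m $ 2 = 1\<close> by (simp add: E_def n_def axis_def)
    show "G (E i) (E j) = (if i = j then 1 else 0)" for i j
    proof -
      have "G (E 2) (E 2) = 1" using s(1) by (simp add: E_def bl s(2)[symmetric])
      moreover have "G (E 1) (E 2) = 0" "G (E 2) (E 1) = 0" using nm G(2)[of m n] by (simp_all add: E_def bl)
      moreover have "G (E 1) (E 1) = 1" by (simp add: E_def nn)
      ultimately show ?thesis using exhaust_2[of i] exhaust_2[of j] by auto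
    qed
  qed
qed

section \<open>A compact oriented surface and its partition of unity\<close>

locale compact_surface =
  fixes X :: "'a topology" and A :: "('a, real^2) chart set"
  assumes oriented: "oriented_manifold X A" and compact: "compact_space X"

sublocale compact_surface \<subseteq> manifold X A
  by (rule smooth_manifold_imp_manifold[OF oriented[unfolded oriented_manifold_def, THEN conjunct1]])

context compact_surface
begin

text \<open>The very term that \<open>integral_2form\<close> contains, so every integral unfolds to
  this one partition.\<close>

definition pou :: "('a, real^2) chart \<Rightarrow> 'a \<Rightarrow> real" where
  "pou = (SOME \<rho>. partition_of_unity X A \<rho>)"

lemma partition_of_unity_pou: "partition_of_unity X A pou"
  unfolding pou_def using partition_of_unity_exists[OF compact] by (rule someI_ex)

definition csupp :: "('a, real^2) chart \<Rightarrow> 'a set" where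
  "csupp c = X closure_of {x \<in> topspace X. pou c x \<noteq> 0}"

definition supp :: "('a, real^2) chart \<Rightarrow> (real^2) set" where
  "supp c = chart_map c ` csupp c"

lemma finite_active: "finite (active_charts A pou)"
  using partition_of_unity_pou unfolding partition_of_unity_def by blast

lemma active_subset: "c \<in> active_charts A pou \<Longrightarrow> c \<in> A"
  by (simp add: active_charts_def)

lemma pou_nonneg: "c \<in> A \<Longrightarrow> x \<in> topspace X \<Longrightarrow> 0 \<le> pou c x"
  using partition_of_unity_pou unfolding partition_of_unity_def by blast

lemma smooth_pou: "c \<in> A \<Longrightarrow> smooth_function A (pou c)"
  using partition_of_unity_pou unfolding partition_of_unity_def by blast

lemma sum_pou: "x \<in> topspace X \<Longrightarrow> (\<Sum>c\<in>active_charts A pou. pou c x) = 1"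
  using partition_of_unity_pou unfolding partition_of_unity_def by blast

lemma csupp_subset: "c \<in> A \<Longrightarrow> csupp c \<subseteq> chart_dom c"
  using partition_of_unity_pou unfolding partition_of_unity_def csupp_def by blast

lemma compactin_csupp: "compactin X (csupp c)"
  unfolding csupp_def using compact by (simp add: closedin_compact_space)

lemma pou_0_outside_csupp: "x \<in> topspace X \<Longrightarrow> x \<notin> csupp c \<Longrightarrow> pou c x = 0"
  using closure_of_subset[of "{x \<in> topspace X. pou c x \<noteq> 0}" X] unfolding csupp_def by blast

lemma compact_supp:
  assumes "c \<in> A" shows "compact (supp c)" "supp c \<subseteq> chart_image c"
proof -
  have "compactin (subtopology X (chart_dom c)) (csupp c)"
    using csupp_subset[OF assms] compactin_csupp by (simp add: compactin_subtopology)
  then have "compactin euclidean (supp c)"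
    unfolding supp_def using continuous_chart_map[OF is_chart[OF assms]] by (rule image_compactin)
  then show "compact (supp c)" by simp
  show "supp c \<subseteq> chart_image c"
    using csupp_subset[OF assms] by (auto simp: supp_def chart_image_def)
qed

lemma chart_inv_in_topspace: "c \<in> A \<Longrightarrow> p \<in> chart_image c \<Longrightarrow> chart_inv c p \<in> topspace X"
  by (rule subsetD[OF chart_dom_subset[OF is_chart] chart_inv_in_dom])

lemma pou_0_outside_supp:
  assumes "c \<in> A" "p \<in> chart_image c" "p \<notin> supp c"
  shows "pou c (chart_inv c p) = 0"
proof (rule pou_0_outside_csupp[OF chart_inv_in_topspace[OF assms(1,2)]], rule notI)
  assume "chart_inv c p \<in> csupp c"
  then have "chart_map c (chart_inv c p) \<in> supp c" unfolding supp_def by (rule imageI)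
  then show False using assms(3) by (simp add: chart_map_inv[OF assms(2)])
qed

lemma continuous_pou:
  "c \<in> A \<Longrightarrow> c' \<in> A \<Longrightarrow> continuous_on (chart_image c) (\<lambda>p. pou c' (chart_inv c p))"
  using smooth_pou[of c'] by (auto simp: smooth_function_def o_def dest: smooth_on_imp_continuous_on)

lemma pou_integrable:
  assumes "c \<in> A" "continuous_on (chart_image c) F"
  shows "(\<lambda>p. pou c (chart_inv c p) * F p) integrable_on chart_image c"
  by (intro absolutely_integrable_on_def[THEN iffD1, THEN conjunct1]
      compact_support_absolutely_integrable[OF open_chart_image[OF is_chart] compact_supp] continuous_intros continuous_pou assms)
    (auto simp: pou_0_outside_supp assms)

lemma integral_2form_pou:
  "integral_2form X A \<alpha> = (\<Sum>c\<in>active_charts A pou. integral (chart_image c)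
     (\<lambda>p. pou c (chart_inv c p) * tensor_coord A \<alpha> c p (axis 1 1) (axis 2 1)))"
  by (simp add: integral_2form_def pou_def Let_def)

text \<open>In dimension two an alternating bilinear form is determined by one component, so
  continuity is asked of that component only.\<close>

definition continuous_2form :: "('a, real^2) tensor2 \<Rightarrow> bool" where
  "continuous_2form \<alpha> \<longleftrightarrow> (\<forall>c\<in>A. continuous_on (chart_image c) (\<lambda>p. tensor_coord A \<alpha> c p (axis 1 1) (axis 2 1)) \<and>
     (\<forall>p\<in>chart_image c. bilinear (tensor_coord A \<alpha> c p) \<and> (\<forall>v. tensor_coord A \<alpha> c p v v = 0)))"

end

locale compact_riemannian_surface = compact_surface +
  fixes g :: "('a, real^2) tensor2"
  assumes metric: "riemannian_metric X A g"
begin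

lemma metric_coord:
  assumes "c \<in> A" "p \<in> chart_image c"
  shows "bilinear (tensor_coord A g c p)" "tensor_coord A g c p u v = tensor_coord A g c p v u"
    "u \<noteq> 0 \<Longrightarrow> 0 < tensor_coord A g c p u u"
proof -
  have x: "chart_inv c p \<in> topspace X" "chart_inv c p \<in> chart_dom c"
    using chart_inv_in_topspace[OF assms] chart_inv_in_dom[OF assms(2)] by auto
  have T: "coord_vector A c (chart_inv c p) w \<in> tangent_space A (chart_inv c p)" for w
    using assms(1) x by (intro coord_vector_in_tangent_space)
  show "bilinear (tensor_coord A g c p)"
    using metric assms by (simp add: riemannian_metric_def smooth_tensor2_def)
  show "tensor_coord A g c p u v = tensor_coord A g c p v u"
    using metric T x unfolding riemannian_metric_def tensor_coord_def by blast
  assume "u \<noteq> 0"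
  then have "coord_vector A c (chart_inv c p) u \<noteq> (\<lambda>c. 0)"
    using coord_vector_same[OF assms(1) x(2)] by metis
  then show "0 < tensor_coord A g c p u u"
    using metric T x unfolding riemannian_metric_def tensor_coord_def by blast
qed

text \<open>Passing to another chart multiplies the matrix of the frame by the transposed Jacobian,
  whose determinant is positive in an oriented atlas. Hence a single chart decides.\<close>

lemma positive_frame_iff:
  assumes "c \<in> A" "x \<in> chart_dom c" "\<And>i. e i \<in> tangent_space A x"
  shows "positive_frame A x e \<longleftrightarrow> 0 < e 1 c$1 * e 2 c$2 - e 1 c$2 * e 2 c$1"
proof -
  have "0 < det (\<chi> i. e i c') \<longleftrightarrow> 0 < det (\<chi> i. e i c)" if "c' \<in> A" "x \<in> chart_dom c'" for c'
  proof -
    let ?D = "coord_change_deriv c c' x"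
    have "(\<chi> i. e i c') = (\<chi> i. e i c) ** transpose (matrix ?D)"
    proof -
      have "e i c' = matrix ?D *v e i c" for i
      proof -
        have "e i c' = ?D (e i c)"
          using assms(1,2) assms(3)[of i] that unfolding tangent_space_def by blast
        then show ?thesis
          using matrix_vector_mul(2)[OF linear_coord_change_deriv[OF assms(1) that(1) assms(2) that(2)]] by metis
      qed
      then show ?thesis
        by (simp add: vec_eq_iff matrix_matrix_mult_def matrix_vector_mult_def transpose_def mult.commute)
    qed
    then have "det (\<chi> i. e i c') = det (\<chi> i. e i c) * det (matrix ?D)"
      by (simp add: det_mul det_transpose)
    moreover have "0 < det (matrix ?D)"
      using oriented that assms(1,2) unfolding oriented_manifold_def by blast
    ultimately show ?thesis by (simp add: zero_less_mult_iff)
  qed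
  then have "positive_frame A x e \<longleftrightarrow> 0 < det (\<chi> i. e i c)"
    unfolding positive_frame_def using assms(1,2) by blast
  then show ?thesis by (simp add: det_2)
qed

lemma orthonormal_frame_coord:
  assumes "c \<in> A" "x \<in> chart_dom c" "orthonormal_frame A g x e"
  shows "tensor_coord A g c (chart_map c x) (e i c) (e j c) = (if i = j then 1 else 0)"
  using assms tensor_coord_eq[of c x "e i" "e j" g] by (auto simp: orthonormal_frame_def)

lemma positive_orthonormal_frame_exists:
  assumes "x \<in> topspace X"
  shows "\<exists>e. orthonormal_frame A g x e \<and> positive_frame A x e"
proof -
  obtain c where c: "c \<in> A" "x \<in> chart_dom c" using assms chart_cover by blast
  note p = chart_map_in_image[OF c(2)]
  obtain E :: "2 \<Rightarrow> real^2" where E: "\<And>i j. tensor_coord A g c (chart_map c x) (E i) (E j) = (if i = j then 1 else 0)"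
    "0 < E 1$1 * E 2$2 - E 1$2 * E 2$1"
    using gram_schmidt_real2[OF metric_coord[OF c(1) p]] by metis
  let ?e = "\<lambda>i. coord_vector A c x (E i)"
  have T: "?e i \<in> tangent_space A x" for i using c by (rule coord_vector_in_tangent_space)
  have "orthonormal_frame A g x ?e"
    unfolding orthonormal_frame_def using T E(1) tensor_coord_eq[OF c T T, of g] by (simp add: coord_vector_same[OF c])
  moreover have "positive_frame A x ?e"
    using positive_frame_iff[OF c T] E(2) by (simp add: coord_vector_same[OF c])
  ultimately show ?thesis by (intro exI[of _ ?e]) simp
qed

text \<open>The frame chosen inside \<open>volume_form\<close>; how it varies with \<open>x\<close>
  is unknown.\<close>

definition frame :: "'a \<Rightarrow> 2 \<Rightarrow> ('a, real^2) tangent" where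
  "frame x = (SOME e. orthonormal_frame A g x e \<and> positive_frame A x e)"

lemma frame: "x \<in> topspace X \<Longrightarrow> orthonormal_frame A g x (frame x) \<and> positive_frame A x (frame x)"
  unfolding frame_def
  by (rule someI_ex[of "\<lambda>e. orthonormal_frame A g x e \<and> positive_frame A x e"], rule positive_orthonormal_frame_exists)

section \<open>Densities and integrals of functions\<close>

definition vol :: "('a, real^2) chart \<Rightarrow> real^2 \<Rightarrow> real" where
  "vol c p = tensor_coord A (volume_form A g) c p (axis 1 1) (axis 2 1)"

text \<open>This is the function \<open>u\<close> for which the form \<open>\<alpha>\<close> equals
  \<open>u\<close> times the volume form.\<close>

definition density :: "('a, real^2) tensor2 \<Rightarrow> 'a \<Rightarrow> real" where
  "density \<alpha> x = \<alpha> x (frame x 1) (frame x 2)"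

lemma frame_in_tangent_space: "x \<in> topspace X \<Longrightarrow> frame x i \<in> tangent_space A x"
  using frame[of x] by (simp add: orthonormal_frame_def)

text \<open>\<open>orthonormal_frame_real2\<close> for the components of \<open>frame x\<close> in
  the chart \<open>c\<close>: its \<open>W\<close> is \<open>vol c p\<close>. So \<open>vol\<close>
  is the square root of the determinant of the metric, its sign being that of the positively
  oriented frame.\<close>

lemma vol:
  assumes "c \<in> A" "p \<in> chart_image c"
  shows "0 < vol c p"
    "(vol c p)\<^sup>2 = tensor_coord A g c p (axis 1 1) (axis 1 1) * tensor_coord A g c p (axis 2 1) (axis 2 1)
      - (tensor_coord A g c p (axis 1 1) (axis 2 1))\<^sup>2"
    "\<lbrakk>bilinear (tensor_coord A \<alpha> c p); \<And>v. tensor_coord A \<alpha> c p v v = 0\<rbrakk> \<Longrightarrow>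
      tensor_coord A \<alpha> c p (axis 1 1) (axis 2 1) = density \<alpha> (chart_inv c p) * vol c p"
proof -
  define x where "x = chart_inv c p"
  have x: "x \<in> topspace X" "x \<in> chart_dom c" "chart_map c x = p"
    using chart_inv_in_topspace[OF assms] chart_inv_in_dom[OF assms(2)] chart_map_inv[OF assms(2)] by (auto simp: x_def)
  let ?E = "\<lambda>i. frame x i c"
  have E: "tensor_coord A g c p (?E i) (?E j) = (if i = j then 1 else 0)" for i j
    using orthonormal_frame_coord[OF assms(1) x(2)] frame[OF x(1)] x(3) by auto
  have cv: "g x (frame x i) (coord_vector A c x w) = tensor_coord A g c p (?E i) w" for i w
    using tensor_coord_eq[OF assms(1) x(2) frame_in_tangent_space[OF x(1)] coord_vector_in_tangent_space[OF assms(1) x(2)]]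
    by (simp add: x(3) coord_vector_same[OF assms(1) x(2)])
  have v: "vol c p = tensor_coord A g c p (?E 1) (axis 1 1) * tensor_coord A g c p (?E 2) (axis 2 1)
      - tensor_coord A g c p (?E 1) (axis 2 1) * tensor_coord A g c p (?E 2) (axis 1 1)"
    by (simp add: vol_def tensor_coord_def[of A "volume_form A g"] volume_form_def x_def[symmetric] frame_def[symmetric] cv Let_def)
  note o = orthonormal_frame_real2[of "tensor_coord A g c p" ?E, OF metric_coord(1)[OF assms] metric_coord(2)[OF assms] E,
      folded v]
  show "(vol c p)\<^sup>2 = tensor_coord A g c p (axis 1 1) (axis 1 1) * tensor_coord A g c p (axis 2 1) (axis 2 1)
      - (tensor_coord A g c p (axis 1 1) (axis 2 1))\<^sup>2" by (rule o(2))
  have "0 < ?E 1$1 * ?E 2$2 - ?E 1$2 * ?E 2$1"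
    using positive_frame_iff[OF assms(1) x(2) frame_in_tangent_space[OF x(1)]] frame[OF x(1)] by simp
  then show "0 < vol c p" using o(1) by (metis zero_less_mult_pos2 zero_less_one)
  assume a: "bilinear (tensor_coord A \<alpha> c p)" "\<And>v. tensor_coord A \<alpha> c p v v = 0"
  have "density \<alpha> x = tensor_coord A \<alpha> c p (?E 1) (?E 2)"
    unfolding density_def
    using tensor_coord_eq[OF assms(1) x(2) frame_in_tangent_space[OF x(1)] frame_in_tangent_space[OF x(1)]] x(3) by metis
  then show "tensor_coord A \<alpha> c p (axis 1 1) (axis 2 1) = density \<alpha> (chart_inv c p) * vol c p"
    using o(3)[OF a] by (simp add: x_def)
qed

text \<open>The norm uses an orthonormal frame of its own choice, possibly of the opposite
  orientation, so only squares agree. Both squares times \<open>(vol c p)\<^sup>2\<close> equal the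
  squared component of \<open>\<alpha>\<close> in the chart.\<close>

lemma form2_norm_density:
  assumes "continuous_2form \<alpha>" "x \<in> topspace X"
  shows "(form2_norm A g \<alpha> x)\<^sup>2 = (density \<alpha> x)\<^sup>2"
proof -
  obtain c where c: "c \<in> A" "x \<in> chart_dom c" using assms(2) chart_cover by blast
  define p where "p = chart_map c x"
  have p: "p \<in> chart_image c" "chart_inv c p = x"
    using chart_map_in_image[OF c(2)] chart_inv_map[OF is_chart c(2)] c(1) by (auto simp: p_def)
  have a: "bilinear (tensor_coord A \<alpha> c p)" "\<And>v. tensor_coord A \<alpha> c p v v = 0"
    using assms(1) c p unfolding continuous_2form_def by auto
  define e where "e = (SOME e. orthonormal_frame A g x e)"
  have e: "orthonormal_frame A g x e"
    unfolding e_def using positive_orthonormal_frame_exists[OF assms(2)] by (intro someI_ex[of "orthonormal_frame A g x"]) auto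
  then have eT: "e i \<in> tangent_space A x" for i by (simp add: orthonormal_frame_def)
  let ?a = "tensor_coord A \<alpha> c p"
  have ae: "\<alpha> x (e i) (e j) = ?a (e i c) (e j c)" for i j
    using tensor_coord_eq[OF c eT eT] by (simp add: p_def)
  note anti = bilinear_alternating[OF a]
  \<comment> \<open>The diagonal terms vanish and the two others are equal, which cancels the factor
    \<open>1 / fact 2\<close>.\<close>
  have "form2_inner A g \<alpha> \<alpha> x = (?a (e 1 c) (e 2 c))\<^sup>2"
    unfolding form2_inner_def e_def[symmetric] Let_def ae
    by (simp add: sum_2 a(2) anti[of "e 2 c" "e 1 c"] power2_eq_square)
  then have n: "(form2_norm A g \<alpha> x)\<^sup>2 = (?a (e 1 c) (e 2 c))\<^sup>2"
    by (simp add: form2_norm_def)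
  have E: "tensor_coord A g c p (e i c) (e j c) = (if i = j then 1 else 0)" for i j
    using orthonormal_frame_coord[OF c e] by (simp add: p_def)
  note o = orthonormal_frame_real2[of "tensor_coord A g c p" "\<lambda>i. e i c", OF metric_coord(1)[OF c(1) p(1)] metric_coord(2)[OF c(1) p(1)] E]
  have "(?a (e 1 c) (e 2 c))\<^sup>2 * (vol c p)\<^sup>2 = (?a (axis 1 1) (axis 2 1))\<^sup>2"
    unfolding o(3)[OF a] vol(2)[OF c(1) p(1)] o(2)[symmetric] by (simp add: power_mult_distrib)
  also have "\<dots> = (density \<alpha> x)\<^sup>2 * (vol c p)\<^sup>2"
    unfolding vol(3)[OF c(1) p(1) a] p(2) by (simp add: power_mult_distrib)
  finally show ?thesis using n vol(1)[OF c(1) p(1)] by simp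
qed

text \<open>The pointwise chosen frame need not be continuous. The root of the Gram determinant is a
  formula without the frame; for the same reason \<open>density\<close> is later written as the
  quotient of a component of \<open>\<alpha>\<close> by \<open>vol\<close>.\<close>

lemma continuous_vol:
  assumes "c \<in> A" shows "continuous_on (chart_image c) (vol c)"
proof -
  have "continuous_on (chart_image c) (\<lambda>p. tensor_coord A g c p u v)" for u v
    using metric assms by (auto simp: riemannian_metric_def smooth_tensor2_def intro: smooth_on_imp_continuous_on)
  then have "continuous_on (chart_image c) (\<lambda>p. sqrt (tensor_coord A g c p (axis 1 1) (axis 1 1) * tensor_coord A g c p (axis 2 1) (axis 2 1)
      - (tensor_coord A g c p (axis 1 1) (axis 2 1))\<^sup>2))"
    by (intro continuous_intros)
  moreover have "vol c p = sqrt (tensor_coord A g c p (axis 1 1) (axis 1 1) * tensor_coord A g c p (axis 2 1) (axis 2 1)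
      - (tensor_coord A g c p (axis 1 1) (axis 2 1))\<^sup>2)" if "p \<in> chart_image c" for p
    using vol(1,2)[OF assms that] by (metis less_imp_le real_sqrt_unique)
  ultimately show ?thesis by (simp cong: continuous_on_cong)
qed

definition continuous_fun :: "('a \<Rightarrow> real) \<Rightarrow> bool" where
  "continuous_fun u \<longleftrightarrow> (\<forall>c\<in>A. continuous_on (chart_image c) (\<lambda>p. u (chart_inv c p)))"

definition vol_integral :: "('a \<Rightarrow> real) \<Rightarrow> real" where
  "vol_integral u = (\<Sum>c\<in>active_charts A pou. integral (chart_image c)
     (\<lambda>p. pou c (chart_inv c p) * (u (chart_inv c p) * vol c p)))"

lemma continuous_density:
  assumes "continuous_2form \<alpha>" shows "continuous_fun (density \<alpha>)"
  unfolding continuous_fun_def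
proof
  fix c assume c: "c \<in> A"
  have "continuous_on (chart_image c) (\<lambda>p. tensor_coord A \<alpha> c p (axis 1 1) (axis 2 1) / vol c p)"
    using assms c vol(1)[OF c] by (intro continuous_intros continuous_vol) (force simp: continuous_2form_def)+
  moreover have "density \<alpha> (chart_inv c p) = tensor_coord A \<alpha> c p (axis 1 1) (axis 2 1) / vol c p" if "p \<in> chart_image c" for p
    using vol(1)[OF c that] vol(3)[OF c that] assms c that by (simp add: continuous_2form_def)
  ultimately show "continuous_on (chart_image c) (\<lambda>p. density \<alpha> (chart_inv c p))"
    by (simp cong: continuous_on_cong)
qed

lemma vol_integral_integrable:
  assumes "continuous_fun u" "c \<in> A"
  shows "(\<lambda>p. pou c (chart_inv c p) * (u (chart_inv c p) * vol c p)) integrable_on chart_image c"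
  using assms by (intro pou_integrable continuous_intros continuous_vol) (auto simp: continuous_fun_def)

lemma vol_integral_linear:
  assumes "continuous_fun u" "continuous_fun v"
  shows "vol_integral (\<lambda>x. a * u x + b * v x) = a * vol_integral u + b * vol_integral v"
proof -
  define G where "G w c p = pou c (chart_inv c p) * (w (chart_inv c p) * vol c p)" for w c p
  have "integral (chart_image c) (G (\<lambda>x. a * u x + b * v x) c) =
    a * integral (chart_image c) (G u c) + b * integral (chart_image c) (G v c)" if c: "c \<in> A" for c
  proof (rule integral_unique)
    have "((\<lambda>p. a * G u c p + b * G v c p) has_integral
        (a * integral (chart_image c) (G u c) + b * integral (chart_image c) (G v c))) (chart_image c)"
      using vol_integral_integrable[OF assms(1) c] vol_integral_integrable[OF assms(2) c]
      by (intro has_integral_add has_integral_mult_right integrable_integral) (simp_all add: G_def[abs_def])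
    moreover have "(\<lambda>p. a * G u c p + b * G v c p) = G (\<lambda>x. a * u x + b * v x) c"
      by (simp add: G_def fun_eq_iff algebra_simps)
    ultimately show "(G (\<lambda>x. a * u x + b * v x) c has_integral
        (a * integral (chart_image c) (G u c) + b * integral (chart_image c) (G v c))) (chart_image c)"
      by simp
  qed
  then have "(\<Sum>c\<in>active_charts A pou. integral (chart_image c) (G (\<lambda>x. a * u x + b * v x) c)) =
      (\<Sum>c\<in>active_charts A pou. a * integral (chart_image c) (G u c) + b * integral (chart_image c) (G v c))"
    using active_subset by (intro sum.cong refl) blast
  then show ?thesis
    by (simp add: vol_integral_def G_def[abs_def] sum.distrib sum_distrib_left)
qed

lemma vol_integral_term_nonneg:
  assumes "continuous_fun u" "\<And>x. x \<in> topspace X \<Longrightarrow> 0 \<le> u x" "c \<in> A"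
  shows "0 \<le> integral (chart_image c) (\<lambda>p. pou c (chart_inv c p) * (u (chart_inv c p) * vol c p))"
  using assms vol(1)[OF assms(3)] pou_nonneg[OF assms(3)] chart_inv_in_topspace[OF assms(3)]
  by (intro integral_nonneg vol_integral_integrable mult_nonneg_nonneg) (auto intro: less_imp_le)

lemma vol_integral_nonneg:
  assumes "continuous_fun u" "\<And>x. x \<in> topspace X \<Longrightarrow> 0 \<le> u x"
  shows "0 \<le> vol_integral u"
  unfolding vol_integral_def using vol_integral_term_nonneg[OF assms] active_subset by (intro sum_nonneg) auto

text \<open>All terms of the sum over charts are nonnegative, hence 0. Some \<open>pou c\<close> is
  nonzero at \<open>x\<close>, and in that chart a continuous nonnegative integrand of compact
  support with integral 0 vanishes.\<close>

lemma vol_integral_eq_0: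
  assumes "continuous_fun u" "\<And>x. x \<in> topspace X \<Longrightarrow> 0 \<le> u x" "vol_integral u = 0" "x \<in> topspace X"
  shows "u x = 0"
proof -
  have zero: "integral (chart_image c) (\<lambda>p. pou c (chart_inv c p) * (u (chart_inv c p) * vol c p)) = 0"
    if "c \<in> active_charts A pou" for c
    using assms(3) that vol_integral_term_nonneg[OF assms(1,2)] active_subset finite_active
    unfolding vol_integral_def by (subst (asm) sum_nonneg_eq_0_iff) auto
  have "\<exists>c\<in>active_charts A pou. pou c x \<noteq> 0"
    using sum_pou[OF assms(4)] by (metis sum.neutral zero_neq_one)
  then obtain c where c: "c \<in> active_charts A pou" "pou c x \<noteq> 0" by auto
  then have cA: "c \<in> A" using active_subset by auto
  have "x \<in> chart_dom c"
    using csupp_subset[OF cA] pou_0_outside_csupp[OF assms(4), of c] c(2) by blast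
  then have p: "chart_map c x \<in> chart_image c" "chart_inv c (chart_map c x) = x"
    using chart_map_in_image[of x c] chart_inv_map[OF is_chart[OF cA]] by auto
  let ?f = "\<lambda>p. pou c (chart_inv c p) * (u (chart_inv c p) * vol c p)"
  have "continuous_on (chart_image c) ?f"
    using assms(1) cA by (intro continuous_intros continuous_pou continuous_vol) (auto simp: continuous_fun_def)
  from _ _ _ zero[OF c(1)] p(1) have "?f (chart_map c x) = 0"
  proof (rule compact_support_integral_eq_0[OF open_chart_image[OF is_chart[OF cA]] compact_supp[OF cA]])
    show "continuous_on (chart_image c) ?f" by fact
    show "?f p = 0" if "p \<in> chart_image c - supp c" for p
      using pou_0_outside_supp[OF cA, of p] that by simp
    show "0 \<le> ?f p" if "p \<in> chart_image c" for p
      using pou_nonneg[OF cA chart_inv_in_topspace[OF cA that]] vol(1)[OF cA that] assms(2)[OF chart_inv_in_topspace[OF cA that]]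
      by simp
  qed
  then show ?thesis using c(2) vol(1)[OF cA p(1)] p(2) by simp
qed

lemma vol_integral_cong:
  assumes "\<And>x. x \<in> topspace X \<Longrightarrow> u x = v x"
  shows "vol_integral u = vol_integral v"
  unfolding vol_integral_def using assms chart_inv_in_topspace active_subset
  by (intro sum.cong refl integral_cong) auto

lemma total_volume_eq: "total_volume X A g = vol_integral (\<lambda>x. 1)"
  by (simp add: total_volume_def integral_2form_pou vol_integral_def vol_def)

lemma integral_2form_eq:
  assumes "continuous_2form \<alpha>"
  shows "integral_2form X A \<alpha> = vol_integral (density \<alpha>)"
  unfolding integral_2form_pou vol_integral_def
proof (intro sum.cong refl integral_cong)
  fix c p assume "c \<in> active_charts A pou" "p \<in> chart_image c"
  with assms show "pou c (chart_inv c p) * tensor_coord A \<alpha> c p (axis 1 1) (axis 2 1) =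
      pou c (chart_inv c p) * (density \<alpha> (chart_inv c p) * vol c p)"
    using vol(3)[of c p \<alpha>] active_subset by (simp add: continuous_2form_def)
qed

lemma integral_norm_eq:
  assumes "continuous_2form \<alpha>"
  shows "integral_2form X A (\<lambda>x u v. (form2_norm A g \<alpha> x)\<^sup>2 * volume_form A g x u v) = vol_integral (\<lambda>x. (density \<alpha> x)\<^sup>2)"
  unfolding integral_2form_pou vol_integral_def
proof (intro sum.cong refl integral_cong)
  fix c p assume "c \<in> active_charts A pou" "p \<in> chart_image c"
  with assms show "pou c (chart_inv c p) * tensor_coord A (\<lambda>x u v. (form2_norm A g \<alpha> x)\<^sup>2 * volume_form A g x u v) c p (axis 1 1) (axis 2 1) =
      pou c (chart_inv c p) * ((density \<alpha> (chart_inv c p))\<^sup>2 * vol c p)"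
    using form2_norm_density[of \<alpha> "chart_inv c p"] chart_inv_in_topspace active_subset
    by (simp add: tensor_coord_def vol_def)
qed

text \<open>The integral of \<open>(u - k)\<^sup>2\<close> with \<open>k\<close> the mean of
  \<open>u\<close> is exactly the defect, up to the factor 1/2. This proves the inequality and the
  equality case at once.\<close>

lemma Cauchy_Schwarz:
  assumes "continuous_fun u"
  shows "1 / (2 * vol_integral (\<lambda>x. 1)) * (vol_integral u)\<^sup>2 \<le> 1 / 2 * vol_integral (\<lambda>x. (u x)\<^sup>2)"
    and "1 / (2 * vol_integral (\<lambda>x. 1)) * (vol_integral u)\<^sup>2 = 1 / 2 * vol_integral (\<lambda>x. (u x)\<^sup>2) \<Longrightarrow>
      \<exists>k. \<forall>x\<in>topspace X. u x = k"
proof -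
  have one: "continuous_fun (\<lambda>x. 1)" by (simp add: continuous_fun_def)
  have sq: "continuous_fun (\<lambda>x. (u x)\<^sup>2)"
    using assms by (auto simp: continuous_fun_def intro!: continuous_intros)
  define k where "k = vol_integral u / vol_integral (\<lambda>x. 1)"
  have lin: "continuous_fun (\<lambda>x. 1 * (u x)\<^sup>2 + (- 2 * k) * u x)"
    using assms by (auto simp: continuous_fun_def intro!: continuous_intros)
  have dev: "continuous_fun (\<lambda>x. (u x - k)\<^sup>2)"
    using assms by (auto simp: continuous_fun_def intro!: continuous_intros)
  have "(\<lambda>x. (u x - k)\<^sup>2) = (\<lambda>x. 1 * (1 * (u x)\<^sup>2 + (- 2 * k) * u x) + k\<^sup>2 * 1)"
    by (simp add: fun_eq_iff power2_eq_square algebra_simps)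
  then have exp: "vol_integral (\<lambda>x. (u x - k)\<^sup>2) = vol_integral (\<lambda>x. (u x)\<^sup>2) - 2 * k * vol_integral u + k\<^sup>2 * vol_integral (\<lambda>x. 1)"
    using vol_integral_linear[OF lin one, of 1 "k\<^sup>2"] vol_integral_linear[OF sq assms, of 1 "- 2 * k"] by simp
  have "vol_integral (\<lambda>x. (u x - k)\<^sup>2) = vol_integral (\<lambda>x. (u x)\<^sup>2) - 1 / vol_integral (\<lambda>x. 1) * (vol_integral u)\<^sup>2"
  proof -
    \<comment> \<open>Since \<open>x / 0 = 0\<close>, the identity also covers total volume 0, as
      for an empty surface.\<close>
    have "v - 2 * (a / b) * a + (a / b)\<^sup>2 * b = v - 1 / b * a\<^sup>2" for v a b :: real
      by (cases "b = 0") (simp_all add: field_simps power2_eq_square)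
    then show ?thesis unfolding exp unfolding k_def .
  qed
  then have key: "1 / (2 * vol_integral (\<lambda>x. 1)) * (vol_integral u)\<^sup>2 = 1 / 2 * vol_integral (\<lambda>x. (u x)\<^sup>2) - 1 / 2 * vol_integral (\<lambda>x. (u x - k)\<^sup>2)"
    by (simp add: diff_divide_distrib)
  show "1 / (2 * vol_integral (\<lambda>x. 1)) * (vol_integral u)\<^sup>2 \<le> 1 / 2 * vol_integral (\<lambda>x. (u x)\<^sup>2)"
    unfolding key using vol_integral_nonneg[OF dev] by simp
  assume "1 / (2 * vol_integral (\<lambda>x. 1)) * (vol_integral u)\<^sup>2 = 1 / 2 * vol_integral (\<lambda>x. (u x)\<^sup>2)"
  then have "vol_integral (\<lambda>x. (u x - k)\<^sup>2) = 0" unfolding key by simp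
  then have "(u x - k)\<^sup>2 = 0" if "x \<in> topspace X" for x
    using that by (intro vol_integral_eq_0[OF dev]) simp_all
  then show "\<exists>k. \<forall>x\<in>topspace X. u x = k" by (intro exI[of _ k]) simp
qed

end

section \<open>Smooth approximation of homotopies\<close>

abbreviation local_rep ::
  "('a, 'e) chart \<Rightarrow> ('b, 'f) chart \<Rightarrow> ('a \<Rightarrow> 'b) \<Rightarrow> 'e \<Rightarrow> 'f" where
  "local_rep c d f \<equiv> chart_map d \<circ> f \<circ> chart_inv c"

abbreviation local_dom ::
  "('a, 'e) chart \<Rightarrow> ('b, 'f) chart \<Rightarrow> ('a \<Rightarrow> 'b) \<Rightarrow> 'e set" where
  "local_dom c d f \<equiv> chart_map c ` (chart_dom c \<inter> f -` chart_dom d)"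

lemma local_dom_subset: "local_dom c d f \<subseteq> chart_image c"
  unfolding chart_image_def by (intro image_mono) simp

section \<open>Maps in charts and smoothness near a point\<close>

locale manifold_pair = M: manifold X A + N: manifold Y B
  for X :: "'a topology" and A :: "('a, 'e::euclidean_space) chart set"
    and Y :: "'b topology" and B :: "('b, 'f::euclidean_space) chart set"
begin

lemma local_dom_iff:
  assumes "c \<in> A"
  shows "p \<in> local_dom c d f \<longleftrightarrow> p \<in> chart_image c \<and> f (chart_inv c p) \<in> chart_dom d"
proof
  assume "p \<in> local_dom c d f"
  then obtain x where "x \<in> chart_dom c" "f x \<in> chart_dom d" "p = chart_map c x" by auto
  then show "p \<in> chart_image c \<and> f (chart_inv c p) \<in> chart_dom d"
    using chart_inv_map[OF M.is_chart[OF assms], of x] by (simp add: chart_map_in_image)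
next
  assume "p \<in> chart_image c \<and> f (chart_inv c p) \<in> chart_dom d"
  then show "p \<in> local_dom c d f"
    by (intro image_eqI[of _ _ "chart_inv c p"]) (simp_all add: chart_map_inv chart_inv_in_dom)
qed

lemma open_local_dom:
  assumes "continuous_map X Y f" "c \<in> A" "d \<in> B"
  shows "open (local_dom c d f)"
proof -
  have "openin X (chart_dom c \<inter> {x \<in> topspace X. f x \<in> chart_dom d})"
    using assms M.openin_chart_dom N.openin_chart_dom
    by (intro openin_Int openin_continuous_map_preimage[OF assms(1)])
  moreover have "chart_dom c \<inter> {x \<in> topspace X. f x \<in> chart_dom d} = chart_dom c \<inter> f -` chart_dom d"
    using chart_dom_subset[OF M.is_chart[OF assms(2)]] by fastforce
  ultimately show ?thesis
    by (intro open_chart_map_image[OF M.is_chart[OF assms(2)]]) auto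
qed

lemma local_rep_in_image: "c \<in> A \<Longrightarrow> p \<in> local_dom c d f \<Longrightarrow> local_rep c d f p \<in> chart_image d"
  using local_dom_iff[of c p f d] chart_map_in_image[of "f (chart_inv c p)" d] by simp

lemma continuous_local_rep:
  assumes "continuous_map X Y f" "c \<in> A" "d \<in> B"
  shows "continuous_on (local_dom c d f) (local_rep c d f)"
proof -
  let ?D = "local_dom c d f"
  have "?D \<subseteq> chart_image c" by (rule local_dom_subset)
  then have "continuous_map (top_of_set ?D) X (chart_inv c)"
    using continuous_chart_inv[OF M.is_chart[OF assms(2)]] by (rule continuous_map_from_subtopology_mono[rotated])
  then have "continuous_map (top_of_set ?D) Y (f \<circ> chart_inv c)"
    using assms(1) by (rule continuous_map_compose)
  then have "continuous_map (top_of_set ?D) (subtopology Y (chart_dom d)) (f \<circ> chart_inv c)"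
    unfolding continuous_map_in_subtopology
    by (intro conjI Pi_I) (use local_dom_iff[OF assms(2), of _ f d] in \<open>simp_all only: topspace_euclidean_subtopology o_apply\<close>)
  then have "continuous_map (top_of_set ?D) euclidean (chart_map d \<circ> (f \<circ> chart_inv c))"
    using continuous_chart_map[OF N.is_chart[OF assms(3)]] by (rule continuous_map_compose)
  then show ?thesis by (simp add: comp_assoc)
qed

text \<open>One pair of charts is enough as a witness. The approximation below enlarges the set of
  points where this holds step by step.\<close>

definition smooth_near :: "('a \<Rightarrow> 'b) \<Rightarrow> 'a \<Rightarrow> bool" where
  "smooth_near f x \<longleftrightarrow> (\<exists>c\<in>A. \<exists>d\<in>B. x \<in> chart_dom c \<and> f x \<in> chart_dom d \<and>
     (\<exists>T. open T \<and> chart_map c x \<in> T \<and> smooth_on (local_rep c d f) T))"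

lemma smooth_nearI:
  "c \<in> A \<Longrightarrow> d \<in> B \<Longrightarrow> x \<in> chart_dom c \<Longrightarrow> f x \<in> chart_dom d \<Longrightarrow> open T \<Longrightarrow> chart_map c x \<in> T \<Longrightarrow>
    smooth_on (local_rep c d f) T \<Longrightarrow> smooth_near f x"
  unfolding smooth_near_def by blast

text \<open>Smoothness is carried from the witnessing charts to any others by composing with
  coordinate changes on both sides, near \<open>x\<close> where all four charts are available
  (\<open>W\<close>).\<close>

lemma smooth_nearD:
  assumes cont: "continuous_map X Y f" and "smooth_near f x"
    and c: "c \<in> A" "x \<in> chart_dom c" and d: "d \<in> B" "f x \<in> chart_dom d"
  obtains T where "open T" "chart_map c x \<in> T" "T \<subseteq> local_dom c d f" "smooth_on (local_rep c d f) T"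
proof -
  obtain c' d' T' where c': "c' \<in> A" "x \<in> chart_dom c'" and d': "d' \<in> B" "f x \<in> chart_dom d'"
    and T': "open T'" "chart_map c' x \<in> T'" "smooth_on (local_rep c' d' f) T'"
    using assms(2) unfolding smooth_near_def by blast
  define W where "W = {y \<in> chart_dom c'. chart_map c' y \<in> T'} \<inter> (chart_dom c \<inter> {y \<in> topspace X. f y \<in> chart_dom d \<inter> chart_dom d'})"
  have "openin X {y \<in> topspace X. f y \<in> chart_dom d \<inter> chart_dom d'}"
    by (intro openin_continuous_map_preimage[OF cont] openin_Int N.openin_chart_dom d d')
  then have "openin X W"
    unfolding W_def by (intro openin_Int openin_chart_vimage[OF M.is_chart] M.openin_chart_dom T' c c')
  then have W: "openin X W" "x \<in> W" "W \<subseteq> chart_dom c" "W \<subseteq> chart_dom c'"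
    unfolding W_def using T' c c' d d' chart_dom_subset[OF M.is_chart[OF c(1)]]
    by auto
  define T where "T = chart_map c ` W"
  let ?T'' = "T' \<inter> chart_map c' ` W"
  have openT: "open T" unfolding T_def by (rule open_chart_map_image[OF M.is_chart[OF c(1)] W(1,3)])
  have openT'': "open ?T''" by (intro open_Int T' open_chart_map_image[OF M.is_chart[OF c'(1)] W(1,4)])
  have Winv: "chart_inv c (chart_map c y) = y" "chart_inv c' (chart_map c' y) = y" if "y \<in> W" for y
    using chart_inv_map[OF M.is_chart[OF c(1)]] chart_inv_map[OF M.is_chart[OF c'(1)]] W(3,4) that by auto
  have smooth1: "smooth_on (\<lambda>q. local_rep c' d' f (coord_change c c' q)) T"
  proof (rule smooth_on_compose[OF openT openT''])
    show "coord_change c c' ` T \<subseteq> ?T''"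
      unfolding T_def using Winv by (auto simp: coord_change_def) (auto simp: W_def)
    show "smooth_on (coord_change c c') T"
      using W(3,4) by (intro smooth_on_subset[OF M.smooth_coord_change[OF c(1) c'(1)]]) (auto simp: T_def)
    show "smooth_on (local_rep c' d' f) ?T''" by (rule smooth_on_subset[OF T'(3)]) simp
  qed
  have "smooth_on (\<lambda>q. coord_change d' d (local_rep c' d' f (coord_change c c' q))) T"
  proof (rule smooth_on_compose[OF openT N.open_overlap[OF d'(1) d(1)] _ smooth1 N.smooth_coord_change[OF d'(1) d(1)]])
    show "(\<lambda>q. local_rep c' d' f (coord_change c c' q)) ` T \<subseteq> chart_map d' ` (chart_dom d' \<inter> chart_dom d)"
      unfolding T_def using Winv by (auto simp: coord_change_def) (auto simp: W_def)
  qed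
  moreover have "coord_change d' d (local_rep c' d' f (coord_change c c' q)) = local_rep c d f q" if "q \<in> T" for q
  proof -
    from that obtain y where y: "y \<in> W" "q = chart_map c y" by (auto simp: T_def)
    then have "f y \<in> chart_dom d'" by (simp add: W_def)
    then show ?thesis using y Winv[OF y(1)] chart_inv_map[OF N.is_chart[OF d'(1)]] by (simp add: coord_change_def)
  qed
  ultimately have "smooth_on (local_rep c d f) T" using smooth_on_cong[OF openT] by metis
  moreover have "T \<subseteq> local_dom c d f" "chart_map c x \<in> T" using W(2,3) by (auto simp: T_def W_def)
  ultimately show thesis using that openT by blast
qed

lemma smooth_map_iff:
  "smooth_map X A Y B f \<longleftrightarrow> continuous_map X Y f \<and> (\<forall>x\<in>topspace X. smooth_near f x)"
proof
  assume f: "smooth_map X A Y B f"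
  then have cont: "continuous_map X Y f" by (simp add: smooth_map_def)
  moreover have "smooth_near f x" if x: "x \<in> topspace X" for x
  proof -
    obtain c where c: "c \<in> A" "x \<in> chart_dom c" using x M.chart_cover[of x] by blast
    have "f x \<in> topspace Y" using cont x by (auto simp: continuous_map_def)
    then obtain d where d: "d \<in> B" "f x \<in> chart_dom d" using N.chart_cover[of "f x"] by blast
    show ?thesis
    proof (rule smooth_nearI[OF c(1) d(1) c(2), of f, OF d(2) open_local_dom[OF cont c(1) d(1)]])
      show "smooth_on (local_rep c d f) (local_dom c d f)"
        using f c(1) d(1) unfolding smooth_map_def by blast
    qed (use c d in auto)
  qed
  ultimately show "continuous_map X Y f \<and> (\<forall>x\<in>topspace X. smooth_near f x)" by blast
next
  assume f: "continuous_map X Y f \<and> (\<forall>x\<in>topspace X. smooth_near f x)"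
  have "smooth_on (local_rep c d f) (local_dom c d f)" if c: "c \<in> A" and d: "d \<in> B" for c d
  proof (rule smooth_on_local)
    fix p assume "p \<in> local_dom c d f"
    then obtain x where x: "x \<in> chart_dom c" "f x \<in> chart_dom d" "p = chart_map c x" by auto
    then have "x \<in> topspace X" using chart_dom_subset[OF M.is_chart[OF c]] by blast
    then obtain T where "open T" "chart_map c x \<in> T" "smooth_on (local_rep c d f) T"
      using f smooth_nearD[of f x c d] c d x by metis
    then show "\<exists>T. open T \<and> p \<in> T \<and> smooth_on (local_rep c d f) T" using x(3) by blast
  qed
  then show "smooth_map X A Y B f" using f by (simp add: smooth_map_def)
qed

lemma smooth_near_cong:
  assumes "openin X W" "x \<in> W" "\<And>y. y \<in> W \<Longrightarrow> f y = f' y" "smooth_near f x"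
  shows "smooth_near f' x"
proof -
  obtain c d T where cd: "c \<in> A" "d \<in> B" "x \<in> chart_dom c" "f x \<in> chart_dom d"
    and T: "open T" "chart_map c x \<in> T" "smooth_on (local_rep c d f) T"
    using assms(4) unfolding smooth_near_def by blast
  let ?T = "T \<inter> chart_map c ` (chart_dom c \<inter> W)"
  have oT: "open ?T"
    using cd assms(1) by (intro open_Int T open_chart_map_image[OF M.is_chart[OF cd(1)]] openin_Int M.openin_chart_dom) auto
  have "local_rep c d f q = local_rep c d f' q" if "q \<in> ?T" for q
    using that chart_inv_map[OF M.is_chart[OF cd(1)]] assms(3) by auto
  then have "smooth_on (local_rep c d f') ?T"
    using smooth_on_cong[OF oT, of "local_rep c d f"] smooth_on_subset[OF T(3), of ?T] by simp
  moreover have "chart_map c x \<in> ?T" "f' x \<in> chart_dom d" using cd T(2) assms(2) assms(3)[OF assms(2)] by auto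
  ultimately show ?thesis using cd oT by (intro smooth_nearI[of c d x f' ?T])
qed

text \<open>The constraints \<open>f (Q i) \<subseteq> U i\<close> are open conditions, so they survive a sufficiently
  \<open>C\<^sup>0\<close>-small change of \<open>f\<close>; in the chart the map is replaced near \<open>a\<close> by a polynomial
  approximation.\<close>

lemma local_smoothing:
  fixes Q :: "'i \<Rightarrow> 'a set" and U :: "'i \<Rightarrow> 'b set"
  assumes cont: "continuous_map X Y f" and c: "c \<in> A" and d: "d \<in> B" and r: "0 < r"
    and K: "cball a r \<subseteq> local_dom c d f"
    and I: "finite I" "\<And>i. i \<in> I \<Longrightarrow> closedin X (Q i) \<and> openin Y (U i) \<and> f ` Q i \<subseteq> U i"
  obtains f' where "continuous_map X Y f'"
    "\<And>x. x \<notin> {y \<in> chart_dom c. chart_map c y \<in> cball a r} \<Longrightarrow> f' x = f x"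
    "\<And>i. i \<in> I \<Longrightarrow> f' ` Q i \<subseteq> U i"
    "\<And>x. x \<in> topspace X \<Longrightarrow> smooth_near f x \<Longrightarrow> smooth_near f' x"
    "\<And>x. x \<in> chart_dom c \<Longrightarrow> chart_map c x \<in> ball a (r/2) \<Longrightarrow> smooth_near f' x"
proof -
  note cc = M.is_chart[OF c] and dd = N.is_chart[OF d]
  define D where "D = local_dom c d f"
  define u where "u = local_rep c d f"
  have oD: "open D" unfolding D_def by (rule open_local_dom[OF cont c d])
  have u: "continuous_on D u" "\<And>p. p \<in> D \<Longrightarrow> u p \<in> chart_image d"
    unfolding D_def u_def by (rule continuous_local_rep[OF cont c d], rule local_rep_in_image[OF c])
  have KD: "cball a r \<subseteq> D" using K by (simp add: D_def)
  have Dim: "D \<subseteq> chart_image c" unfolding D_def by (rule local_dom_subset)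
  \<comment> \<open>A compact image inside an open set leaves a uniform margin; this bounds the
    admissible error of the approximation.\<close>
  have \<delta>_exists: "\<exists>\<delta>>0. \<forall>p\<in>C. ball (u p) \<delta> \<subseteq> V"
    if CV: "compact C" "C \<subseteq> D" "open V" "u ` C \<subseteq> V" for C V
  proof -
    have "compact (u ` C)"
      using CV by (intro compact_continuous_image continuous_on_subset[OF u(1)])
    then obtain \<delta> where "\<delta> > 0" "(\<Union>x\<in>u ` C. ball x \<delta>) \<subseteq> V"
      using compact_subset_open_imp_ball_epsilon_subset[OF _ CV(3,4)] by blast
    then show ?thesis by blast
  qed
  \<comment> \<open>The constraint for \<open>i\<close> read in the charts: \<open>u\<close> has to
    send the compact set \<open>C i\<close> into the open set \<open>V i\<close>.\<close>
  define C where "C i = {p \<in> cball a r. chart_inv c p \<in> Q i}" for i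
  define V where "V i = chart_map d ` (chart_dom d \<inter> U i)" for i
  have C: "compact (C i)" if "i \<in> I" for i
  proof -
    have "continuous_map (top_of_set (cball a r)) X (chart_inv c)"
      using continuous_map_from_subtopology_mono[OF continuous_chart_inv[OF cc]] KD Dim by blast
    then have "closedin (top_of_set (cball a r)) {p \<in> topspace (top_of_set (cball a r)). chart_inv c p \<in> Q i}"
      using I(2)[OF that] by (intro closedin_continuous_map_preimage) auto
    then have "closedin (top_of_set (cball a r)) (C i)" by (simp add: C_def)
    then show ?thesis using closedin_compact compact_cball by blast
  qed
  have "\<exists>\<delta>>0. \<forall>p\<in>C i. ball (u p) \<delta> \<subseteq> V i" if "i \<in> I" for i
  proof (rule \<delta>_exists[OF C[OF that]])
    show "C i \<subseteq> D" using KD by (auto simp: C_def)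
    show "open (V i)" unfolding V_def
      using I(2)[OF that] N.openin_chart_dom[OF d] by (intro open_chart_map_image[OF dd] openin_Int) auto
    show "u ` C i \<subseteq> V i"
    proof
      fix q assume "q \<in> u ` C i"
      then obtain p where p: "p \<in> C i" "q = u p" by auto
      then have "f (chart_inv c p) \<in> chart_dom d"
        using KD local_dom_iff[OF c, of p f d] by (auto simp: C_def D_def)
      moreover have "f (chart_inv c p) \<in> U i" using I(2)[OF that] p(1) by (auto simp: C_def)
      ultimately show "q \<in> V i" using p(2) by (auto simp: V_def u_def)
    qed
  qed
  then obtain \<delta> where \<delta>: "\<And>i. i \<in> I \<Longrightarrow> \<delta> i > 0" "\<And>i p. i \<in> I \<Longrightarrow> p \<in> C i \<Longrightarrow> ball (u p) (\<delta> i) \<subseteq> V i"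
    by metis
  obtain \<delta>0 where \<delta>0: "\<delta>0 > 0" "\<And>p. p \<in> cball a r \<Longrightarrow> ball (u p) \<delta>0 \<subseteq> chart_image d"
    using \<delta>_exists[OF compact_cball KD open_chart_image[OF dd]] u(2) KD by blast
  \<comment> \<open>Besides the margins of the constraints, \<open>\<delta>0\<close> keeps the new
    values in the image of \<open>d\<close>, so that \<open>chart_inv d\<close> may be applied. It
    also keeps the minimum defined for empty \<open>I\<close>.\<close>
  define \<epsilon> where "\<epsilon> = Min (insert \<delta>0 (\<delta> ` I))"
  have \<epsilon>: "\<epsilon> > 0" "\<epsilon> \<le> \<delta>0" "\<And>i. i \<in> I \<Longrightarrow> \<epsilon> \<le> \<delta> i"
    using I(1) \<delta>0(1) \<delta>(1) by (auto simp: \<epsilon>_def)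
  obtain w where w: "polynomial_function w" "\<And>p. p \<in> cball a r \<Longrightarrow> norm (u p - w p) < \<epsilon>"
    using Stone_Weierstrass_polynomial_function[OF compact_cball continuous_on_subset[OF u(1) KD] \<epsilon>(1)] by blast
  obtain \<eta> :: "'e \<Rightarrow> real" where \<eta>: "smooth_on \<eta> UNIV" "\<And>p. 0 \<le> \<eta> p" "\<And>p. \<eta> p \<le> 1"
    "\<And>p. p \<in> ball a (r/2) \<Longrightarrow> \<eta> p = 1" "\<And>p. p \<notin> ball a r \<Longrightarrow> \<eta> p = 0"
    using smooth_bump[OF r] by metis
  \<comment> \<open>\<open>v\<close> is the polynomial \<open>w\<close> on the half ball and
    \<open>u\<close> outside the ball. In between it is a convex combination, hence no farther from
    \<open>u\<close> than \<open>w\<close> is.\<close>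
  define v where "v p = u p + \<eta> p *\<^sub>R (w p - u p)" for p
  have v_close: "dist (u p) (v p) < \<epsilon>" if "p \<in> cball a r" for p
  proof -
    have "dist (u p) (v p) = \<eta> p * norm (u p - w p)"
      using \<eta>(2)[of p] by (simp add: v_def dist_norm norm_minus_commute)
    also have "\<dots> \<le> 1 * norm (u p - w p)" using \<eta>(3) by (intro mult_right_mono) auto
    finally show ?thesis using w(2)[OF that] by simp
  qed
  have v_out: "v p = u p" if "p \<notin> cball a r" for p
    using that \<eta>(5)[of p] by (simp add: v_def)
  have v_im: "v p \<in> chart_image d" if "p \<in> D" for p
  proof (cases "p \<in> cball a r")
    case True
    then show ?thesis using \<delta>0(2)[OF True] v_close[OF True] \<epsilon>(2) by auto
  qed (simp add: v_out u(2) that)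
  have v_cont: "continuous_on D v"
    unfolding v_def
    using continuous_on_subset[OF smooth_on_imp_continuous_on[OF \<eta>(1)]]
      continuous_on_subset[OF smooth_on_imp_continuous_on[OF smooth_on_polynomial_function[OF w(1)]]]
    by (intro continuous_intros u(1)) auto
  define E where "E = {x \<in> chart_dom c. chart_map c x \<in> D}"
  define Kh where "Kh = {y \<in> chart_dom c. chart_map c y \<in> cball a r}"
  have E: "openin X E" unfolding E_def by (rule openin_chart_vimage[OF cc oD])
  have KhE: "Kh \<subseteq> E" using KD by (auto simp: Kh_def E_def)
  have Kh: "closedin X Kh"
    unfolding Kh_def using KD Dim by (intro compactin_imp_closedin[OF M.Hausdorff] compactin_chart_vimage[OF cc]) auto
  define f' where "f' x = (if x \<in> E then chart_inv d (v (chart_map c x)) else f x)" for x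
  have f'_out: "f' x = f x" if "x \<notin> Kh" for x
  proof (cases "x \<in> E")
    case True
    then have x: "x \<in> chart_dom c" "chart_map c x \<in> D" "chart_map c x \<notin> cball a r"
      using that by (auto simp: E_def Kh_def)
    have "f x \<in> chart_dom d"
      using x(1,2) local_dom_iff[OF c, of "chart_map c x" f d] chart_inv_map[OF cc x(1)] by (simp add: D_def)
    then show ?thesis
      using True x(1) v_out[OF x(3)] chart_inv_map[OF cc x(1)] chart_inv_map[OF dd] by (simp add: f'_def u_def)
  qed (simp add: f'_def)
  have f'_cont: "continuous_map X Y f'"
  \<comment> \<open>Two open pieces: \<open>E\<close>, where the chart formula makes sense, and the
    complement of the closed set \<open>Kh\<close>, where nothing was changed. On the overlap
    \<open>v = u\<close>, so both formulas give \<open>f\<close>.\<close>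
  proof (rule pasting_lemma[where I = UNIV and T = "\<lambda>b. if b then E else topspace X - Kh"
        and f = "\<lambda>b. if b then chart_inv d \<circ> (v \<circ> chart_map c) else f"])
    fix b :: bool
    show "openin X (if b then E else topspace X - Kh)" using E Kh by auto
    show "continuous_map (subtopology X (if b then E else topspace X - Kh)) Y (if b then chart_inv d \<circ> (v \<circ> chart_map c) else f)"
    proof (cases b)
      case True
      have "continuous_map (subtopology X E) euclidean (chart_map c)"
        by (rule continuous_map_from_subtopology_mono[OF continuous_chart_map[OF cc]]) (auto simp: E_def)
      then have "continuous_map (subtopology X E) (top_of_set D) (chart_map c)"
        by (auto simp: continuous_map_in_subtopology E_def)
      moreover have "continuous_map (top_of_set D) (top_of_set (chart_image d)) v"
        using v_cont v_im by (auto simp: continuous_map_in_subtopology)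
      ultimately have "continuous_map (subtopology X E) (top_of_set (chart_image d)) (v \<circ> chart_map c)"
        by (rule continuous_map_compose)
      then have "continuous_map (subtopology X E) Y (chart_inv d \<circ> (v \<circ> chart_map c))"
        by (rule continuous_map_compose[OF _ continuous_chart_inv[OF dd]])
      then show ?thesis using True by simp
    next
      case False
      then show ?thesis using continuous_map_from_subtopology[OF cont] by simp
    qed
  next
    fix b b' :: bool and x
    assume x: "x \<in> topspace X \<inter> (if b then E else topspace X - Kh) \<inter> (if b' then E else topspace X - Kh)"
    have "chart_inv d (v (chart_map c x)) = f x" if "x \<in> E" "x \<notin> Kh"
      using f'_out[OF that(2)] that(1) by (simp add: f'_def)
    then show "(if b then chart_inv d \<circ> (v \<circ> chart_map c) else f) x = (if b' then chart_inv d \<circ> (v \<circ> chart_map c) else f) x"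
      using x by (auto split: if_splits)
  next
    fix x assume x: "x \<in> topspace X"
    show "\<exists>b. b \<in> UNIV \<and> x \<in> (if b then E else topspace X - Kh) \<and> f' x = (if b then chart_inv d \<circ> (v \<circ> chart_map c) else f) x"
    proof (cases "x \<in> E")
      case True
      then show ?thesis by (intro exI[of _ True]) (simp add: f'_def)
    next
      case False
      then show ?thesis using x KhE by (intro exI[of _ False]) (auto simp: f'_def)
    qed
  qed
  have f'_dom: "f' x \<in> chart_dom d" "chart_map d (f' x) = v (chart_map c x)" if "x \<in> E" for x
    using that chart_inv_in_dom[OF v_im[of "chart_map c x"]] chart_map_inv[OF v_im[of "chart_map c x"]]
    by (auto simp: f'_def E_def)
  have rep: "local_rep c d f' p = v p" if "p \<in> D" for p
  proof -
    have "chart_inv c p \<in> E" using that Dim chart_map_inv[of p c] chart_inv_in_dom[of p c] by (auto simp: E_def)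
    then show ?thesis using f'_dom(2) that Dim chart_map_inv[of p c] by auto
  qed
  have nearI: "smooth_near f' x" if "x \<in> E" "open T" "chart_map c x \<in> T" "T \<subseteq> D" "smooth_on v T" for x T
  proof (rule smooth_nearI[OF c d _, of x f', OF _ f'_dom(1)[OF that(1)] that(2,3)])
    show "x \<in> chart_dom c" using that(1) by (simp add: E_def)
    show "smooth_on (local_rep c d f') T"
      using smooth_on_cong[OF that(2), of "local_rep c d f'" v] rep that(4,5) by blast
  qed
  show thesis
  proof (rule that[of f'])
    show "continuous_map X Y f'" by (rule f'_cont)
    show "f' x = f x" if "x \<notin> {y \<in> chart_dom c. chart_map c y \<in> cball a r}" for x
      using f'_out that by (simp add: Kh_def)
    show "f' ` Q i \<subseteq> U i" if i: "i \<in> I" for i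
    proof
      fix y assume "y \<in> f' ` Q i"
      then obtain x where x: "x \<in> Q i" "y = f' x" by auto
      show "y \<in> U i"
      proof (cases "x \<in> Kh")
        case True
        then have xc: "x \<in> chart_dom c" "chart_map c x \<in> cball a r" by (auto simp: Kh_def)
        then have "chart_map c x \<in> C i" using x(1) chart_inv_map[OF cc] by (simp add: C_def)
        moreover have "v (chart_map c x) \<in> ball (u (chart_map c x)) (\<delta> i)"
          using v_close[OF xc(2)] \<epsilon>(3)[OF i] by simp
        ultimately have "v (chart_map c x) \<in> V i" using \<delta>(2)[OF i] by blast
        then obtain z where z: "z \<in> chart_dom d" "z \<in> U i" "v (chart_map c x) = chart_map d z" by (auto simp: V_def)
        then have "f' x = z" using True KhE chart_inv_map[OF dd z(1)] by (auto simp: f'_def)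
        then show ?thesis using x z by simp
      next
        case False
        then show ?thesis using f'_out I(2)[OF i] x by auto
      qed
    qed
    show "smooth_near f' x" if x: "x \<in> topspace X" "smooth_near f x" for x
    proof (cases "x \<in> Kh")
      case False
      then show ?thesis
        using x Kh f'_out by (intro smooth_near_cong[of "topspace X - Kh" x f f']) auto
    next
      case True
      then have xE: "x \<in> E" and xc: "x \<in> chart_dom c" using KhE by (auto simp: E_def)
      have "f x \<in> chart_dom d"
        using xE local_dom_iff[OF c, of "chart_map c x" f d] chart_inv_map[OF cc xc] by (simp add: D_def E_def)
      then obtain T where T: "open T" "chart_map c x \<in> T" "T \<subseteq> D" "smooth_on u T"
        using smooth_nearD[OF cont x(2) c xc d] unfolding u_def D_def by metis
      \<comment> \<open>Smoothness achieved earlier is not lost: where \<open>u\<close> is smooth,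
        so is its combination with a bump and a polynomial.\<close>
      have "smooth_on v T" unfolding v_def
        by (intro smooth_on_add smooth_on_scaleR smooth_on_diff T smooth_on_subset[OF \<eta>(1)]
            smooth_on_subset[OF smooth_on_polynomial_function[OF w(1)]]) auto
      then show ?thesis using nearI[OF xE T(1-3)] by blast
    qed
    show "smooth_near f' x" if x: "x \<in> chart_dom c" "chart_map c x \<in> ball a (r/2)" for x
    proof -
      have sub: "ball a (r/2) \<subseteq> D" using KD r ball_subset_cball subset_ball[of "r/2" r a] by fastforce
      have "smooth_on v (ball a (r/2))"
        using smooth_on_cong[OF open_ball, of a "r/2" v w] \<eta>(4) smooth_on_subset[OF smooth_on_polynomial_function[OF w(1)]]
        by (simp add: v_def)
      then show ?thesis using x sub by (intro nearI[OF _ open_ball]) (auto simp: E_def)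
    qed
  qed
qed

definition box_in :: "('a, 'e) chart \<Rightarrow> 'e \<Rightarrow> real \<Rightarrow> 'a set" where
  "box_in c a r = {y \<in> chart_dom c. chart_map c y \<in> cball a r}"

text \<open>One application of \<open>local_smoothing\<close> per box. The condition that box
  \<open>i\<close> is mapped into the domain of \<open>d i\<close> must survive for all of
  \<open>I\<close>, including boxes still to be treated, since it makes the next application
  possible; this is what the constraints in \<open>local_smoothing\<close> are for.\<close>

lemma finite_smoothing:
  fixes c :: "'i \<Rightarrow> ('a, 'e) chart" and d :: "'i \<Rightarrow> ('b, 'f) chart" and a :: "'i \<Rightarrow> 'e" and r :: "'i \<Rightarrow> real"
  assumes I: "finite I" and box: "\<And>i. i \<in> I \<Longrightarrow> c i \<in> A \<and> d i \<in> B \<and> 0 < r i \<and> cball (a i) (r i) \<subseteq> chart_image (c i)"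
    and f: "continuous_map X Y f" "\<And>i. i \<in> I \<Longrightarrow> f ` box_in (c i) (a i) (r i) \<subseteq> chart_dom (d i)"
  obtains f' where "continuous_map X Y f'"
    "\<And>x. x \<notin> (\<Union>i\<in>I. box_in (c i) (a i) (r i)) \<Longrightarrow> f' x = f x"
    "\<And>x. x \<in> topspace X \<Longrightarrow> smooth_near f x \<Longrightarrow> smooth_near f' x"
    "\<And>i x. i \<in> I \<Longrightarrow> x \<in> chart_dom (c i) \<Longrightarrow> chart_map (c i) x \<in> ball (a i) (r i / 2) \<Longrightarrow> smooth_near f' x"
proof -
  have "\<exists>f'. continuous_map X Y f' \<and> (\<forall>i\<in>I. f' ` box_in (c i) (a i) (r i) \<subseteq> chart_dom (d i)) \<and>
    (\<forall>x. x \<notin> (\<Union>i\<in>I. box_in (c i) (a i) (r i)) \<longrightarrow> f' x = f x) \<and>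
    (\<forall>x\<in>topspace X. smooth_near f x \<longrightarrow> smooth_near f' x) \<and>
    (\<forall>i\<in>J. \<forall>x\<in>chart_dom (c i). chart_map (c i) x \<in> ball (a i) (r i / 2) \<longrightarrow> smooth_near f' x)"
    if "finite J" "J \<subseteq> I" for J
    using that
  proof (induction J rule: finite_induct)
    case empty
    then show ?case using f by blast
  next
    case (insert j J)
    then obtain f1 where f1: "continuous_map X Y f1" "\<And>i. i \<in> I \<Longrightarrow> f1 ` box_in (c i) (a i) (r i) \<subseteq> chart_dom (d i)"
      "\<And>x. x \<notin> (\<Union>i\<in>I. box_in (c i) (a i) (r i)) \<Longrightarrow> f1 x = f x"
      "\<And>x. x \<in> topspace X \<Longrightarrow> smooth_near f x \<Longrightarrow> smooth_near f1 x"
      "\<And>i x. i \<in> J \<Longrightarrow> x \<in> chart_dom (c i) \<Longrightarrow> chart_map (c i) x \<in> ball (a i) (r i / 2) \<Longrightarrow> smooth_near f1 x"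
      by auto
    have j: "j \<in> I" using insert by simp
    note bj = box[OF j]
    have sub: "cball (a j) (r j) \<subseteq> local_dom (c j) (d j) f1"
    proof
      fix p assume p: "p \<in> cball (a j) (r j)"
      then have pi: "p \<in> chart_image (c j)" using bj by blast
      then have "chart_inv (c j) p \<in> box_in (c j) (a j) (r j)"
        using p by (simp add: box_in_def chart_inv_in_dom chart_map_inv)
      then show "p \<in> local_dom (c j) (d j) f1"
        using local_dom_iff[OF conjunct1[OF bj], of p f1 "d j"] pi f1(2)[OF j] by (simp add: image_subset_iff)
    qed
    have closed: "closedin X (box_in (c i) (a i) (r i)) \<and> openin Y (chart_dom (d i)) \<and>
        f1 ` box_in (c i) (a i) (r i) \<subseteq> chart_dom (d i)" if "i \<in> I" for i
      using f1(2)[OF that] box[OF that] N.openin_chart_dom[of "d i"] unfolding box_in_def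
      by (intro conjI compactin_imp_closedin[OF M.Hausdorff] compactin_chart_vimage[OF M.is_chart]) auto
    obtain f2 where f2: "continuous_map X Y f2"
      "\<And>x. x \<notin> {y \<in> chart_dom (c j). chart_map (c j) y \<in> cball (a j) (r j)} \<Longrightarrow> f2 x = f1 x"
      "\<And>i. i \<in> I \<Longrightarrow> f2 ` box_in (c i) (a i) (r i) \<subseteq> chart_dom (d i)"
      "\<And>x. x \<in> topspace X \<Longrightarrow> smooth_near f1 x \<Longrightarrow> smooth_near f2 x"
      "\<And>x. x \<in> chart_dom (c j) \<Longrightarrow> chart_map (c j) x \<in> ball (a j) (r j / 2) \<Longrightarrow> smooth_near f2 x"
      by (rule local_smoothing[OF f1(1) conjunct1[OF bj] conjunct1[OF conjunct2[OF bj]]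
            conjunct1[OF conjunct2[OF conjunct2[OF bj]]] sub I closed], assumption, rule that) fast+
    have top: "x \<in> topspace X" if "i \<in> I" "x \<in> chart_dom (c i)" for i x
      using chart_dom_subset[OF M.is_chart, of "c i"] box[OF that(1)] that(2) by blast
    show ?case
    proof (intro exI[of _ f2] conjI ballI allI impI)
      fix x assume x: "x \<notin> (\<Union>i\<in>I. box_in (c i) (a i) (r i))"
      then have "x \<notin> box_in (c j) (a j) (r j)" using j by blast
      then show "f2 x = f x" using f2(2)[of x] f1(3)[OF x] by (simp add: box_in_def)
    next
      fix i x assume i: "i \<in> insert j J" "x \<in> chart_dom (c i)" "chart_map (c i) x \<in> ball (a i) (r i / 2)"
      then show "smooth_near f2 x"
        using f2(5) f1(5) f2(4) top[of i x] insert.prems by (cases "i = j") auto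
    qed (use f2 f1 in auto)
  qed
  from this[OF I subset_refl] show thesis using that by blast
qed

end

section \<open>The cylinder over a manifold\<close>

lemma prod_topology_euclidean:
  "prod_topology euclidean euclidean = (euclidean :: ('a::topological_space \<times> 'b::topological_space) topology)"
  unfolding topology_eq by (auto simp: openin_prod_topology_alt open_prod_def)

text \<open>Time is the first coordinate and ranges over the whole line, so that chart images are
  open and the same notion of manifold applies.\<close>

definition cylinder_chart :: "('a, 'e) chart \<Rightarrow> (real \<times> 'a, real \<times> 'e) chart" where
  "cylinder_chart c = (UNIV \<times> chart_dom c, \<lambda>(t, x). (t, chart_map c x))"

lemma cylinder_chart_simps:
  "chart_dom (cylinder_chart c) = UNIV \<times> chart_dom c"
  "chart_map (cylinder_chart c) z = (fst z, chart_map c (snd z))"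
  "chart_image (cylinder_chart c) = UNIV \<times> chart_image c"
  by (auto simp: cylinder_chart_def chart_image_def split_def image_iff)

lemma is_chart_cylinder:
  assumes "is_chart X c"
  shows "is_chart (prod_topology euclideanreal X) (cylinder_chart c)"
  unfolding is_chart_def
proof (intro conjI)
  show "openin (prod_topology euclideanreal X) (chart_dom (cylinder_chart c))"
    using assms by (simp add: cylinder_chart_simps openin_prod_Times_iff is_chart_def)
  show "open (chart_image (cylinder_chart c))"
    using assms by (simp add: cylinder_chart_simps open_Times is_chart_def)
  obtain g where g: "homeomorphic_maps (subtopology X (chart_dom c)) (top_of_set (chart_image c)) (chart_map c) g"
    using assms unfolding is_chart_def homeomorphic_map_maps by blast
  have "homeomorphic_maps (prod_topology euclideanreal (subtopology X (chart_dom c)))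
      (prod_topology euclideanreal (top_of_set (chart_image c))) (\<lambda>(t, x). (id t, chart_map c x)) (\<lambda>(t, x). (id t, g x))"
    unfolding homeomorphic_maps_prod using g by (simp add: homeomorphic_maps_def)
  moreover have "prod_topology euclideanreal (subtopology X (chart_dom c)) = subtopology (prod_topology euclideanreal X) (UNIV \<times> chart_dom c)"
    by (simp add: subtopology_Times)
  moreover have "prod_topology euclideanreal (top_of_set (chart_image c)) = top_of_set (UNIV \<times> chart_image c)"
    by (metis prod_topology_euclidean subtopology_Times subtopology_UNIV)
  moreover have "(\<lambda>(t, x). (id t, chart_map c x)) = chart_map (cylinder_chart c)"
    by (simp add: cylinder_chart_def)
  ultimately show "homeomorphic_map (subtopology (prod_topology euclideanreal X) (chart_dom (cylinder_chart c)))
      (top_of_set (chart_image (cylinder_chart c))) (chart_map (cylinder_chart c))"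
    unfolding homeomorphic_map_maps cylinder_chart_simps(1,3) by metis
qed

lemma chart_inv_cylinder:
  assumes "is_chart X c" "p \<in> chart_image c"
  shows "chart_inv (cylinder_chart c) (t, p) = (t, chart_inv c p)"
  using chart_inv_map[OF is_chart_cylinder[OF assms(1)], of "(t, chart_inv c p)"] assms(2)
  by (simp add: cylinder_chart_simps chart_map_inv chart_inv_in_dom)

context manifold
begin

lemma cylinder_manifold: "manifold (prod_topology euclideanreal X) (cylinder_chart ` A)"
proof
  show "Hausdorff_space (prod_topology euclideanreal X)"
    using Hausdorff by (simp add: Hausdorff_space_prod_topology)
  show "is_chart (prod_topology euclideanreal X) c" if "c \<in> cylinder_chart ` A" for c
    using that is_chart is_chart_cylinder by blast
  have "(\<Union>c\<in>cylinder_chart ` A. chart_dom c) = UNIV \<times> (\<Union>c\<in>A. chart_dom c)"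
    by (auto simp: cylinder_chart_simps)
  then show "(\<Union>c\<in>cylinder_chart ` A. chart_dom c) = topspace (prod_topology euclideanreal X)"
    by (simp add: chart_domains)
  have smooth: "smooth_on (coord_change (cylinder_chart c) (cylinder_chart c'))
      (chart_map (cylinder_chart c) ` (chart_dom (cylinder_chart c) \<inter> chart_dom (cylinder_chart c')))"
    if c: "c \<in> A" "c' \<in> A" for c c'
  proof -
    let ?S = "chart_map c ` (chart_dom c \<inter> chart_dom c')"
    have im: "chart_map (cylinder_chart c) ` (chart_dom (cylinder_chart c) \<inter> chart_dom (cylinder_chart c')) = UNIV \<times> ?S"
      by (force simp: cylinder_chart_simps)
    have o: "open (UNIV \<times> ?S :: (real \<times> 'e) set)"
      by (intro open_Times open_overlap c open_UNIV)
    have "smooth_on (\<lambda>z :: real \<times> 'e. (fst z, coord_change c c' (snd z))) (UNIV \<times> ?S)"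
      by (intro smooth_on_Pair o smooth_on_fst smooth_on_compose[OF o open_overlap[OF c] _ smooth_on_snd smooth_coord_change[OF c]]) auto
    moreover have "coord_change (cylinder_chart c) (cylinder_chart c') z = (fst z, coord_change c c' (snd z))"
      if "z \<in> UNIV \<times> ?S" for z
    proof -
      have "snd z \<in> chart_image c" using that by (auto simp: chart_image_def)
      then show ?thesis
        using chart_inv_cylinder[OF is_chart[OF c(1)], of "snd z" "fst z"]
        by (simp add: coord_change_def cylinder_chart_simps)
    qed
    ultimately show ?thesis unfolding im by (subst smooth_on_cong[OF o])
  qed
  show "compatible_charts c c'" if c: "c \<in> cylinder_chart ` A" "c' \<in> cylinder_chart ` A" for c c'
  proof -
    obtain b b' where b: "b \<in> A" "c = cylinder_chart b" "b' \<in> A" "c' = cylinder_chart b'" using c by blast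
    show ?thesis
      unfolding compatible_charts_def b(2,4)
      by (rule conjI[OF smooth[OF b(1,3)] smooth[OF b(3,1),
            unfolded Int_commute[of "chart_dom (cylinder_chart b')"]]])
  qed
qed

end

context manifold_pair
begin

text \<open>The times -2 and 3 leave room: the smoothing is confined to boxes of radius at most 1
  whose centres have time in the unit interval, so it happens at times between -1 and 2.\<close>

lemma smooth_homotopy_exists:
  assumes compact: "compact_space X" and \<phi>: "smooth_map X A Y B \<phi>" and \<psi>: "smooth_map X A Y B \<psi>"
    and "homotopic_with (\<lambda>_. True) X Y \<phi> \<psi>"
  obtains F where "smooth_map (prod_topology euclideanreal X) (cylinder_chart ` A) Y B F"
    "\<And>x. F (- 2, x) = \<phi> x" "\<And>x. F (3, x) = \<psi> x"
proof -
  let ?P = "prod_topology euclideanreal X"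
  interpret C: manifold_pair ?P "cylinder_chart ` A" Y B
    by (rule manifold_pair.intro[OF M.cylinder_manifold N.manifold_axioms])
  obtain h where h: "continuous_map (prod_topology (top_of_set {0..1::real}) X) Y h" "\<And>x. h (0, x) = \<phi> x" "\<And>x. h (1, x) = \<psi> x"
    using assms(4) unfolding homotopic_with_def by blast
  \<comment> \<open>Clamping the time makes \<open>H\<close> equal to \<open>\<phi>\<close> before 0
    and to \<open>\<psi>\<close> after 1, so there it is smooth already.\<close>
  define H where "H = (\<lambda>z. h (max 0 (min 1 (fst z)), snd z))"
  have "continuous_map ?P (prod_topology (top_of_set {0..1::real}) X) (\<lambda>z. (max 0 (min 1 (fst z)), snd z))"
    by (auto simp: continuous_map_paired continuous_map_in_subtopology intro!: continuous_map_snd continuous_map_real_max continuous_map_real_min continuous_map_fst)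
  from continuous_map_compose[OF this h(1)] have contH: "continuous_map ?P Y H"
    by (simp add: H_def o_def)
  have slice: "C.smooth_near (\<lambda>z. \<theta> (snd z)) (t, x)" if \<theta>: "smooth_map X A Y B \<theta>" and x: "x \<in> topspace X" for \<theta> t x
  proof -
    have cont: "continuous_map X Y \<theta>" "smooth_near \<theta> x" using \<theta> x by (auto simp: smooth_map_iff)
    obtain c where c: "c \<in> A" "x \<in> chart_dom c" using x M.chart_cover[of x] by blast
    have "\<theta> x \<in> topspace Y" using cont(1) x by (auto simp: continuous_map_def)
    then obtain d where d: "d \<in> B" "\<theta> x \<in> chart_dom d" using N.chart_cover[of "\<theta> x"] by blast
    obtain T where T: "open T" "chart_map c x \<in> T" "T \<subseteq> local_dom c d \<theta>" "smooth_on (local_rep c d \<theta>) T"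
      using smooth_nearD[OF cont c d] by metis
    have oT: "open (UNIV \<times> T :: (real \<times> 'e) set)" by (intro open_Times T(1) open_UNIV)
    have "smooth_on (\<lambda>z :: real \<times> 'e. local_rep c d \<theta> (snd z)) (UNIV \<times> T)"
      by (rule smooth_on_compose[OF oT T(1) _ smooth_on_snd[OF oT] T(4)]) auto
    moreover have "local_rep (cylinder_chart c) d (\<lambda>z. \<theta> (snd z)) z = local_rep c d \<theta> (snd z)" if "z \<in> UNIV \<times> T" for z
    proof -
      have "snd z \<in> chart_image c" using that subsetD[OF subset_trans[OF T(3) local_dom_subset], of "snd z"] by auto
      then show ?thesis using chart_inv_cylinder[OF M.is_chart[OF c(1)], of "snd z" "fst z"] by simp
    qed
    ultimately have "smooth_on (local_rep (cylinder_chart c) d (\<lambda>z. \<theta> (snd z))) (UNIV \<times> T)"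
      by (subst smooth_on_cong[OF oT])
    then show ?thesis
      using c d T(2) oT
      by (intro C.smooth_nearI[of "cylinder_chart c" d "(t, x)" "\<lambda>z. \<theta> (snd z)" "UNIV \<times> T"]) (auto simp: cylinder_chart_simps)
  qed
  have outside: "C.smooth_near H (t, x)" if x: "x \<in> topspace X" and t: "t \<notin> {0..1}" for t x
  proof (cases "t < 0")
    case True
    show ?thesis
    proof (rule C.smooth_near_cong[OF _ _ _ slice[OF \<phi> x]])
      show "openin ?P ({..<0} \<times> topspace X)" by (simp add: openin_prod_Times_iff)
    qed (use True x in \<open>auto simp: H_def h(2)\<close>)
  next
    case False
    then have "1 < t" using t by auto
    show ?thesis
    proof (rule C.smooth_near_cong[OF _ _ _ slice[OF \<psi> x]])
      show "openin ?P ({1<..} \<times> topspace X)" by (simp add: openin_prod_Times_iff)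
    qed (use \<open>1 < t\<close> x in \<open>auto simp: H_def h(3)\<close>)
  qed
  \<comment> \<open>A box around \<open>z\<close> that \<open>H\<close> maps into a single chart
    domain of the target. The conditions \<open>r \<le> 1\<close> and \<open>fst a = fst z\<close>
    are kept to locate the altered region in time.\<close>
  define good where "good z c d a r \<longleftrightarrow> c \<in> cylinder_chart ` A \<and> d \<in> B \<and> 0 < r \<and> r \<le> 1 \<and> cball a r \<subseteq> chart_image c \<and>
      H ` C.box_in c a r \<subseteq> chart_dom d \<and> z \<in> chart_dom c \<and> a = chart_map c z \<and> fst a = fst z" for z c d a r
  have "\<exists>c d a r. good z c d a r"
    if "z \<in> {0..1} \<times> topspace X" for z
  proof -
    have "z \<in> topspace ?P" using that by auto
    then obtain c where c: "c \<in> cylinder_chart ` A" "z \<in> chart_dom c" using C.M.chart_cover[of z] by blast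
    have "H z \<in> topspace Y" using contH \<open>z \<in> topspace ?P\<close> by (auto simp: continuous_map_def)
    then obtain d where d: "d \<in> B" "H z \<in> chart_dom d" using N.chart_cover[of "H z"] by blast
    have "chart_map c z \<in> local_dom c d H" using c(2) d(2) by blast
    then obtain r0 where r0: "r0 > 0" "cball (chart_map c z) r0 \<subseteq> local_dom c d H"
      using C.open_local_dom[OF contH c(1) d(1)] open_contains_cball by metis
    have sub: "cball (chart_map c z) (min 1 r0) \<subseteq> local_dom c d H" using r0(2) by auto
    have "H ` C.box_in c (chart_map c z) (min 1 r0) \<subseteq> chart_dom d"
    proof
      fix y assume "y \<in> H ` C.box_in c (chart_map c z) (min 1 r0)"
      then obtain w where w: "w \<in> chart_dom c" "chart_map c w \<in> local_dom c d H" "y = H w"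
        using sub by (auto simp: C.box_in_def)
      then show "y \<in> chart_dom d"
        using C.local_dom_iff[OF c(1), of "chart_map c w" H d] chart_inv_map[OF C.M.is_chart[OF c(1)] w(1)] by simp
    qed
    moreover have "fst (chart_map c z) = fst z" using c(1) by (auto simp: cylinder_chart_simps)
    ultimately show ?thesis
      using c d r0(1) sub local_dom_subset[of c H d] unfolding good_def
      by (intro exI[of _ c] exI[of _ d] exI[of _ "chart_map c z"] exI[of _ "min 1 r0"]) simp
  qed
  then obtain c d a r where "\<And>z. z \<in> {0..1} \<times> topspace X \<Longrightarrow> good z (c z) (d z) (a z) (r z)"
    by metis
  then have box: "\<And>z. z \<in> {0..1} \<times> topspace X \<Longrightarrow> c z \<in> cylinder_chart ` A \<and> d z \<in> B \<and> 0 < r z \<and> r z \<le> 1 \<and>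
      cball (a z) (r z) \<subseteq> chart_image (c z) \<and> H ` C.box_in (c z) (a z) (r z) \<subseteq> chart_dom (d z) \<and> z \<in> chart_dom (c z) \<and>
      a z = chart_map (c z) z \<and> fst (a z) = fst z"
    unfolding good_def by blast
  \<comment> \<open>Half balls, because only there does the smoothing guarantee a smooth
    result.\<close>
  define U where "U z = {y \<in> chart_dom (c z). chart_map (c z) y \<in> ball (a z) (r z / 2)}" for z
  have comp: "compactin ?P ({0..1} \<times> topspace X)"
    using compact by (simp add: compactin_Times compact_space_def)
  have opn: "openin ?P (U z)" if "z \<in> {0..1} \<times> topspace X" for z
    unfolding U_def by (rule openin_chart_vimage[OF C.M.is_chart]) (use box[OF that] in auto)
  have cov: "{0..1} \<times> topspace X \<subseteq> \<Union> (U ` ({0..1} \<times> topspace X))"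
  proof
    fix z :: "real \<times> 'a" assume z: "z \<in> {0..1} \<times> topspace X"
    have "z \<in> U z" using box[OF z] by (simp add: U_def)
    then show "z \<in> \<Union> (U ` ({0..1} \<times> topspace X))" using z by blast
  qed
  have "\<exists>\<F>. finite \<F> \<and> \<F> \<subseteq> U ` ({0..1} \<times> topspace X) \<and> {0..1} \<times> topspace X \<subseteq> \<Union>\<F>"
  proof (rule compactinD[OF comp _ cov])
    show "openin ?P V" if "V \<in> U ` ({0..1} \<times> topspace X)" for V
      using that by (elim imageE) (simp only: opn)
  qed
  then obtain \<F> where \<F>: "finite \<F>" "\<F> \<subseteq> U ` ({0..1} \<times> topspace X)" "{0..1} \<times> topspace X \<subseteq> \<Union>\<F>"
    by (elim exE conjE)
  obtain I where I: "I \<subseteq> {0..1} \<times> topspace X" "finite I" "\<F> = U ` I"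
    using finite_subset_image[OF \<F>(1,2)] by blast
  note cover = \<F>(3)[unfolded I(3)]
  have boxI: "\<And>i. i \<in> I \<Longrightarrow> c i \<in> cylinder_chart ` A \<and> d i \<in> B \<and> 0 < r i \<and> cball (a i) (r i) \<subseteq> chart_image (c i)"
    using I(1) box by blast
  obtain F where F: "continuous_map ?P Y F"
    "\<And>x. x \<notin> (\<Union>i\<in>I. C.box_in (c i) (a i) (r i)) \<Longrightarrow> F x = H x"
    "\<And>x. x \<in> topspace ?P \<Longrightarrow> C.smooth_near H x \<Longrightarrow> C.smooth_near F x"
    "\<And>i x. i \<in> I \<Longrightarrow> x \<in> chart_dom (c i) \<Longrightarrow> chart_map (c i) x \<in> ball (a i) (r i / 2) \<Longrightarrow> C.smooth_near F x"
  proof (rule C.finite_smoothing[OF I(2) boxI contH])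
    show "H ` C.box_in (c i) (a i) (r i) \<subseteq> chart_dom (d i)" if "i \<in> I" for i
      using box[OF subsetD[OF I(1) that]] by blast
  qed (assumption, rule that, fast+)
  \<comment> \<open>A box meeting time \<open>t\<close> would put \<open>t\<close> within distance 1
    of the unit interval.\<close>
  have far: "F (t, x) = H (t, x)" if "t \<le> - 2 \<or> 3 \<le> t" for t x
  proof (rule F(2), rule notI)
    assume "(t, x) \<in> (\<Union>i\<in>I. C.box_in (c i) (a i) (r i))"
    then obtain i where i: "i \<in> I" "(t, x) \<in> C.box_in (c i) (a i) (r i)" by blast
    note b = box[OF subsetD[OF I(1) i(1)]]
    have "dist (fst (a i)) (fst (chart_map (c i) (t, x))) \<le> 1"
      using dist_fst_le[of "a i" "chart_map (c i) (t, x)"] i(2) b by (auto simp: C.box_in_def)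
    moreover have "fst (chart_map (c i) (t, x)) = t" using b by (auto simp: cylinder_chart_simps)
    moreover have "fst (a i) \<in> {0..1}" using b I(1) i(1) by auto
    ultimately show False using that by (auto simp: dist_real_def)
  qed
  show thesis
  proof (rule that[of F])
    \<comment> \<open>At times in the unit interval \<open>z\<close> lies in one of the half balls;
      at other times \<open>H\<close> was smooth and the smoothing preserved this.\<close>
    have "C.smooth_near F z" if z: "z \<in> topspace ?P" for z
    proof (cases "fst z \<in> {0..1}")
      case True
      then have "z \<in> {0..1} \<times> topspace X" using z by (auto simp: mem_Times_iff)
      then obtain i where "i \<in> I" "z \<in> U i" using cover by blast
      then show ?thesis using F(4) by (auto simp: U_def)
    next
      case False
      then have "C.smooth_near H z" using outside[of "snd z" "fst z"] z by auto
      then show ?thesis by (rule F(3)[OF z])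
    qed
    then show "smooth_map ?P (cylinder_chart ` A) Y B F" using F(1) by (simp add: C.smooth_map_iff)
    show "F (- 2, x) = \<phi> x" "F (3, x) = \<psi> x" for x
      using far[of "-2" x] far[of 3 x] h(2,3) by (simp_all add: H_def)
  qed
qed

end

section \<open>Integration by parts and pullbacks of closed forms\<close>

lemma smooth_on_zero_extension:
  assumes "open S" "closed K" "K \<subseteq> S" "smooth_on f S" "\<And>x. x \<in> S - K \<Longrightarrow> f x = 0"
  shows "smooth_on (\<lambda>x. if x \<in> S then f x else 0) UNIV"
proof (rule smooth_on_local)
  fix x
  have "smooth_on (\<lambda>x. if x \<in> S then f x else 0) S"
    using smooth_on_cong[OF assms(1), of "\<lambda>x. if x \<in> S then f x else 0" f] assms(4) by simp
  moreover have "smooth_on (\<lambda>x. if x \<in> S then f x else 0) (- K)"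
  proof -
    have "(if x \<in> S then f x else 0) = 0" if "x \<in> - K" for x using assms(5) that by auto
    then show ?thesis
      using assms(2) by (subst smooth_on_cong) (auto simp: smooth_on_const)
  qed
  ultimately show "\<exists>T. open T \<and> x \<in> T \<and> smooth_on (\<lambda>x. if x \<in> S then f x else 0) T"
    using assms(1,2,3) by (cases "x \<in> S") auto
qed

lemma continuous_on_dir_deriv: "smooth_on f UNIV \<Longrightarrow> continuous_on S (dir_deriv f v)"
  by (rule continuous_on_subset[OF smooth_on_imp_continuous_on[OF smooth_on_dir_deriv]]) auto

lemma has_real_derivative_along_line':
  fixes f :: "'a::euclidean_space \<Rightarrow> real"
  assumes "smooth_on f UNIV"
  shows "((\<lambda>s. f (p + s *\<^sub>R v)) has_real_derivative dir_deriv f v (p + s *\<^sub>R v)) (at s within U)"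
  using has_real_derivative_along_line[OF smooth_on_imp_differentiable[OF assms]] has_field_derivative_at_within by blast

text \<open>By translation invariance \<open>\<integral> f (p + s v) dp\<close> does not depend on \<open>s\<close>.\<close>

lemma integral_dir_deriv_compact_support_UNIV:
  fixes f :: "'a::euclidean_space \<Rightarrow> real"
  assumes f: "smooth_on f UNIV" and K: "compact K" "\<And>x. x \<notin> K \<Longrightarrow> f x = 0"
  shows "\<exists>a b. K \<subseteq> cbox a b \<and> integral (cbox a b) (dir_deriv f v) = 0"
proof -
  \<comment> \<open>The box must contain \<open>K\<close> moved by \<open>- s v\<close> for all
    \<open>s\<close> up to 1 in absolute value. Then integrating the translated function over this
    fixed box captures its full integral.\<close>
  let ?L = "(\<lambda>(k, s). k - s *\<^sub>R v) ` (K \<times> {-1..1::real})"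
  have "compact ?L"
    by (intro compact_continuous_image compact_Times K compact_Icc continuous_on_diff continuous_intros)
      (auto simp: split_def intro!: continuous_intros)
  then obtain a b where ab: "?L \<subseteq> cbox a b"
    using bounded_subset_cbox_symmetric[OF compact_imp_bounded] by metis
  have Kab: "K \<subseteq> cbox (a + s *\<^sub>R v) (b + s *\<^sub>R v)" if "s \<in> {-1..1}" for s
  proof
    fix k assume "k \<in> K"
    then have "k - s *\<^sub>R v \<in> cbox a b" using ab that by blast
    then show "k \<in> cbox (a + s *\<^sub>R v) (b + s *\<^sub>R v)"
      by (auto simp: mem_box inner_diff_left inner_add_left algebra_simps)
  qed
  have box: "integral (cbox c d) f = integral UNIV f" if "K \<subseteq> cbox c d" for c d
  proof -
    have "integral (cbox c d) f = integral UNIV (\<lambda>x. if x \<in> cbox c d then f x else 0)"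
      by (simp add: integral_restrict_UNIV)
    also have "(\<lambda>x. if x \<in> cbox c d then f x else 0) = f" using that K(2) by (intro ext) auto
    finally show ?thesis .
  qed
  have const: "integral (cbox a b) (\<lambda>p. f (p + s *\<^sub>R v)) = integral UNIV f" if "s \<in> {-1<..<1}" for s
    using integral_shift_cbox[of "a + s *\<^sub>R v" "s *\<^sub>R v" "b + s *\<^sub>R v" f] box[OF Kab[of s]] that by simp
  have "((\<lambda>s. integral (cbox a b) (\<lambda>p. f (p + s *\<^sub>R v))) has_real_derivative integral (cbox a b) (\<lambda>p. dir_deriv f v (p + 0 *\<^sub>R v))) (at 0 within {-1<..<1})"
  proof (rule leibniz_rule_field_derivative)
    show "((\<lambda>s. f (p + s *\<^sub>R v)) has_real_derivative dir_deriv f v (p + s *\<^sub>R v)) (at s within {-1<..<1})" for s p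
      by (rule has_real_derivative_along_line'[OF f])
    show "(\<lambda>p. f (p + s *\<^sub>R v)) integrable_on cbox a b" for s
      by (rule integrable_continuous, rule continuous_on_compose2[OF smooth_on_imp_continuous_on[OF f]])
        (auto intro!: continuous_intros)
    show "continuous_on ({-1<..<1} \<times> cbox a b) (\<lambda>(s, p). dir_deriv f v (p + s *\<^sub>R v))"
      unfolding split_def
      by (rule continuous_on_compose2[OF continuous_on_dir_deriv[OF f, of UNIV v]]) (auto intro!: continuous_intros)
  qed auto
  then have "((\<lambda>s. integral (cbox a b) (\<lambda>p. f (p + s *\<^sub>R v))) has_real_derivative integral (cbox a b) (dir_deriv f v)) (at 0)"
    by (simp add: at_within_open[of 0 "{-1<..<1::real}"])
  \<comment> \<open>Near \<open>s = 0\<close> the differentiated integral is constant, so its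
    derivative, the wanted integral, is 0.\<close>
  then have "((\<lambda>s. integral UNIV f) has_real_derivative integral (cbox a b) (dir_deriv f v)) (at 0)"
    by (rule has_field_derivative_transform_within_open[of _ _ _ "{-1<..<1}"]) (use const in auto)
  then have "integral (cbox a b) (dir_deriv f v) = 0" using DERIV_unique[OF _ DERIV_const] by blast
  moreover have "K \<subseteq> cbox a b" using Kab[of 0] by simp
  ultimately show ?thesis by blast
qed

lemma dir_deriv_outside_support:
  assumes "open S" "closed K" "\<And>x. x \<in> S - K \<Longrightarrow> f x = 0" "x \<in> S - K"
  shows "dir_deriv f v x = 0"
proof -
  have "frechet_derivative f (at x) = frechet_derivative (\<lambda>x. 0) (at x)"
    using assms by (intro frechet_cong[of "S - K"]) auto
  then show ?thesis by (simp add: frechet_derivative_eqI[OF has_derivative_const])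
qed

text \<open>Compact support lets \<open>f\<close> be extended smoothly by 0, which reduces the claim
  to the whole space.\<close>

lemma integral_dir_deriv_compact_support:
  fixes f :: "'a::euclidean_space \<Rightarrow> real"
  assumes S: "open S" and K: "compact K" "K \<subseteq> S" and f: "smooth_on f S" "\<And>x. x \<in> S - K \<Longrightarrow> f x = 0"
  shows "integral S (dir_deriv f v) = 0"
proof -
  let ?g = "\<lambda>x. if x \<in> S then f x else 0"
  have g: "smooth_on ?g UNIV"
    by (rule smooth_on_zero_extension[OF S compact_imp_closed[OF K(1)] K(2) f])
  have g0: "?g x = 0" if "x \<notin> K" for x using f(2) that by auto
  obtain a b where ab: "K \<subseteq> cbox a b" "integral (cbox a b) (dir_deriv ?g v) = 0"
    using integral_dir_deriv_compact_support_UNIV[OF g K(1) g0] by blast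
  have eq: "dir_deriv ?g v x = (if x \<in> S then dir_deriv f v x else 0)" for x
  proof (cases "x \<in> S")
    case True
    have "frechet_derivative ?g (at x) = frechet_derivative f (at x)"
      using True by (intro frechet_cong[OF S]) auto
    then show ?thesis using True by simp
  next
    case False
    then have "x \<in> UNIV - K" using K(2) by auto
    then have "dir_deriv ?g v x = 0"
      using g0 by (intro dir_deriv_outside_support[OF open_UNIV compact_imp_closed[OF K(1)]]) auto
    then show ?thesis using False by simp
  qed
  have "integral S (dir_deriv f v) = integral (cbox a b) (\<lambda>x. if x \<in> S then dir_deriv f v x else 0)"
    using dir_deriv_outside_support[OF S compact_imp_closed[OF K(1)] f(2)]
    by (intro compact_support_integral(1)[OF S K smooth_on_imp_continuous_on[OF smooth_on_dir_deriv[OF f(1)]] _ ab(1)]) auto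
  also have "\<dots> = 0" using ab(2) by (simp only: eq)
  finally show ?thesis .
qed

text \<open>The cutoff \<open>r\<close> makes the integrand vanish off \<open>K\<close> for every
  \<open>t\<close>, so its extension by 0 is smooth in \<open>(t, p)\<close> and the Leibniz rule on
  one fixed box applies.\<close>

lemma has_derivative_integral_compact_support:
  fixes h :: "real \<times> 'a::euclidean_space \<Rightarrow> real" and r :: "'a \<Rightarrow> real"
  assumes S: "open S" and K: "compact K" "K \<subseteq> S" and r: "smooth_on r S" "\<And>x. x \<in> S - K \<Longrightarrow> r x = 0"
    and h: "smooth_on h (UNIV \<times> S)"
  shows "((\<lambda>t. integral S (\<lambda>p. r p * h (t, p))) has_real_derivative
      integral S (\<lambda>p. r p * dir_deriv h (1, 0) (t, p))) (at t)"
proof -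
  obtain a b where ab: "K \<subseteq> cbox a b"
    using bounded_subset_cbox_symmetric[OF compact_imp_bounded[OF K(1)]] by metis
  let ?g = "\<lambda>z. if z \<in> UNIV \<times> S then r (snd z) * h z else 0"
  let ?S = "UNIV \<times> S :: (real \<times> 'a) set"
  have oS: "open ?S" using S by (intro open_Times) auto
  have rs: "smooth_on (\<lambda>z :: real \<times> 'a. r (snd z)) ?S"
    by (rule smooth_on_compose[OF oS S _ smooth_on_snd[OF oS] r(1)]) auto
  have g: "smooth_on ?g UNIV"
  proof (rule smooth_on_zero_extension[OF oS])
    show "closed (UNIV \<times> K)" by (intro closed_Times compact_imp_closed K(1) closed_UNIV)
    show "smooth_on (\<lambda>z. r (snd z) * h z) ?S" by (intro smooth_on_mult oS rs h)
    show "r (snd z) * h z = 0" if "z \<in> ?S - UNIV \<times> K" for z using that r(2)[of "snd z"] by (simp add: mem_Times_iff)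
  qed (use K(2) in auto)
  have cont: "continuous_on S (\<lambda>p. f (t, p))" if "continuous_on ?S f" for f :: "real \<times> 'a \<Rightarrow> real" and t
    by (rule continuous_on_compose2[OF that]) (auto intro!: continuous_intros)
  have int: "integral S (\<lambda>p. r p * f (t, p)) = integral (cbox a b) (\<lambda>p. if p \<in> S then r p * f (t, p) else 0)"
    if "smooth_on f ?S" for f t
    using r(2) smooth_on_imp_continuous_on[OF r(1)] cont[OF smooth_on_imp_continuous_on[OF that]]
    by (intro compact_support_integral(1)[OF S K _ _ ab] continuous_intros) auto
  have d: "dir_deriv ?g (1, 0) (t, p) = (if p \<in> S then r p * dir_deriv h (1, 0) (t, p) else 0)" for t p
  proof (cases "p \<in> S")
    case True
    then have inS: "(t, p) \<in> ?S" by simp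
    have "frechet_derivative ?g (at (t, p)) = frechet_derivative (\<lambda>z. r (snd z) * h z) (at (t, p))"
      using inS by (intro frechet_cong[OF oS]) auto
    moreover have "((\<lambda>z. r (snd z) * h z) has_derivative
        (\<lambda>w. r (snd (t, p)) * dir_deriv h w (t, p) + dir_deriv r (snd w) p * h (t, p))) (at (t, p))"
    proof (rule has_derivative_mult)
      have "(r has_derivative frechet_derivative r (at p)) (at (snd (t, p)))"
        using smooth_on_imp_differentiable[OF r(1) True] by (simp add: frechet_derivative_worksI)
      from diff_chain_at[OF bounded_linear_imp_has_derivative[OF bounded_linear_snd] this]
      show "((\<lambda>z. r (snd z)) has_derivative (\<lambda>w. dir_deriv r (snd w) p)) (at (t, p))"
        by (simp add: o_def)
      show "(h has_derivative frechet_derivative h (at (t, p))) (at (t, p))"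
        using smooth_on_imp_differentiable[OF h inS] by (rule frechet_derivative_worksI)
    qed
    moreover have "dir_deriv r 0 p = 0"
      using linear_frechet_derivative[OF smooth_on_imp_differentiable[OF r(1) True]] by (rule linear_0)
    ultimately show ?thesis using True by (simp add: frechet_derivative_eqI)
  next
    case False
    have "dir_deriv ?g (1, 0) (t, p) = 0"
    proof (rule dir_deriv_outside_support[of UNIV "UNIV \<times> K"])
      show "closed (UNIV \<times> K :: (real \<times> 'a) set)" by (intro closed_Times compact_imp_closed K(1) closed_UNIV)
      show "?g z = 0" if "z \<in> UNIV - UNIV \<times> K" for z
        using that r(2)[of "snd z"] by (simp add: mem_Times_iff)
    qed (use False K(2) in auto)
    then show ?thesis using False by simp
  qed
  have "((\<lambda>t. integral (cbox a b) (\<lambda>p. ?g (t, p))) has_real_derivative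
      integral (cbox a b) (\<lambda>p. dir_deriv ?g (1, 0) (t, p))) (at t within UNIV)"
  proof (rule leibniz_rule_field_derivative)
    show "((\<lambda>t. ?g (t, p)) has_real_derivative dir_deriv ?g (1, 0) (t, p)) (at t within UNIV)" for t p
    proof -
      have "(0, p) + s *\<^sub>R (1, 0) = (s, p)" for s :: real by simp
      then show ?thesis using has_real_derivative_along_line'[OF g, of "(0, p)" "(1, 0)" t UNIV] by (simp only:)
    qed
    have "continuous_on UNIV ?g" by (rule smooth_on_imp_continuous_on[OF g])
    then show "(\<lambda>p. ?g (t, p)) integrable_on cbox a b" for t
      by (intro integrable_continuous, elim continuous_on_compose2) (auto intro!: continuous_intros)
    show "continuous_on (UNIV \<times> cbox a b) (\<lambda>(t, p). dir_deriv ?g (1, 0) (t, p))"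
      using continuous_on_dir_deriv[OF g] by (simp add: split_def)
  qed auto
  moreover have "?g (t, p) = (if p \<in> S then r p * h (t, p) else 0)" for t p
    by (cases "p \<in> S") simp_all
  ultimately show ?thesis
    by (simp only: d int[OF h] int[OF smooth_on_dir_deriv[OF h]])
qed

section \<open>Bilinear fields and pullbacks of 2-forms\<close>

lemma bilinear_Basis_sum:
  fixes W :: "'f::euclidean_space \<Rightarrow> 'f \<Rightarrow> real"
  assumes "bilinear W"
  shows "W a b = (\<Sum>i\<in>Basis. \<Sum>j\<in>Basis. (a \<bullet> i) * (b \<bullet> j) * W i j)"
proof -
  have "W a b = W (\<Sum>i\<in>Basis. (a \<bullet> i) *\<^sub>R i) (\<Sum>j\<in>Basis. (b \<bullet> j) *\<^sub>R j)"
    by (simp add: euclidean_representation)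
  also have "\<dots> = (\<Sum>i\<in>Basis. \<Sum>j\<in>Basis. W ((a \<bullet> i) *\<^sub>R i) ((b \<bullet> j) *\<^sub>R j))"
    by (simp add: bilinear_sum[OF assms] sum.cartesian_product)
  finally show ?thesis
    by (simp add: bilinear_lmul[OF assms] bilinear_rmul[OF assms] mult_ac)
qed

context
  fixes W :: "'f::euclidean_space \<Rightarrow> 'f \<Rightarrow> 'f \<Rightarrow> real" and V :: "'f set"
    and u a b :: "'a::euclidean_space \<Rightarrow> 'f" and T :: "'a set"
  assumes bil: "\<And>q. q \<in> V \<Longrightarrow> bilinear (W q)" and W: "\<And>v w. smooth_on (\<lambda>q. W q v w) V" and V: "open V"
    and T: "open T" and u: "smooth_on u T" "u ` T \<subseteq> V" and ab: "smooth_on a T" "smooth_on b T"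
begin

text \<open>\<open>W\<close> is known to be smooth only with fixed arguments. Expansion in the basis
  reduces varying arguments to finitely many such functions times coordinates.\<close>

lemma smooth_on_bilinear_field: "smooth_on (\<lambda>p. W (u p) (a p) (b p)) T"
proof -
  have "smooth_on (\<lambda>p. \<Sum>i\<in>Basis. \<Sum>j\<in>Basis. (a p \<bullet> i) * (b p \<bullet> j) * W (u p) i j) T"
    by (intro smooth_on_sum smooth_on_mult T smooth_on_inner ab smooth_on_const smooth_on_compose[OF T V u(2,1) W])
  moreover have "W (u p) (a p) (b p) = (\<Sum>i\<in>Basis. \<Sum>j\<in>Basis. (a p \<bullet> i) * (b p \<bullet> j) * W (u p) i j)" if "p \<in> T" for p
    using u(2) that by (intro bilinear_Basis_sum bil) auto
  ultimately show ?thesis by (subst smooth_on_cong[OF T])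
qed

text \<open>The product rule with three terms: one for each argument and one, by the chain rule, for
  the base point. The last is first computed with the arguments frozen, where it is again bilinear
  in them.\<close>

lemma dir_deriv_bilinear_field:
  assumes p: "p \<in> T"
  shows "dir_deriv (\<lambda>p. W (u p) (a p) (b p)) x p = W (u p) (dir_deriv a x p) (b p) + W (u p) (a p) (dir_deriv b x p)
    + dir_deriv (\<lambda>q. W q (a p) (b p)) (dir_deriv u x p) (u p)"
proof -
  have up: "u p \<in> V" using u(2) p by blast
  have Wd: "(\<lambda>q. W q v w) differentiable at (u p)" for v w
    by (rule smooth_on_imp_differentiable[OF W up])
  define D where "D v w = dir_deriv (\<lambda>q. W q v w) (dir_deriv u x p) (u p)" for v w
  have "frechet_derivative (\<lambda>q. W q v w) (at (u p)) = frechet_derivative (\<lambda>q. \<Sum>i\<in>Basis. \<Sum>j\<in>Basis. (v \<bullet> i) * (w \<bullet> j) * W q i j) (at (u p))" for v w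
    by (rule frechet_cong[OF V up]) (rule bilinear_Basis_sum[OF bil])
  moreover have "((\<lambda>q. \<Sum>i\<in>Basis. \<Sum>j\<in>Basis. (v \<bullet> i) * (w \<bullet> j) * W q i j) has_derivative
      (\<lambda>y. \<Sum>i\<in>Basis. \<Sum>j\<in>Basis. (v \<bullet> i) * (w \<bullet> j) * dir_deriv (\<lambda>q. W q i j) y (u p))) (at (u p))" for v w
    by (intro has_derivative_sum has_derivative_mult_right frechet_derivative_worksI Wd)
  ultimately have fd: "frechet_derivative (\<lambda>q. W q v w) (at (u p)) =
      (\<lambda>y. \<Sum>i\<in>Basis. \<Sum>j\<in>Basis. (v \<bullet> i) * (w \<bullet> j) * dir_deriv (\<lambda>q. W q i j) y (u p))" for v w
    by (rule trans[OF _ frechet_derivative_eqI])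
  have D: "D v w = (\<Sum>i\<in>Basis. \<Sum>j\<in>Basis. (v \<bullet> i) * (w \<bullet> j) * D i j)" for v w
    unfolding D_def by (subst fd[of v w]) (rule refl)
  have da: "a differentiable at p" "b differentiable at p" "u differentiable at p"
    using smooth_on_imp_differentiable p ab u(1) by blast+
  have Wu: "((\<lambda>p. W (u p) i j) has_derivative (\<lambda>y. dir_deriv (\<lambda>q. W q i j) (dir_deriv u y p) (u p))) (at p)" for i j
    using diff_chain_at[OF frechet_derivative_worksI[OF da(3)] frechet_derivative_worksI[OF Wd]] by (simp add: o_def)
  have "((\<lambda>p. \<Sum>i\<in>Basis. \<Sum>j\<in>Basis. ((a p \<bullet> i) * (b p \<bullet> j)) * W (u p) i j) has_derivative
     (\<lambda>y. \<Sum>i\<in>Basis. \<Sum>j\<in>Basis. ((a p \<bullet> i) * (b p \<bullet> j)) * dir_deriv (\<lambda>q. W q i j) (dir_deriv u y p) (u p)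
       + ((a p \<bullet> i) * (dir_deriv b y p \<bullet> j) + (dir_deriv a y p \<bullet> i) * (b p \<bullet> j)) * W (u p) i j)) (at p)"
    by (intro has_derivative_sum has_derivative_mult Wu has_derivative_inner_left frechet_derivative_worksI da)
  moreover have "frechet_derivative (\<lambda>p. W (u p) (a p) (b p)) (at p) = frechet_derivative (\<lambda>p. \<Sum>i\<in>Basis. \<Sum>j\<in>Basis. ((a p \<bullet> i) * (b p \<bullet> j)) * W (u p) i j) (at p)"
    using u(2) by (intro frechet_cong[OF T p] bilinear_Basis_sum bil) auto
  ultimately have "dir_deriv (\<lambda>p. W (u p) (a p) (b p)) x p = (\<Sum>i\<in>Basis. \<Sum>j\<in>Basis. ((a p \<bullet> i) * (b p \<bullet> j)) * D i j
       + ((a p \<bullet> i) * (dir_deriv b x p \<bullet> j) + (dir_deriv a x p \<bullet> i) * (b p \<bullet> j)) * W (u p) i j)"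
    by (simp only: frechet_derivative_eqI D_def)
  then show ?thesis
    unfolding D_def[symmetric] D[of "a p"] bilinear_Basis_sum[OF bil[OF up], of "a p"] bilinear_Basis_sum[OF bil[OF up], of "dir_deriv a x p"]
    by (simp add: sum.distrib distrib_right)
qed

end

definition alternating_2form :: "('a, 'e::euclidean_space) chart set \<Rightarrow> ('a, 'e) tensor2 \<Rightarrow> bool" where
  "alternating_2form A \<alpha> \<longleftrightarrow> (\<forall>c\<in>A. \<forall>p\<in>chart_image c. \<forall>v. tensor_coord A \<alpha> c p v v = 0)"

context manifold_pair
begin

context
  fixes f assumes f: "smooth_map X A Y B f"
begin

lemma smooth_local_rep: "c \<in> A \<Longrightarrow> d \<in> B \<Longrightarrow> smooth_on (local_rep c d f) (local_dom c d f)"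
  using f unfolding smooth_map_def by blast

lemma open_local_dom': "c \<in> A \<Longrightarrow> d \<in> B \<Longrightarrow> open (local_dom c d f)"
  using f open_local_dom by (simp add: smooth_map_def)

lemma local_rep_differentiable:
  assumes "c \<in> A" "d \<in> B" "x \<in> chart_dom c" "f x \<in> chart_dom d"
  shows "local_rep c d f differentiable at (chart_map c x)"
  using smooth_on_imp_differentiable[OF smooth_local_rep[OF assms(1,2)]] assms(3,4) by blast

text \<open>\<open>differential\<close> is computed in the chart picked by \<open>chart_at\<close>;
  by the chain rule any other chart around \<open>x\<close> gives the same vector.\<close>

lemma differential_coord:
  assumes c: "c \<in> A" "x \<in> chart_dom c" and d: "d \<in> B" "f x \<in> chart_dom d" and v: "v \<in> tangent_space A x"
  shows "differential A B f x v d = frechet_derivative (local_rep c d f) (at (chart_map c x)) (v c)"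
proof -
  define c0 where "c0 = chart_at A x"
  have c0: "c0 \<in> A" "x \<in> chart_dom c0"
    using M.chart_at[of x] chart_dom_subset[OF M.is_chart[OF c(1)]] c(2) unfolding c0_def by blast+
  let ?S = "chart_map c ` (chart_dom c \<inter> chart_dom c0)"
  have "v c0 = coord_change_deriv c c0 x (v c)"
    using v c c0 unfolding tangent_space_def by blast
  moreover have "frechet_derivative (local_rep c d f) (at (chart_map c x)) =
      frechet_derivative (\<lambda>q. local_rep c0 d f (coord_change c c0 q)) (at (chart_map c x))"
  proof (rule frechet_cong[OF M.open_overlap[OF c(1) c0(1)]])
    fix q assume "q \<in> ?S"
    then obtain y where "y \<in> chart_dom c" "y \<in> chart_dom c0" "q = chart_map c y" by auto
    then show "local_rep c d f q = local_rep c0 d f (coord_change c c0 q)"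
      using chart_inv_map[OF M.is_chart[OF c(1)]] chart_inv_map[OF M.is_chart[OF c0(1)]] by (simp add: coord_change_def)
  qed (use c c0 in auto)
  moreover have "frechet_derivative (\<lambda>q. local_rep c0 d f (coord_change c c0 q)) (at (chart_map c x)) (v c) =
      frechet_derivative (local_rep c0 d f) (at (chart_map c0 x)) (coord_change_deriv c c0 x (v c))"
  proof -
    have eq: "coord_change c c0 (chart_map c x) = chart_map c0 x"
      using chart_inv_map[OF M.is_chart[OF c(1)] c(2)] by (simp add: coord_change_def)
    have "coord_change c c0 differentiable at (chart_map c x)"
      using M.coord_change_has_derivative[OF c(1) c0(1) c(2) c0(2)] by (rule differentiableI)
    from frechet_derivative_compose[OF this, of "local_rep c0 d f", unfolded eq, OF local_rep_differentiable[OF c0(1) d(1) c0(2) d(2)]]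
    show ?thesis by (simp only: coord_change_deriv_def)
  qed
  ultimately show ?thesis
    using d by (simp add: differential_def Let_def c0_def[symmetric])
qed

lemma differential_eq_coord_vector:
  assumes c: "c \<in> A" "x \<in> chart_dom c" and d: "d \<in> B" "f x \<in> chart_dom d" and v: "v \<in> tangent_space A x"
  shows "differential A B f x v = coord_vector B d (f x) (frechet_derivative (local_rep c d f) (at (chart_map c x)) (v c))"
proof
  fix d'
  show "differential A B f x v d' = coord_vector B d (f x) (frechet_derivative (local_rep c d f) (at (chart_map c x)) (v c)) d'"
  proof (cases "d' \<in> B \<and> f x \<in> chart_dom d'")
    case False
    then show ?thesis by (auto simp: differential_def coord_vector_def)
  next
    case True
    let ?S = "local_dom c d f \<inter> local_dom c d' f"
    have "frechet_derivative (local_rep c d' f) (at (chart_map c x)) =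
        frechet_derivative (\<lambda>q. coord_change d d' (local_rep c d f q)) (at (chart_map c x))"
    proof (rule frechet_cong)
      show "open ?S" using True c d by (intro open_Int open_local_dom') auto
      fix q assume "q \<in> ?S"
      then have "f (chart_inv c q) \<in> chart_dom d"
        using local_dom_iff[OF c(1), of q f d] by blast
      then show "local_rep c d' f q = coord_change d d' (local_rep c d f q)"
        using chart_inv_map[OF N.is_chart[OF d(1)]] by (simp add: coord_change_def)
    qed (use True c d in auto)
    moreover have "frechet_derivative (\<lambda>q. coord_change d d' (local_rep c d f q)) (at (chart_map c x)) (v c) =
        coord_change_deriv d d' (f x) (frechet_derivative (local_rep c d f) (at (chart_map c x)) (v c))"
    proof -
      have eq: "local_rep c d f (chart_map c x) = chart_map d (f x)"
        using chart_inv_map[OF M.is_chart[OF c(1)] c(2)] by simp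
      have "coord_change d d' differentiable at (chart_map d (f x))"
        using M.manifold_axioms N.coord_change_has_derivative[OF d(1) _ d(2)] True differentiableI by blast
      from frechet_derivative_compose[OF local_rep_differentiable[OF c(1) d(1) c(2) d(2)], of "coord_change d d'", unfolded eq, OF this]
      show ?thesis by (simp only: coord_change_deriv_def)
    qed
    ultimately show ?thesis
      using differential_coord[OF c conjunct1[OF True] conjunct2[OF True] v] True by (simp add: coord_vector_def)
  qed
qed

lemma pullback2_coord:
  assumes c: "c \<in> A" and d: "d \<in> B" and p: "p \<in> local_dom c d f"
  shows "tensor_coord A (pullback2 A B f \<alpha>) c p v w =
    tensor_coord B \<alpha> d (local_rep c d f p) (dir_deriv (local_rep c d f) v p) (dir_deriv (local_rep c d f) w p)"
proof -
  define x where "x = chart_inv c p"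
  have pi: "p \<in> chart_image c" and fx: "f x \<in> chart_dom d"
    using p local_dom_iff[OF c, of p f d] by (auto simp: x_def)
  have x: "x \<in> chart_dom c" "chart_map c x = p"
    using chart_inv_in_dom[OF pi] chart_map_inv[OF pi] by (simp_all add: x_def)
  have T: "coord_vector A c x w \<in> tangent_space A x" for w by (rule M.coord_vector_in_tangent_space[OF c x(1)])
  have "chart_inv d (local_rep c d f p) = f x"
    using chart_inv_map[OF N.is_chart[OF d] fx] by (simp add: x_def)
  then show ?thesis
    unfolding tensor_coord_def[of A] tensor_coord_def[of B] x_def[symmetric] pullback2_def
      differential_eq_coord_vector[OF c x(1) d fx T] M.coord_vector_same[OF c x(1)] x(2) by simp
qed

text \<open>In charts the pullback is \<open>W(u)(du v, du w)\<close>. Its exterior derivative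
  consists of terms with second derivatives of \<open>u\<close>, which cancel in pairs, and of the
  exterior derivative of \<open>\<alpha>\<close> on the images of the vectors.\<close>

lemma pullback2_closed:
  assumes \<alpha>: "smooth_tensor2 B \<alpha>" "alternating_2form B \<alpha>" "closed_2form B \<alpha>"
  shows "smooth_tensor2 A (pullback2 A B f \<alpha>)" "alternating_2form A (pullback2 A B f \<alpha>)" "closed_2form A (pullback2 A B f \<alpha>)"
proof -
  have cover: "\<exists>d\<in>B. p \<in> local_dom c d f" if "c \<in> A" "p \<in> chart_image c" for c p
  proof -
    have "chart_inv c p \<in> topspace X"
      using chart_inv_in_dom[OF that(2)] chart_dom_subset[OF M.is_chart[OF that(1)]] by blast
    then have "f (chart_inv c p) \<in> topspace Y" using f by (auto simp: smooth_map_def continuous_map_def)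
    then obtain d where "d \<in> B" "f (chart_inv c p) \<in> chart_dom d" using N.chart_cover[of "f (chart_inv c p)"] by blast
    then show ?thesis using local_dom_iff[OF that(1), of p f d] that(2) by blast
  qed
  \<comment> \<open>All assertions are local, so they are proved on the domains where one target
    chart is enough; by \<open>cover\<close> these exhaust the chart of the source.\<close>
  have loc: "smooth_on (\<lambda>p. tensor_coord A (pullback2 A B f \<alpha>) c p v w) (local_dom c d f)
    \<and> (\<forall>p\<in>local_dom c d f. bilinear (tensor_coord A (pullback2 A B f \<alpha>) c p)
       \<and> tensor_coord A (pullback2 A B f \<alpha>) c p v v = 0
       \<and> frechet_derivative (\<lambda>q. tensor_coord A (pullback2 A B f \<alpha>) c q v w) (at p) x
       - frechet_derivative (\<lambda>q. tensor_coord A (pullback2 A B f \<alpha>) c q x w) (at p) v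
       + frechet_derivative (\<lambda>q. tensor_coord A (pullback2 A B f \<alpha>) c q x v) (at p) w = 0)"
    if c: "c \<in> A" and d: "d \<in> B" for c d x v w
  proof -
    let ?T = "local_dom c d f" and ?u = "local_rep c d f" and ?W = "tensor_coord B \<alpha> d"
    let ?\<Theta> = "tensor_coord A (pullback2 A B f \<alpha>) c"
    have T: "open ?T" by (rule open_local_dom'[OF c d])
    have V: "open (chart_image d)" by (rule open_chart_image[OF N.is_chart[OF d]])
    have bil: "bilinear (?W q)" if "q \<in> chart_image d" for q
      using \<alpha>(1) d that unfolding smooth_tensor2_def by blast
    have W: "smooth_on (\<lambda>q. ?W q v w) (chart_image d)" for v w
      using \<alpha>(1) d unfolding smooth_tensor2_def by blast
    have alt: "?W q v v = 0" if "q \<in> chart_image d" for q v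
      using \<alpha>(2) d that unfolding alternating_2form_def by blast
    have u: "smooth_on ?u ?T" by (rule smooth_local_rep[OF c d])
    have uV: "?u ` ?T \<subseteq> chart_image d"
      using local_rep_in_image[OF c, of _ f d] by (intro image_subsetI)
    have du: "smooth_on (dir_deriv ?u v) ?T" for v by (rule smooth_on_dir_deriv[OF u])
    note field = bil W V T u uV du du
    have eq: "?\<Theta> p v w = ?W (?u p) (dir_deriv ?u v p) (dir_deriv ?u w p)" if "p \<in> ?T" for p v w
      by (rule pullback2_coord[OF c d that])
    have "smooth_on (\<lambda>p. ?W (?u p) (dir_deriv ?u v p) (dir_deriv ?u w p)) ?T"
      by (rule smooth_on_bilinear_field[OF field])
    then have sm: "smooth_on (\<lambda>p. ?\<Theta> p v w) ?T"
      using eq by (subst smooth_on_cong[OF T])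
    have "bilinear (?\<Theta> p) \<and> ?\<Theta> p v v = 0 \<and> dir_deriv (\<lambda>q. ?\<Theta> q v w) x p - dir_deriv (\<lambda>q. ?\<Theta> q x w) v p + dir_deriv (\<lambda>q. ?\<Theta> q x v) w p = 0"
      if p: "p \<in> ?T" for p
    proof (intro conjI)
      have up: "?u p \<in> chart_image d" using uV p by blast
      have lin: "linear (\<lambda>v. dir_deriv ?u v p)"
        by (rule linear_frechet_derivative[OF smooth_on_imp_differentiable[OF u p]])
      have "?\<Theta> p = (\<lambda>v w. ?W (?u p) (dir_deriv ?u v p) (dir_deriv ?u w p))"
        by (intro ext eq[OF p])
      moreover have "bilinear (\<lambda>v w. ?W (?u p) (dir_deriv ?u v p) (dir_deriv ?u w p))"
        using bil[OF up] lin unfolding bilinear_def by (auto intro: linear_compose[unfolded o_def])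
      ultimately show "bilinear (?\<Theta> p)" by simp
      show "?\<Theta> p v v = 0" using eq[OF p] alt[OF up] by simp
      have D: "dir_deriv (\<lambda>q. ?\<Theta> q v w) x p = ?W (?u p) (dir_deriv (dir_deriv ?u v) x p) (dir_deriv ?u w p)
         + ?W (?u p) (dir_deriv ?u v p) (dir_deriv (dir_deriv ?u w) x p)
         + dir_deriv (\<lambda>q. ?W q (dir_deriv ?u v p) (dir_deriv ?u w p)) (dir_deriv ?u x p) (?u p)" for v w x
        using frechet_cong[OF T p eq] dir_deriv_bilinear_field[OF field p] by simp
      have sym: "dir_deriv (dir_deriv ?u v) w p = dir_deriv (dir_deriv ?u w) v p" for v w
        by (rule dir_deriv_commute[OF T p u])
      have anti: "?W (?u p) a b = - ?W (?u p) b a" for a b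
        by (rule bilinear_alternating[OF bil[OF up] alt[OF up]])
      have closed: "dir_deriv (\<lambda>q. ?W q b c) a (?u p) - dir_deriv (\<lambda>q. ?W q a c) b (?u p) + dir_deriv (\<lambda>q. ?W q a b) c (?u p) = 0" for a b c
        using \<alpha>(3) d up unfolding closed_2form_def by blast
      \<comment> \<open>Six terms contain a second derivative of \<open>?u\<close>. Symmetry cancels
        two pairs outright; in the remaining pair the second derivative stands in different
        arguments, which \<open>anti\<close> repairs.\<close>
      show "dir_deriv (\<lambda>q. ?\<Theta> q v w) x p - dir_deriv (\<lambda>q. ?\<Theta> q x w) v p + dir_deriv (\<lambda>q. ?\<Theta> q x v) w p = 0"
        unfolding D sym[of x v] sym[of w v] sym[of w x]
        using closed[of "dir_deriv ?u v p" "dir_deriv ?u w p" "dir_deriv ?u x p"]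
          anti[of "dir_deriv ?u v p" "dir_deriv (dir_deriv ?u x) w p"] by linarith
    qed
    then show ?thesis using sm by blast
  qed
  show "smooth_tensor2 A (pullback2 A B f \<alpha>)"
    unfolding smooth_tensor2_def
  proof (intro ballI conjI allI)
    fix c p assume cp: "c \<in> A" "p \<in> chart_image c"
    then obtain d where d: "d \<in> B" "p \<in> local_dom c d f" using cover by blast
    show "bilinear (tensor_coord A (pullback2 A B f \<alpha>) c p)" using loc[OF cp(1) d(1)] d(2) by blast
  next
    fix c v w assume c: "c \<in> A"
    show "smooth_on (\<lambda>p. tensor_coord A (pullback2 A B f \<alpha>) c p v w) (chart_image c)"
    proof (rule smooth_on_local)
      fix p assume "p \<in> chart_image c"
      then obtain d where d: "d \<in> B" "p \<in> local_dom c d f" using cover[OF c] by blast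
      then show "\<exists>T. open T \<and> p \<in> T \<and> smooth_on (\<lambda>p. tensor_coord A (pullback2 A B f \<alpha>) c p v w) T"
        using loc[OF c d(1), of v w] open_local_dom'[OF c d(1)] by blast
    qed
  qed
  show "alternating_2form A (pullback2 A B f \<alpha>)"
    unfolding alternating_2form_def
  proof (intro ballI allI)
    fix c p v assume cp: "c \<in> A" "p \<in> chart_image c"
    then obtain d where d: "d \<in> B" "p \<in> local_dom c d f" using cover by blast
    show "tensor_coord A (pullback2 A B f \<alpha>) c p v v = 0" using loc[OF cp(1) d(1)] d(2) by blast
  qed
  show "closed_2form A (pullback2 A B f \<alpha>)"
    unfolding closed_2form_def
  proof (intro ballI allI)
    fix c p x v w assume cp: "c \<in> A" "p \<in> chart_image c"
    then obtain d where d: "d \<in> B" "p \<in> local_dom c d f" using cover by blast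
    show "frechet_derivative (\<lambda>q. tensor_coord A (pullback2 A B f \<alpha>) c q v w) (at p) x
       - frechet_derivative (\<lambda>q. tensor_coord A (pullback2 A B f \<alpha>) c q x w) (at p) v
       + frechet_derivative (\<lambda>q. tensor_coord A (pullback2 A B f \<alpha>) c q x v) (at p) w = 0"
      using loc[OF cp(1) d(1)] d(2) by blast
  qed
qed

end

end

section \<open>Stokes' theorem on a compact surface\<close>

lemma integral_eq_on_support:
  fixes f :: "'a::euclidean_space \<Rightarrow> real"
  assumes "T \<subseteq> S" "\<And>x. x \<in> S \<Longrightarrow> x \<notin> T \<Longrightarrow> f x = 0"
  shows "integral S f = integral T f"
proof -
  have eq: "(\<lambda>x. if x \<in> S then f x else 0) = (\<lambda>x. if x \<in> T then f x else 0)"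
    using assms by (intro ext) auto
  have "integral S f = integral UNIV (\<lambda>x. if x \<in> S then f x else 0)" by (simp add: integral_restrict_UNIV)
  also have "\<dots> = integral T f" unfolding eq by (simp add: integral_restrict_UNIV)
  finally show ?thesis .
qed

lemma integral_change_of_variables_real:
  fixes f :: "real^2 \<Rightarrow> real" and \<tau> :: "real^2 \<Rightarrow> real^2"
  assumes S: "open S" and der: "\<And>x. x \<in> S \<Longrightarrow> (\<tau> has_derivative \<tau>' x) (at x)" and inj: "inj_on \<tau> S"
    and f: "f absolutely_integrable_on \<tau> ` S"
  shows "integral (\<tau> ` S) f = integral S (\<lambda>x. \<bar>det (matrix (\<tau>' x))\<bar> * f (\<tau> x))"
proof -
  let ?f = "\<lambda>x. vec (f x) :: real^1"
  have "?f absolutely_integrable_on \<tau> ` S"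
    using f by (simp add: absolutely_integrable_on_1_iff)
  moreover have "S \<in> sets lebesgue" using S by (intro sets_completionI_sets) simp
  ultimately have "integral (\<tau> ` S) ?f = integral S (\<lambda>x. \<bar>det (matrix (\<tau>' x))\<bar> *\<^sub>R ?f (\<tau> x))"
    by (intro integral_change_of_variables[OF _ has_derivative_at_withinI[OF der] inj] disjI1)
  then show ?thesis by (simp add: integral_on_1_eq vec_eq_iff)
qed

lemma linear_real2:
  fixes l :: "real^2 \<Rightarrow> real"
  assumes "linear l"
  shows "l v = v$1 * l (axis 1 1) + v$2 * l (axis 2 1)"
proof -
  have "v = v$1 *\<^sub>R axis 1 1 + v$2 *\<^sub>R axis 2 1" by (simp add: vec_eq_iff axis_def forall_2)
  then have "l v = l (v$1 *\<^sub>R axis 1 1 + v$2 *\<^sub>R axis 2 1)" by simp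
  then show ?thesis by (simp add: linear_add[OF assms] linear_cmul[OF assms])
qed

text \<open>The value of the 2-form \<open>l \<and> m\<close> on the images of the basis: top degree
  forms scale by the determinant.\<close>

lemma wedge_linear_det:
  fixes l m :: "real^2 \<Rightarrow> real" and D :: "real^2 \<Rightarrow> real^2"
  assumes l: "linear l" and m: "linear m"
  shows "l (D (axis 1 1)) * m (D (axis 2 1)) - l (D (axis 2 1)) * m (D (axis 1 1)) =
    det (matrix D) * (l (axis 1 1) * m (axis 2 1) - l (axis 2 1) * m (axis 1 1))"
  unfolding linear_real2[OF l, of "D _"] linear_real2[OF m, of "D _"]
  by (simp add: det_2 matrix_def algebra_simps)

context compact_surface
begin

text \<open>The first chart names the function, the second supplies the coordinates.\<close>

definition pouc :: "('a, real^2) chart \<Rightarrow> ('a, real^2) chart \<Rightarrow> real^2 \<Rightarrow> real" where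
  "pouc c c' p = pou c (chart_inv c' p)"

lemma smooth_pouc: "c \<in> A \<Longrightarrow> c' \<in> A \<Longrightarrow> smooth_on (pouc c c') (chart_image c')"
  using smooth_pou[of c] unfolding smooth_function_def pouc_def comp_def by blast

text \<open>The \<open>dx\<^sub>1 \<and> dx\<^sub>2\<close> component of \<open>d(pou c0) \<and> b\<close> in the chart \<open>c\<close>.\<close>

definition dpou_wedge :: "(('a, real^2) chart \<Rightarrow> real^2 \<Rightarrow> real^2 \<Rightarrow> real) \<Rightarrow> ('a, real^2) chart \<Rightarrow> ('a, real^2) chart \<Rightarrow> real^2 \<Rightarrow> real" where
  "dpou_wedge b c0 c p = dir_deriv (pouc c0 c) (axis 1 1) p * b c p (axis 2 1) - dir_deriv (pouc c0 c) (axis 2 1) p * b c p (axis 1 1)"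

context
  fixes b :: "('a, real^2) chart \<Rightarrow> real^2 \<Rightarrow> real^2 \<Rightarrow> real"
  assumes lin: "\<And>c p. c \<in> A \<Longrightarrow> p \<in> chart_image c \<Longrightarrow> linear (b c p)"
    and smooth: "\<And>c v. c \<in> A \<Longrightarrow> smooth_on (\<lambda>p. b c p v) (chart_image c)"
    and covariant: "\<And>c c' x v. c \<in> A \<Longrightarrow> c' \<in> A \<Longrightarrow> x \<in> chart_dom c \<Longrightarrow> x \<in> chart_dom c' \<Longrightarrow>
      b c (chart_map c x) v = b c' (chart_map c' x) (coord_change_deriv c c' x v)"
begin

lemma linear_dpouc:
  assumes "c0 \<in> A" "c \<in> A" "p \<in> chart_image c"
  shows "linear (\<lambda>v. dir_deriv (pouc c0 c) v p)"
  by (rule linear_frechet_derivative[OF smooth_on_imp_differentiable[OF smooth_pouc[OF assms(1,2)] assms(3)]])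

lemma dpouc_change:
  assumes c0: "c0 \<in> A" and c: "c \<in> A" "x \<in> chart_dom c" and c': "c' \<in> A" "x \<in> chart_dom c'"
  shows "dir_deriv (pouc c0 c) v (chart_map c x) = dir_deriv (pouc c0 c') (coord_change_deriv c c' x v) (chart_map c' x)"
proof -
  let ?S = "chart_map c ` (chart_dom c \<inter> chart_dom c')"
  have eq: "coord_change c c' (chart_map c x) = chart_map c' x"
    using chart_inv_map[OF is_chart[OF c(1)] c(2)] by (simp add: coord_change_def)
  have "frechet_derivative (pouc c0 c) (at (chart_map c x)) = frechet_derivative (\<lambda>q. pouc c0 c' (coord_change c c' q)) (at (chart_map c x))"
  proof (rule frechet_cong[OF open_overlap[OF c(1) c'(1)]])
    fix q assume "q \<in> ?S"
    then obtain y where "y \<in> chart_dom c" "y \<in> chart_dom c'" "q = chart_map c y" by auto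
    then show "pouc c0 c q = pouc c0 c' (coord_change c c' q)"
      using chart_inv_map[OF is_chart[OF c(1)]] chart_inv_map[OF is_chart[OF c'(1)]] by (simp add: coord_change_def pouc_def)
  qed (use c c' in auto)
  moreover have "frechet_derivative (\<lambda>q. pouc c0 c' (coord_change c c' q)) (at (chart_map c x)) v =
      dir_deriv (pouc c0 c') (coord_change_deriv c c' x v) (chart_map c' x)"
  proof -
    have d: "coord_change c c' differentiable at (chart_map c x)"
      using coord_change_has_derivative[OF c(1) c'(1) c(2) c'(2)] by (rule differentiableI)
    have "pouc c0 c' differentiable at (chart_map c' x)"
      by (rule smooth_on_imp_differentiable[OF smooth_pouc[OF c0 c'(1)] chart_map_in_image[OF c'(2)]])
    from frechet_derivative_compose[OF d, of "pouc c0 c'", unfolded eq, OF this]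
    show ?thesis by (simp only: coord_change_deriv_def)
  qed
  ultimately show ?thesis by simp
qed

text \<open>Both \<open>d(pou c0)\<close> and \<open>b\<close> are covariant, so their wedge scales
  by the Jacobian determinant. The orientation allows the absolute value, which is the form needed
  for change of variables.\<close>

lemma dpou_wedge_change:
  assumes c0: "c0 \<in> A" and c: "c \<in> A" "x \<in> chart_dom c" and c': "c' \<in> A" "x \<in> chart_dom c'"
  shows "dpou_wedge b c0 c (chart_map c x) = \<bar>det (matrix (coord_change_deriv c c' x))\<bar> * dpou_wedge b c0 c' (chart_map c' x)"
proof -
  note p' = chart_map_in_image[OF c'(2)]
  have "0 < det (matrix (coord_change_deriv c c' x))"
    using oriented c c' unfolding oriented_manifold_def by blast
  then show ?thesis
    unfolding dpou_wedge_def dpouc_change[OF c0 c c'] covariant[OF c(1) c'(1) c(2) c'(2)]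
    using wedge_linear_det[OF linear_dpouc[OF c0 c'(1) p'] lin[OF c'(1) p'], of "coord_change_deriv c c' x"] by simp
qed

lemma continuous_dpou_wedge:
  assumes "c0 \<in> A" "c \<in> A"
  shows "continuous_on (chart_image c) (dpou_wedge b c0 c)"
proof -
  note * = smooth_on_imp_continuous_on[OF smooth_on_dir_deriv[OF smooth_pouc[OF assms]]]
    smooth_on_imp_continuous_on[OF smooth[OF assms(2)]]
  show ?thesis
    unfolding dpou_wedge_def[abs_def] by (intro continuous_intros *)
qed

text \<open>\<open>csupp\<close> is closed, so off it the function vanishes on a whole neighbourhood
  and its derivative does too.\<close>

lemma dpou_wedge_0_outside_csupp:
  assumes c0: "c0 \<in> A" and c: "c \<in> A" "x \<in> chart_dom c" and x: "x \<notin> csupp c0"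
  shows "dpou_wedge b c0 c (chart_map c x) = 0"
proof -
  let ?S = "chart_map c ` (chart_dom c \<inter> (topspace X - csupp c0))"
  have oS: "open ?S"
    by (intro open_chart_map_image[OF is_chart[OF c(1)]] openin_Int openin_chart_dom[OF c(1)] openin_diff)
      (auto simp: csupp_def)
  have "frechet_derivative (pouc c0 c) (at (chart_map c x)) = frechet_derivative (\<lambda>p. 0) (at (chart_map c x))"
  proof (rule frechet_cong[OF oS])
    show "chart_map c x \<in> ?S" using c x chart_dom_subset[OF is_chart[OF c(1)]] by blast
    fix p assume "p \<in> ?S"
    then obtain y where "y \<in> chart_dom c" "y \<in> topspace X" "y \<notin> csupp c0" "p = chart_map c y" by auto
    then show "pouc c0 c p = 0"
      using chart_inv_map[OF is_chart[OF c(1)]] pou_0_outside_csupp by (simp add: pouc_def)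
  qed
  then show ?thesis by (simp add: dpou_wedge_def frechet_derivative_eqI[OF has_derivative_const])
qed

text \<open>Both sides integrate the 2-form \<open>pou c' * d(pou c) \<and> b\<close>, which lives
  on the overlap of the two charts; there the change of variables applies.\<close>

lemma integral_pou_dpou_wedge:
  assumes c: "c \<in> A" and c': "c' \<in> A"
  shows "integral (chart_image c) (\<lambda>p. pouc c' c p * dpou_wedge b c c p) =
    integral (chart_image c') (\<lambda>p. pouc c' c' p * dpou_wedge b c c' p)"
proof -
  let ?S = "chart_map c ` (chart_dom c \<inter> chart_dom c')" and ?S' = "chart_map c' ` (chart_dom c \<inter> chart_dom c')"
  let ?\<tau> = "coord_change c c'"
  define f where "f p = pouc c' c' p * dpou_wedge b c c' p" for p
  note cc = is_chart[OF c] and cc' = is_chart[OF c']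
  note sub = csupp_subset[OF c] csupp_subset[OF c']
  have oS: "open ?S" by (rule open_overlap[OF c c'])
  have oS': "open ?S'" using open_overlap[OF c' c] by (simp only: Int_commute)
  have S': "?S' \<subseteq> chart_image c'" "?S \<subseteq> chart_image c" by (auto simp: chart_image_def)
  have im: "?\<tau> ` ?S = ?S'"
  proof -
    have "?\<tau> (chart_map c x) = chart_map c' x" if "x \<in> chart_dom c \<inter> chart_dom c'" for x
      using that chart_inv_map[OF cc, of x] by (simp add: coord_change_def)
    then show ?thesis unfolding image_image by (rule image_cong[OF refl])
  qed
  have inj: "inj_on ?\<tau> ?S"
  proof (rule inj_on_inverseI)
    fix p assume "p \<in> ?S"
    then obtain x where "x \<in> chart_dom c" "x \<in> chart_dom c'" "p = chart_map c x" by auto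
    then show "coord_change c' c (?\<tau> p) = p"
      using chart_inv_map[OF cc, of x] chart_inv_map[OF cc', of x] by (simp add: coord_change_def)
  qed
  \<comment> \<open>The factor \<open>pou c'\<close> vanishes off \<open>csupp c'\<close> and the
    differential off \<open>csupp c\<close>. The intersection is compact and inside the overlap,
    which makes the integrand absolutely integrable there.\<close>
  let ?K = "chart_map c' ` (csupp c \<inter> csupp c')"
  have K: "compact ?K" "?K \<subseteq> ?S'"
  proof -
    have "compactin X (csupp c \<inter> csupp c')"
      using compact_Int_closedin[OF compactin_csupp, of "csupp c'" c] by (simp add: csupp_def)
    then have "compactin (subtopology X (chart_dom c')) (csupp c \<inter> csupp c')"
      using sub by (auto simp: compactin_subtopology)
    then have "compactin euclidean ?K"
      using continuous_chart_map[OF cc'] by (rule image_compactin)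
    then show "compact ?K" by simp
    show "?K \<subseteq> ?S'" using sub by (intro image_mono) blast
  qed
  have f0: "f p = 0" if "p \<in> chart_image c' - ?K" for p
  proof -
    from that obtain x where x: "x \<in> chart_dom c'" "p = chart_map c' x" by (auto simp: chart_image_def)
    have xt: "x \<in> topspace X" using x(1) chart_dom_subset[OF cc'] by blast
    have "x \<notin> csupp c \<or> x \<notin> csupp c'" using that x(2) by blast
    then show ?thesis
    proof
      assume "x \<notin> csupp c"
      then show ?thesis using dpou_wedge_0_outside_csupp[OF c c' x(1)] x(2) by (simp add: f_def)
    next
      assume "x \<notin> csupp c'"
      then show ?thesis using pou_0_outside_csupp[OF xt] chart_inv_map[OF cc' x(1)] x(2) by (simp add: f_def pouc_def)
    qed
  qed
  have cf: "continuous_on (chart_image c') f"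
    unfolding f_def by (intro continuous_on_mult smooth_on_imp_continuous_on[OF smooth_pouc] continuous_dpou_wedge c c')
  have fS': "f absolutely_integrable_on ?S'"
    using f0 S'(1) by (intro compact_support_absolutely_integrable[OF oS' K continuous_on_subset[OF cf S'(1)]]) blast
  have "integral (chart_image c') f = integral ?S' f"
  proof (rule integral_eq_on_support[OF S'(1)])
    fix p assume "p \<in> chart_image c'" "p \<notin> ?S'"
    then have "p \<in> chart_image c' - ?K" using K(2) by blast
    then show "f p = 0" by (rule f0)
  qed
  also have "\<dots> = integral ?S (\<lambda>p. \<bar>det (matrix (coord_change_deriv c c' (chart_inv c p)))\<bar> * f (?\<tau> p))"
  proof -
    have "(?\<tau> has_derivative coord_change_deriv c c' (chart_inv c p)) (at p)" if "p \<in> ?S" for p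
    proof -
      from that obtain x where "x \<in> chart_dom c" "x \<in> chart_dom c'" "p = chart_map c x" by auto
      then show ?thesis
        using coord_change_has_derivative[OF c c', of x] chart_inv_map[OF cc, of x] by simp
    qed
    from integral_change_of_variables_real[OF oS this inj] fS' show ?thesis by (simp only: im)
  qed
  also have "\<dots> = integral ?S (\<lambda>p. pouc c' c p * dpou_wedge b c c p)"
  proof (rule integral_cong)
    fix p assume "p \<in> ?S"
    then obtain x where x: "x \<in> chart_dom c" "x \<in> chart_dom c'" "p = chart_map c x" by auto
    then show "\<bar>det (matrix (coord_change_deriv c c' (chart_inv c p)))\<bar> * f (?\<tau> p) = pouc c' c p * dpou_wedge b c c p"
      using chart_inv_map[OF cc x(1)] chart_inv_map[OF cc' x(2)] dpou_wedge_change[OF c c x(1) c' x(2)]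
      by (simp add: f_def coord_change_def pouc_def)
  qed
  also have "\<dots> = integral (chart_image c) (\<lambda>p. pouc c' c p * dpou_wedge b c c p)"
  proof -
    have "pouc c' c p * dpou_wedge b c c p = 0" if "p \<in> chart_image c" "p \<notin> ?S" for p
    proof -
      from that obtain x where x: "x \<in> chart_dom c" "p = chart_map c x" by (auto simp: chart_image_def)
      then have "x \<notin> csupp c'" "x \<in> topspace X" using that(2) sub(2) chart_dom_subset[OF cc] by blast+
      then show ?thesis
        using pou_0_outside_csupp chart_inv_map[OF cc x(1)] x(2) by (simp add: pouc_def)
    qed
    then show ?thesis by (rule integral_eq_on_support[OF S'(2), symmetric])
  qed
  finally show ?thesis by (simp add: f_def[abs_def])
qed

text \<open>Integration by parts: with \<open>\<rho> = pou c\<close>,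
  \<open>\<rho> db = d(\<rho> b) - d\<rho> \<and> b\<close>, and the components of
  \<open>\<rho> b\<close> have compact support, so their derivatives integrate to 0.\<close>

lemma integral_curl:
  assumes c: "c \<in> A"
  shows "integral (chart_image c) (\<lambda>p. pouc c c p * (dir_deriv (\<lambda>p. b c p (axis 2 1)) (axis 1 1) p - dir_deriv (\<lambda>p. b c p (axis 1 1)) (axis 2 1) p))
    = - integral (chart_image c) (dpou_wedge b c c)"
proof -
  let ?S = "chart_image c" and ?r = "pouc c c"
  let ?f = "\<lambda>v p. ?r p * b c p v"
  note oS = open_chart_image[OF is_chart[OF c]]
  have r: "smooth_on ?r ?S" by (rule smooth_pouc[OF c c])
  have r0: "?r p = 0" if "p \<in> ?S - supp c" for p
    using pou_0_outside_supp[OF c, of p] that by (simp add: pouc_def)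
  have f: "smooth_on (?f v) ?S" for v by (intro smooth_on_mult oS r smooth[OF c])
  have f0: "integral ?S (dir_deriv (?f v) w) = 0" for v w
    using r0 by (intro integral_dir_deriv_compact_support[OF oS compact_supp[OF c] f]) simp
  have df: "dir_deriv (?f v) w p = ?r p * dir_deriv (\<lambda>p. b c p v) w p + dir_deriv ?r w p * b c p v" if "p \<in> ?S" for v w p
    using frechet_derivative_eqI[OF has_derivative_mult[OF frechet_derivative_worksI[OF smooth_on_imp_differentiable[OF r that]]
          frechet_derivative_worksI[OF smooth_on_imp_differentiable[OF smooth[OF c] that]]]] by simp
  have int: "g integrable_on ?S" if "continuous_on ?S g" "\<And>p. p \<in> ?S - supp c \<Longrightarrow> g p = 0" for g :: "real^2 \<Rightarrow> real"
    using compact_support_absolutely_integrable[OF oS compact_supp[OF c] that] by (simp add: absolutely_integrable_on_def)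
  have d0: "dir_deriv ?r w p = 0" if "p \<in> ?S - supp c" for w p
    by (rule dir_deriv_outside_support[OF oS compact_imp_closed[OF compact_supp(1)[OF c]] r0 that])
  have i1: "(dir_deriv (?f v) w) integrable_on ?S" for v w
    using dir_deriv_outside_support[OF oS compact_imp_closed[OF compact_supp(1)[OF c]], of "?f v" _ w] r0
    by (intro int smooth_on_imp_continuous_on[OF smooth_on_dir_deriv[OF f]]) simp
  have i2: "(dpou_wedge b c c) integrable_on ?S"
    using d0 by (intro int continuous_dpou_wedge c) (simp add: dpou_wedge_def)
  have "integral ?S (\<lambda>p. ?r p * (dir_deriv (\<lambda>p. b c p (axis 2 1)) (axis 1 1) p - dir_deriv (\<lambda>p. b c p (axis 1 1)) (axis 2 1) p))
      = integral ?S (\<lambda>p. (dir_deriv (?f (axis 2 1)) (axis 1 1) p - dir_deriv (?f (axis 1 1)) (axis 2 1) p) - dpou_wedge b c c p)"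
    by (rule integral_cong) (simp add: df dpou_wedge_def algebra_simps)
  also have "\<dots> = integral ?S (dir_deriv (?f (axis 2 1)) (axis 1 1)) - integral ?S (dir_deriv (?f (axis 1 1)) (axis 2 1)) - integral ?S (dpou_wedge b c c)"
    by (simp only: integral_diff i1 i2 integrable_diff)
  finally show ?thesis by (simp add: f0)
qed

text \<open>The functions of the partition add up to 1 on the chart, so their differentials add up
  to 0.\<close>

lemma sum_dpou_wedge:
  assumes c: "c \<in> A" and p: "p \<in> chart_image c"
  shows "(\<Sum>c0\<in>active_charts A pou. dpou_wedge b c0 c p) = 0"
proof -
  have "(\<Sum>c0\<in>active_charts A pou. dir_deriv (pouc c0 c) v p) = 0" for v
  proof -
    have "((\<lambda>p. \<Sum>c0\<in>active_charts A pou. pouc c0 c p) has_derivative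
        (\<lambda>v. \<Sum>c0\<in>active_charts A pou. dir_deriv (pouc c0 c) v p)) (at p)"
      using smooth_on_imp_differentiable[OF smooth_pouc[OF _ c] p] active_subset
      by (intro has_derivative_sum frechet_derivative_worksI) blast
    then have "(\<Sum>c0\<in>active_charts A pou. dir_deriv (pouc c0 c) v p) = dir_deriv (\<lambda>p. \<Sum>c0\<in>active_charts A pou. pouc c0 c p) v p"
      by (simp add: frechet_derivative_eqI)
    also have "frechet_derivative (\<lambda>p. \<Sum>c0\<in>active_charts A pou. pouc c0 c p) (at p) = frechet_derivative (\<lambda>p. 1) (at p)"
      using sum_pou[OF chart_inv_in_topspace[OF c]]
      by (intro frechet_cong[OF open_chart_image[OF is_chart[OF c]] p]) (simp add: pouc_def)
    finally show ?thesis by (simp add: frechet_derivative_eqI[OF has_derivative_const])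
  qed
  then show ?thesis
    by (simp add: dpou_wedge_def sum_subtractf flip: sum_distrib_right)
qed

text \<open>Integration by parts turns the left hand side into \<open>- \<integral> \<Sum>\<^sub>c d(pou c) \<and> b\<close>, and the
  functions \<open>pou c\<close> add up to a constant.\<close>

lemma integral_curl_sum:
  "(\<Sum>c\<in>active_charts A pou. integral (chart_image c)
     (\<lambda>p. pouc c c p * (dir_deriv (\<lambda>p. b c p (axis 2 1)) (axis 1 1) p - dir_deriv (\<lambda>p. b c p (axis 1 1)) (axis 2 1) p))) = 0"
proof -
  let ?C = "active_charts A pou"
  have int: "(\<lambda>p. pouc c' c' p * dpou_wedge b c c' p) integrable_on chart_image c'" if "c \<in> A" "c' \<in> A" for c c'
    unfolding pouc_def by (intro pou_integrable continuous_dpou_wedge that)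
  have int': "(\<lambda>p. pouc c' c p * dpou_wedge b c c p) integrable_on chart_image c" if c: "c \<in> A" "c' \<in> A" for c c'
  proof (rule absolutely_integrable_on_def[THEN iffD1, THEN conjunct1, OF compact_support_absolutely_integrable[OF open_chart_image[OF is_chart[OF c(1)]] compact_supp[OF c(1)]]])
    show "continuous_on (chart_image c) (\<lambda>p. pouc c' c p * dpou_wedge b c c p)"
      by (intro continuous_on_mult smooth_on_imp_continuous_on[OF smooth_pouc] continuous_dpou_wedge c)
    show "pouc c' c p * dpou_wedge b c c p = 0" if "p \<in> chart_image c - supp c" for p
    proof -
      have p: "p \<in> chart_image c" "p \<notin> supp c" using that by blast+
      have "chart_inv c p \<notin> csupp c"
      proof
        assume "chart_inv c p \<in> csupp c"
        then have "chart_map c (chart_inv c p) \<in> supp c" unfolding supp_def by (rule imageI)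
        then show False using p by (simp add: chart_map_inv)
      qed
      from dpou_wedge_0_outside_csupp[OF c(1) c(1) chart_inv_in_dom[OF p(1)] this]
      show ?thesis using p(1) by (simp add: chart_map_inv)
    qed
  qed
  \<comment> \<open>A second use of the partition of unity splits the integral in chart
    \<open>c\<close> into pieces, each of which is moved to the chart \<open>c'\<close> of its
    cutoff.\<close>
  have "integral (chart_image c) (dpou_wedge b c c) = (\<Sum>c'\<in>?C. integral (chart_image c') (\<lambda>p. pouc c' c' p * dpou_wedge b c c' p))"
    if c: "c \<in> A" for c
  proof -
    have "integral (chart_image c) (dpou_wedge b c c) = integral (chart_image c) (\<lambda>p. \<Sum>c'\<in>?C. pouc c' c p * dpou_wedge b c c p)"
      using sum_pou[OF chart_inv_in_topspace[OF c]]
      by (intro integral_cong) (simp add: pouc_def flip: sum_distrib_right)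
    also have "\<dots> = (\<Sum>c'\<in>?C. integral (chart_image c) (\<lambda>p. pouc c' c p * dpou_wedge b c c p))"
      using int'[OF c] active_subset by (intro integral_sum finite_active) blast
    also have "\<dots> = (\<Sum>c'\<in>?C. integral (chart_image c') (\<lambda>p. pouc c' c' p * dpou_wedge b c c' p))"
      using integral_pou_dpou_wedge[OF c] active_subset by (intro sum.cong refl) blast
    finally show ?thesis .
  qed
  then have "(\<Sum>c\<in>?C. integral (chart_image c) (dpou_wedge b c c)) =
      (\<Sum>c\<in>?C. \<Sum>c'\<in>?C. integral (chart_image c') (\<lambda>p. pouc c' c' p * dpou_wedge b c c' p))"
    using active_subset by (intro sum.cong refl) blast
  \<comment> \<open>For fixed \<open>c'\<close> all pieces now live in one chart with one cutoff, so
    \<open>sum_dpou_wedge\<close> can be applied under the integral.\<close>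
  also have "\<dots> = (\<Sum>c'\<in>?C. \<Sum>c\<in>?C. integral (chart_image c') (\<lambda>p. pouc c' c' p * dpou_wedge b c c' p))"
    by (rule sum.swap)
  also have "\<dots> = (\<Sum>c'\<in>?C. 0)"
  proof (rule sum.cong[OF refl])
    fix c' assume "c' \<in> ?C"
    then have c': "c' \<in> A" by (rule active_subset)
    have "(\<Sum>c\<in>?C. integral (chart_image c') (\<lambda>p. pouc c' c' p * dpou_wedge b c c' p)) =
        integral (chart_image c') (\<lambda>p. \<Sum>c\<in>?C. pouc c' c' p * dpou_wedge b c c' p)"
      using int[OF _ c'] active_subset by (intro integral_sum[symmetric] finite_active) blast
    also have "\<dots> = integral (chart_image c') (\<lambda>p. 0)"
      by (rule integral_cong) (simp add: sum_dpou_wedge[OF c'] flip: sum_distrib_left)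
    finally show "(\<Sum>c\<in>?C. integral (chart_image c') (\<lambda>p. pouc c' c' p * dpou_wedge b c c' p)) = 0" by simp
  qed
  finally have "(\<Sum>c\<in>?C. integral (chart_image c) (dpou_wedge b c c)) = 0" by simp
  moreover have "(\<Sum>c\<in>?C. integral (chart_image c)
     (\<lambda>p. pouc c c p * (dir_deriv (\<lambda>p. b c p (axis 2 1)) (axis 1 1) p - dir_deriv (\<lambda>p. b c p (axis 1 1)) (axis 2 1) p)))
     = (\<Sum>c\<in>?C. - integral (chart_image c) (dpou_wedge b c c))"
    using integral_curl active_subset by (intro sum.cong refl) blast
  ultimately show ?thesis by (simp add: sum_negf)
qed

end

end

section \<open>Homotopy invariance and the energy bound\<close>

lemma has_derivative_Pair_const: "((\<lambda>q. (t, q)) has_derivative (\<lambda>v. (0, v))) (at p)"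
  by (auto intro!: derivative_eq_intros)

lemma dir_deriv_slice:
  fixes h :: "real \<times> 'a::euclidean_space \<Rightarrow> 'b::real_normed_vector"
  assumes "h differentiable at (t, p)"
  shows "dir_deriv (\<lambda>q. h (t, q)) v p = dir_deriv h (0, v) (t, p)"
  using diff_chain_at[OF has_derivative_Pair_const frechet_derivative_worksI[OF assms]]
  by (simp add: frechet_derivative_eqI o_def)

lemma smooth_on_slice:
  fixes h :: "real \<times> 'a::euclidean_space \<Rightarrow> 'b::real_normed_vector"
  assumes "open T" "open S" "smooth_on h T" "\<And>p. p \<in> S \<Longrightarrow> (t, p) \<in> T"
  shows "smooth_on (\<lambda>p. h (t, p)) S"
  by (rule smooth_on_compose[OF assms(2,1) _ _ assms(3)])
    (use assms(2,4) in \<open>auto intro: smooth_on_Pair smooth_on_const smooth_on_id\<close>)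

context manifold
begin

text \<open>Coordinate changes of the cylinder fix the time component and do not mix it with the
  others. Hence inserting the time direction into a 2-form on the cylinder gives a covariant 1-form
  on each slice.\<close>

lemma coord_change_deriv_cylinder:
  assumes "c \<in> A" "c' \<in> A" "x \<in> chart_dom c" "x \<in> chart_dom c'"
  shows "coord_change_deriv (cylinder_chart c) (cylinder_chart c') (t, x) (\<tau>, w) = (\<tau>, coord_change_deriv c c' x w)"
proof -
  let ?S = "UNIV \<times> chart_map c ` (chart_dom c \<inter> chart_dom c') :: (real \<times> 'e) set"
  have eq: "chart_map (cylinder_chart c) (t, x) = (t, chart_map c x)" by (simp add: cylinder_chart_simps)
  have "frechet_derivative (coord_change (cylinder_chart c) (cylinder_chart c')) (at (t, chart_map c x)) =
      frechet_derivative (\<lambda>z. (fst z, coord_change c c' (snd z))) (at (t, chart_map c x))"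
  proof (rule frechet_cong)
    show "open ?S" by (intro open_Times open_overlap assms open_UNIV)
    show "(t, chart_map c x) \<in> ?S" using assms by blast
    fix z assume z: "z \<in> ?S"
    then have "snd z \<in> chart_image c" by (auto simp: chart_image_def)
    then show "coord_change (cylinder_chart c) (cylinder_chart c') z = (fst z, coord_change c c' (snd z))"
      using chart_inv_cylinder[OF is_chart[OF assms(1)], of "snd z" "fst z"]
      by (simp add: coord_change_def cylinder_chart_simps)
  qed
  moreover have "((\<lambda>z. (fst z, coord_change c c' (snd z))) has_derivative (\<lambda>y. (fst y, coord_change_deriv c c' x (snd y)))) (at (t, chart_map c x))"
  proof (rule has_derivative_Pair)
    show "(fst has_derivative fst) (at (t, chart_map c x))"
      by (rule bounded_linear_imp_has_derivative[OF bounded_linear_fst])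
    have "(coord_change c c' has_derivative coord_change_deriv c c' x) (at (snd (t, chart_map c x)))"
      using coord_change_has_derivative[OF assms] by simp
    from diff_chain_at[OF bounded_linear_imp_has_derivative[OF bounded_linear_snd] this]
    show "((\<lambda>z. coord_change c c' (snd z)) has_derivative (\<lambda>y. coord_change_deriv c c' x (snd y))) (at (t, chart_map c x))"
      by (simp add: o_def)
  qed
  ultimately show ?thesis
    unfolding coord_change_deriv_def[of "cylinder_chart c"] eq by (simp add: frechet_derivative_eqI)
qed

end

context manifold_pair
begin

context
  fixes F assumes F: "smooth_map (prod_topology euclideanreal X) (cylinder_chart ` A) Y B F"
begin

interpretation C: manifold_pair "prod_topology euclideanreal X" "cylinder_chart ` A" Y B
  by (rule manifold_pair.intro[OF M.cylinder_manifold N.manifold_axioms])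

lemma local_dom_slice:
  assumes "c \<in> A"
  shows "p \<in> local_dom c d (\<lambda>x. F (t, x)) \<longleftrightarrow> (t, p) \<in> local_dom (cylinder_chart c) d F"
  unfolding local_dom_iff[OF assms] C.local_dom_iff[OF imageI[OF assms]]
  using chart_inv_cylinder[OF M.is_chart[OF assms], of p t] by (auto simp: cylinder_chart_simps)

lemma local_rep_slice:
  assumes "c \<in> A" "p \<in> chart_image c"
  shows "local_rep c d (\<lambda>x. F (t, x)) p = local_rep (cylinder_chart c) d F (t, p)"
  using chart_inv_cylinder[OF M.is_chart[OF assms(1)] assms(2), of t] by simp

lemma smooth_map_slice: "smooth_map X A Y B (\<lambda>x. F (t, x))"
proof -
  have contF: "continuous_map (prod_topology euclideanreal X) Y F" using F by (simp add: smooth_map_def)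
  have "continuous_map X (prod_topology euclideanreal X) (\<lambda>x. (t, x))"
    by (simp add: continuous_map_paired)
  from continuous_map_compose[OF this contF] have cont: "continuous_map X Y (\<lambda>x. F (t, x))" by (simp add: o_def)
  moreover have "smooth_on (local_rep c d (\<lambda>x. F (t, x))) (local_dom c d (\<lambda>x. F (t, x)))"
    if c: "c \<in> A" and d: "d \<in> B" for c d
  proof -
    let ?T = "local_dom c d (\<lambda>x. F (t, x))"
    have oT: "open ?T" by (rule open_local_dom[OF cont c d])
    have "smooth_on (\<lambda>p. local_rep (cylinder_chart c) d F (t, p)) ?T"
      using local_dom_slice[OF c]
      by (intro smooth_on_slice[OF C.open_local_dom'[OF F imageI[OF c] d] oT C.smooth_local_rep[OF F imageI[OF c] d]]) blast
    moreover have "local_rep c d (\<lambda>x. F (t, x)) p = local_rep (cylinder_chart c) d F (t, p)" if "p \<in> ?T" for p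
      by (rule local_rep_slice[OF c subsetD[OF local_dom_subset that]])
    ultimately show ?thesis by (subst smooth_on_cong[OF oT])
  qed
  ultimately show ?thesis by (simp add: smooth_map_def)
qed

text \<open>Pulling back by a slice map is restricting the pullback by \<open>F\<close> to the
  horizontal vectors \<open>(0, v)\<close>.\<close>

lemma pullback2_slice:
  assumes c: "c \<in> A" and p: "p \<in> chart_image c"
  shows "tensor_coord A (pullback2 A B (\<lambda>x. F (t, x)) \<alpha>) c p v w =
    tensor_coord (cylinder_chart ` A) (pullback2 (cylinder_chart ` A) B F \<alpha>) (cylinder_chart c) (t, p) (0, v) (0, w)"
proof -
  let ?f = "\<lambda>x. F (t, x)"
  have "chart_inv c p \<in> topspace X"
    using chart_inv_in_dom[OF p] chart_dom_subset[OF M.is_chart[OF c]] by blast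
  then have "?f (chart_inv c p) \<in> topspace Y"
    using smooth_map_slice[of t] by (auto simp: smooth_map_def continuous_map_def)
  then obtain d where d: "d \<in> B" "?f (chart_inv c p) \<in> chart_dom d" using N.chart_cover[of "?f (chart_inv c p)"] by blast
  then have pd: "p \<in> local_dom c d ?f" using local_dom_iff[OF c, of p ?f d] p by blast
  then have pd': "(t, p) \<in> local_dom (cylinder_chart c) d F" by (simp only: local_dom_slice[OF c])
  have D: "dir_deriv (local_rep c d ?f) v p = dir_deriv (local_rep (cylinder_chart c) d F) (0, v) (t, p)" for v
  proof -
    have "frechet_derivative (local_rep c d ?f) (at p) = frechet_derivative (\<lambda>q. local_rep (cylinder_chart c) d F (t, q)) (at p)"
      by (rule frechet_cong[OF open_local_dom'[OF smooth_map_slice c d(1)] pd])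
        (rule local_rep_slice[OF c subsetD[OF local_dom_subset]])
    moreover have "local_rep (cylinder_chart c) d F differentiable at (t, p)"
      by (rule smooth_on_imp_differentiable[OF C.smooth_local_rep[OF F imageI[OF c] d(1)] pd'])
    ultimately show ?thesis using dir_deriv_slice by metis
  qed
  show ?thesis
    unfolding pullback2_coord[OF smooth_map_slice c d(1) pd] C.pullback2_coord[OF F imageI[OF c] d(1) pd'] D
      local_rep_slice[OF c p] ..
qed

end

end

locale compact_surface_to_manifold = compact_surface X A + N: manifold Y B
  for X :: "'a topology" and A :: "('a, real^2) chart set"
    and Y :: "'b topology" and B :: "('b, 'f::euclidean_space) chart set"

sublocale compact_surface_to_manifold \<subseteq> manifold_pair X A Y B ..

context compact_surface_to_manifold
begin

lemma integral_pullback_homotopy_invariant: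
  assumes \<phi>: "smooth_map X A Y B \<phi>" and \<psi>: "smooth_map X A Y B \<psi>"
    and hom: "homotopic_with (\<lambda>_. True) X Y \<phi> \<psi>"
    and \<alpha>: "smooth_tensor2 B \<alpha>" "alternating_2form B \<alpha>" "closed_2form B \<alpha>"
  shows "integral_2form X A (pullback2 A B \<psi> \<alpha>) = integral_2form X A (pullback2 A B \<phi> \<alpha>)"
proof -
  let ?P = "prod_topology euclideanreal X" and ?CA = "cylinder_chart ` A"
  interpret C: manifold_pair ?P ?CA Y B
    by (rule manifold_pair.intro[OF cylinder_manifold N.manifold_axioms])
  obtain F where F: "smooth_map ?P ?CA Y B F" "\<And>x. F (- 2, x) = \<phi> x" "\<And>x. F (3, x) = \<psi> x"
    by (rule smooth_homotopy_exists[OF compact \<phi> \<psi> hom]) blast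
  define \<Theta> where "\<Theta> c z \<xi> \<zeta> = tensor_coord ?CA (pullback2 ?CA B F \<alpha>) (cylinder_chart c) z \<xi> \<zeta>" for c z \<xi> \<zeta>
  note \<Theta> = C.pullback2_closed[OF F(1) \<alpha>]
  have bil: "bilinear (\<Theta> c (t, p))" if "c \<in> A" "p \<in> chart_image c" for c t p
  proof -
    have "(t, p) \<in> chart_image (cylinder_chart c)" using that(2) by (simp add: cylinder_chart_simps)
    then show ?thesis
      using \<Theta>(1) that(1) unfolding smooth_tensor2_def \<Theta>_def[abs_def] by blast
  qed
  have smooth: "smooth_on (\<lambda>z. \<Theta> c z \<xi> \<zeta>) (UNIV \<times> chart_image c)" if "c \<in> A" for c \<xi> \<zeta>
    using \<Theta>(1) that unfolding smooth_tensor2_def \<Theta>_def cylinder_chart_simps(3)[symmetric] by blast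
  have closed: "dir_deriv (\<lambda>z. \<Theta> c z \<xi> \<zeta>) u (t, p) - dir_deriv (\<lambda>z. \<Theta> c z u \<zeta>) \<xi> (t, p) + dir_deriv (\<lambda>z. \<Theta> c z u \<xi>) \<zeta> (t, p) = 0"
    if "c \<in> A" "p \<in> chart_image c" for c t p u \<xi> \<zeta>
  proof -
    have "(t, p) \<in> chart_image (cylinder_chart c)" using that(2) by (simp add: cylinder_chart_simps)
    then show ?thesis
      using \<Theta>(3) that(1) unfolding closed_2form_def \<Theta>_def by blast
  qed
  have change: "\<Theta> c (t, chart_map c x) (\<tau>, v) (\<sigma>, w) =
      \<Theta> c' (t, chart_map c' x) (\<tau>, coord_change_deriv c c' x v) (\<sigma>, coord_change_deriv c c' x w)"
    if c: "c \<in> A" "c' \<in> A" "x \<in> chart_dom c" "x \<in> chart_dom c'" for c c' x t \<tau> \<sigma> v w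
    using C.M.tensor_coord_change[OF imageI[OF c(1)] imageI[OF c(2)], of "(t, x)" "pullback2 ?CA B F \<alpha>" "(\<tau>, v)" "(\<sigma>, w)"] c
    by (simp add: \<Theta>_def coord_change_deriv_cylinder cylinder_chart_simps)
  \<comment> \<open>The horizontal component of the pulled back form; \<open>I t\<close> is the
    integral of its restriction to the slice at time \<open>t\<close>.\<close>
  define h where "h c z = \<Theta> c z (0, axis 1 1) (0, axis 2 1)" for c z
  define I where "I t = (\<Sum>c\<in>active_charts A pou. integral (chart_image c) (\<lambda>p. pouc c c p * h c (t, p)))" for t
  have slice: "integral_2form X A (pullback2 A B (\<lambda>x. F (t, x)) \<alpha>) = I t" for t
    unfolding integral_2form_pou I_def
  proof (intro sum.cong refl integral_cong)
    fix c p assume c: "c \<in> active_charts A pou" and p: "p \<in> chart_image c"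
    show "pou c (chart_inv c p) * tensor_coord A (pullback2 A B (\<lambda>x. F (t, x)) \<alpha>) c p (axis 1 1) (axis 2 1) = pouc c c p * h c (t, p)"
      by (simp only: pouc_def h_def \<Theta>_def pullback2_slice[OF F(1) active_subset[OF c] p])
  qed
  have "(I has_real_derivative 0) (at t)" for t
  proof -
    \<comment> \<open>The contraction of \<open>\<Theta>\<close> with the time direction, i.e. the
      1-form \<open>\<beta>\<close> on the slice at time \<open>t\<close>.\<close>
    define b where "b c p v = \<Theta> c (t, p) (1, 0) (0, v)" for c p v
    have b_smooth: "smooth_on (\<lambda>p. b c p v) (chart_image c)" if c: "c \<in> A" for c v
    proof -
      have oS: "open (chart_image c)" by (rule open_chart_image[OF is_chart[OF c]])
      show ?thesis unfolding b_def
        by (rule smooth_on_slice[OF _ oS smooth[OF c]]) (auto intro: open_Times oS)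
    qed
    have curl: "(\<Sum>c\<in>active_charts A pou. integral (chart_image c)
       (\<lambda>p. pouc c c p * (dir_deriv (\<lambda>p. b c p (axis 2 1)) (axis 1 1) p - dir_deriv (\<lambda>p. b c p (axis 1 1)) (axis 2 1) p))) = 0"
    proof (rule integral_curl_sum)
      show "linear (b c p)" if "c \<in> A" "p \<in> chart_image c" for c p
      proof -
        have "linear (\<Theta> c (t, p) (1, 0))" using bil[OF that] unfolding bilinear_def by blast
        moreover have "linear (\<lambda>v. (0, v) :: real \<times> (real^2))"
          by (intro bounded_linear.linear bounded_linear_Pair bounded_linear_zero bounded_linear_ident)
        ultimately show ?thesis unfolding b_def[abs_def] using linear_compose[unfolded o_def] by blast
      qed
      show "b c (chart_map c x) v = b c' (chart_map c' x) (coord_change_deriv c c' x v)"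
        if "c \<in> A" "c' \<in> A" "x \<in> chart_dom c" "x \<in> chart_dom c'" for c c' x v
        using change[OF that, of t 1 0 0 v] linear_0[OF linear_coord_change_deriv[OF that]] by (simp add: b_def)
    qed (rule b_smooth)
    have "((\<lambda>t. integral (chart_image c) (\<lambda>p. pouc c c p * h c (t, p))) has_real_derivative
        integral (chart_image c) (\<lambda>p. pouc c c p * (dir_deriv (\<lambda>p. b c p (axis 2 1)) (axis 1 1) p - dir_deriv (\<lambda>p. b c p (axis 1 1)) (axis 2 1) p))) (at t)"
      if "c \<in> active_charts A pou" for c
    proof -
      have c: "c \<in> A" by (rule active_subset[OF that])
      have "((\<lambda>t. integral (chart_image c) (\<lambda>p. pouc c c p * h c (t, p))) has_real_derivative
          integral (chart_image c) (\<lambda>p. pouc c c p * dir_deriv (h c) (1, 0) (t, p))) (at t)"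
      proof (rule has_derivative_integral_compact_support[OF open_chart_image[OF is_chart[OF c]] compact_supp[OF c] smooth_pouc[OF c c]])
        show "pouc c c p = 0" if "p \<in> chart_image c - supp c" for p
          using pou_0_outside_supp[OF c, of p] that by (simp add: pouc_def)
        show "smooth_on (h c) (UNIV \<times> chart_image c)"
          unfolding h_def[abs_def] by (rule smooth[OF c])
      qed
      \<comment> \<open>Closedness of \<open>\<Theta>\<close> on the time direction and the two
        horizontal coordinate directions: the time derivative of \<open>h\<close> is the curl of
        \<open>b\<close>.\<close>
      moreover have "dir_deriv (h c) (1, 0) (t, p) = dir_deriv (\<lambda>p. b c p (axis 2 1)) (axis 1 1) p - dir_deriv (\<lambda>p. b c p (axis 1 1)) (axis 2 1) p"
        if p: "p \<in> chart_image c" for p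
      proof -
        have "dir_deriv (\<lambda>p. b c p v) w p = dir_deriv (\<lambda>z. \<Theta> c z (1, 0) (0, v)) (0, w) (t, p)" for v w
          unfolding b_def using p by (intro dir_deriv_slice smooth_on_imp_differentiable[OF smooth[OF c]]) simp
        then show ?thesis
          using closed[OF c p, of "(0, axis 1 1)" "(0, axis 2 1)" t "(1, 0)"] by (simp add: h_def[abs_def])
      qed
      ultimately show ?thesis by (simp cong: integral_cong)
    qed
    then have "(I has_real_derivative (\<Sum>c\<in>active_charts A pou. integral (chart_image c)
       (\<lambda>p. pouc c c p * (dir_deriv (\<lambda>p. b c p (axis 2 1)) (axis 1 1) p - dir_deriv (\<lambda>p. b c p (axis 1 1)) (axis 2 1) p)))) (at t)"
      unfolding I_def[abs_def] by (rule DERIV_sum)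
    then show ?thesis by (simp only: curl)
  qed
  then have "I 3 = I (- 2)" by (intro DERIV_isconst_all) blast
  moreover have "(\<lambda>x. F (3, x)) = \<psi>" "(\<lambda>x. F (- 2, x)) = \<phi>" using F(2,3) by auto
  ultimately show ?thesis using slice[of 3] slice[of "-2"] by simp
qed

end

text \<open>Closedness is part of the Kaehler condition. The form is alternating because
  \<open>h(Jv, v) = h(JJv, Jv) = - h(v, Jv) = - h(Jv, v)\<close>, by invariance of \<open>h\<close>
  under \<open>J\<close>, \<open>JJ = -1\<close> and symmetry.\<close>

lemma kaehler_form_closed_2form:
  assumes "kaehler_manifold Y B h J"
  shows "smooth_tensor2 B (kaehler_form h J)" "alternating_2form B (kaehler_form h J)" "closed_2form B (kaehler_form h J)"
proof -
  interpret N: manifold Y B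
    using assms unfolding kaehler_manifold_def by (intro smooth_manifold_imp_manifold) blast
  have h: "smooth_tensor2 B h" "\<And>x u v. x \<in> topspace Y \<Longrightarrow> u \<in> tangent_space B x \<Longrightarrow> v \<in> tangent_space B x \<Longrightarrow> h x u v = h x v u"
    using assms unfolding kaehler_manifold_def riemannian_metric_def by blast+
  have hJ: "\<And>x u v. x \<in> topspace Y \<Longrightarrow> u \<in> tangent_space B x \<Longrightarrow> v \<in> tangent_space B x \<Longrightarrow> h x (J x u) (J x v) = h x u v"
    using assms unfolding kaehler_manifold_def by blast
  have ac: "almost_complex_structure Y B J"
    using assms unfolding kaehler_manifold_def complex_structure_def by blast
  show "closed_2form B (kaehler_form h J)"
    using assms unfolding kaehler_manifold_def by blast
  define j where "j d q v = J (chart_inv d q) (coord_vector B d (chart_inv d q) v) d" for d q v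
  have coord: "tensor_coord B (kaehler_form h J) d q v w = tensor_coord B h d q (j d q v) w"
    "linear (j d q)" "tensor_coord B h d q (j d q v) v = 0"
    if d: "d \<in> B" and q: "q \<in> chart_image d" for d q v w
  proof -
    let ?y = "chart_inv d q"
    note y = chart_inv_in_dom[OF q] chart_map_inv[OF q]
    have yt: "?y \<in> topspace Y" using chart_dom_subset[OF N.is_chart[OF d]] y(1) by blast
    let ?cv = "coord_vector B d ?y"
    have T: "?cv v \<in> tangent_space B ?y" for v by (rule N.coord_vector_in_tangent_space[OF d y(1)])
    have JT: "J ?y u \<in> tangent_space B ?y" "J ?y (J ?y u) = (\<lambda>c. - u c)" if "u \<in> tangent_space B ?y" for u
      using ac yt that unfolding almost_complex_structure_def by blast+
    have same: "?cv v d = v" for v by (rule N.coord_vector_same[OF d y(1)])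
    have hc: "h ?y u v = tensor_coord B h d q (u d) (v d)" if "u \<in> tangent_space B ?y" "v \<in> tangent_space B ?y" for u v
      using N.tensor_coord_eq[OF d y(1) that] y(2) by simp
    have jJ: "j d q v = J ?y (?cv v) d" for v by (simp add: j_def)
    show "tensor_coord B (kaehler_form h J) d q v w = tensor_coord B h d q (j d q v) w"
      using hc[OF JT(1)[OF T] T] by (simp add: tensor_coord_def[of B "kaehler_form h J"] kaehler_form_def jJ same)
    show "linear (j d q)"
      unfolding j_def using ac d y(1) unfolding almost_complex_structure_def by blast
    have bil: "bilinear (tensor_coord B h d q)"
      using h(1) d q unfolding smooth_tensor2_def by blast
    have "tensor_coord B h d q (j d q v) v = h ?y (J ?y (?cv v)) (?cv v)"
      using hc[OF JT(1)[OF T] T] by (simp add: jJ same)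
    also have "\<dots> = h ?y (J ?y (J ?y (?cv v))) (J ?y (?cv v))"
      by (rule hJ[OF yt JT(1)[OF T] T, symmetric])
    also have "\<dots> = tensor_coord B h d q (- v) (j d q v)"
      using hc[OF JT(1)[OF JT(1)[OF T]] JT(1)[OF T]] by (simp add: JT(2)[OF T] jJ same)
    also have "\<dots> = - tensor_coord B h d q v (j d q v)"
      by (rule bilinear_lneg[OF bil])
    also have "tensor_coord B h d q v (j d q v) = h ?y (?cv v) (J ?y (?cv v))"
      using hc[OF T JT(1)[OF T]] by (simp add: jJ same)
    also have "\<dots> = h ?y (J ?y (?cv v)) (?cv v)"
      by (rule h(2)[OF yt T JT(1)[OF T]])
    also have "\<dots> = tensor_coord B h d q (j d q v) v"
      using hc[OF JT(1)[OF T] T] by (simp add: jJ same)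
    finally show "tensor_coord B h d q (j d q v) v = 0" by simp
  qed
  show "alternating_2form B (kaehler_form h J)"
    unfolding alternating_2form_def using coord(1,3) by simp
  show "smooth_tensor2 B (kaehler_form h J)"
    unfolding smooth_tensor2_def
  proof (intro ballI conjI allI)
    fix d q assume d: "d \<in> B" and q: "q \<in> chart_image d"
    have eq: "tensor_coord B (kaehler_form h J) d q = (\<lambda>v w. tensor_coord B h d q (j d q v) w)"
      by (intro ext coord(1)[OF d q])
    have "bilinear (tensor_coord B h d q)"
      using h(1) d q unfolding smooth_tensor2_def by blast
    then show "bilinear (tensor_coord B (kaehler_form h J) d q)"
      unfolding eq bilinear_def using linear_compose[OF coord(2)[OF d q], unfolded o_def] by blast
  next
    fix d v w assume d: "d \<in> B"
    note oS = open_chart_image[OF N.is_chart[OF d]]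
    have "smooth_on (\<lambda>q. tensor_coord B h d q (j d q v) w) (chart_image d)"
    \<comment> \<open>The base point map is the identity here, and the first argument is the column
      \<open>j d q v\<close> of the matrix of \<open>J\<close>, smooth by the definition of an
      almost complex structure.\<close>
    proof (rule smooth_on_bilinear_field[OF _ _ oS oS smooth_on_id])
      show "bilinear (tensor_coord B h d q)" if "q \<in> chart_image d" for q
        using h(1) d that unfolding smooth_tensor2_def by blast
      show "smooth_on (\<lambda>q. tensor_coord B h d q v w) (chart_image d)" for v w
        using h(1) d unfolding smooth_tensor2_def by blast
      show "smooth_on (\<lambda>q. j d q v) (chart_image d)"
        unfolding j_def using ac d unfolding almost_complex_structure_def by blast
    qed (simp_all add: smooth_on_const)
    then show "smooth_on (\<lambda>q. tensor_coord B (kaehler_form h J) d q v w) (chart_image d)"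
      using coord(1)[OF d] by (subst smooth_on_cong[OF oS])
  qed
qed

context compact_surface
begin

lemma continuous_2form_of_smooth:
  "smooth_tensor2 A \<alpha> \<Longrightarrow> alternating_2form A \<alpha> \<Longrightarrow> continuous_2form \<alpha>"
  unfolding smooth_tensor2_def alternating_2form_def continuous_2form_def
  using smooth_on_imp_continuous_on by blast

end

context compact_riemannian_surface
begin

section \<open>Isotropic maps and maps without critical points\<close>

lemma eq_0_of_density_eq_0:
  assumes "continuous_2form \<alpha>" "x \<in> topspace X" "density \<alpha> x = 0" "u \<in> tangent_space A x" "v \<in> tangent_space A x"
  shows "\<alpha> x u v = 0"
proof -
  obtain c where c: "c \<in> A" "x \<in> chart_dom c" using assms(2) chart_cover[of x] by blast
  note p = chart_map_in_image[OF c(2)]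
  let ?a = "tensor_coord A \<alpha> c (chart_map c x)"
  have a: "bilinear ?a" "\<And>v. ?a v v = 0"
    using assms(1) c(1) p unfolding continuous_2form_def by blast+
  have a12: "?a (axis 1 1) (axis 2 1) = 0"
    using vol(3)[OF c(1) p a] assms(3) chart_inv_map[OF is_chart[OF c(1)] c(2)] by simp
  have "?a (u c) (v c) = 0"
    unfolding bilinear_real2[OF a(1), of "u c"] bilinear_alternating[OF a, of "axis 2 1"] a12 a(2) by simp
  then show ?thesis using tensor_coord_eq[OF c assms(4,5), of \<alpha>] by simp
qed

lemma density_nonzero_coord:
  assumes "continuous_2form \<alpha>" "x \<in> topspace X" "density \<alpha> x \<noteq> 0" "c \<in> A" "x \<in> chart_dom c"
  shows "tensor_coord A \<alpha> c (chart_map c x) (axis 1 1) (axis 2 1) \<noteq> 0"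
proof -
  note p = chart_map_in_image[OF assms(5)]
  have "bilinear (tensor_coord A \<alpha> c (chart_map c x))" "\<And>v. tensor_coord A \<alpha> c (chart_map c x) v v = 0"
    using assms(1,4) p unfolding continuous_2form_def by blast+
  from vol(3)[OF assms(4) p this] show ?thesis
    using vol(1)[OF assms(4) p] assms(3) chart_inv_map[OF is_chart[OF assms(4)] assms(5)] by simp
qed

end

text \<open>If the differential kills \<open>w\<close>, inserting its image into the form gives the
  coordinates of \<open>w\<close> times the nonzero component. So the differential is injective and
  its rank is 2.\<close>

lemma not_critical_point:
  fixes A :: "('a, real^2) chart set" and B :: "('b, 'f::euclidean_space) chart set"
  assumes "manifold_pair X A Y B" and f: "smooth_map X A Y B f" and \<alpha>: "smooth_tensor2 B \<alpha>" "alternating_2form B \<alpha>"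
    and c: "c \<in> A" "x \<in> chart_dom c"
    and nz: "tensor_coord A (pullback2 A B f \<alpha>) c (chart_map c x) (axis 1 1) (axis 2 1) \<noteq> 0"
  shows "\<not> critical_point A B f x"
proof -
  interpret manifold_pair X A Y B by fact
  have "x \<in> topspace X" using chart_dom_subset[OF M.is_chart[OF c(1)]] c(2) by blast
  then have "f x \<in> topspace Y" using f by (auto simp: smooth_map_def continuous_map_def)
  then have d: "chart_at B (f x) \<in> B" "f x \<in> chart_dom (chart_at B (f x))" using N.chart_at by auto
  define d where "d = chart_at B (f x)"
  note d' = d[folded d_def]
  let ?p = "chart_map c x"
  let ?D = "frechet_derivative (local_rep c d f) (at ?p)"
  have pd: "?p \<in> local_dom c d f" using c(2) d'(2) by blast
  have linD: "linear ?D"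
    by (rule linear_frechet_derivative[OF local_rep_differentiable[OF f c(1) d'(1) c(2) d'(2)]])
  note q = local_rep_in_image[OF c(1) pd]
  define a where "a = tensor_coord B \<alpha> d (local_rep c d f ?p)"
  have a: "bilinear a" "\<And>v. a v v = 0"
    using \<alpha> d'(1) q unfolding smooth_tensor2_def alternating_2form_def a_def by blast+
  have nz': "a (?D (axis 1 1)) (?D (axis 2 1)) \<noteq> 0"
    using nz unfolding pullback2_coord[OF f c(1) d'(1) pd] a_def .
  have "inj ?D"
  proof (subst linear_injective_0[OF linD], intro allI impI)
    fix w assume w: "?D w = 0"
    have "w = w$1 *\<^sub>R axis 1 1 + w$2 *\<^sub>R axis 2 1" by (simp add: vec_eq_iff axis_def forall_2)
    then have rep: "?D w = w$1 *\<^sub>R ?D (axis 1 1) + w$2 *\<^sub>R ?D (axis 2 1)"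
      using linear_add[OF linD] linear_cmul[OF linD] by metis
    have "a (?D w) (?D (axis 2 1)) = w$1 * a (?D (axis 1 1)) (?D (axis 2 1))"
      unfolding rep by (simp add: bilinear_ladd[OF a(1)] bilinear_lmul[OF a(1)] a(2))
    moreover have "a (?D (axis 1 1)) (?D w) = w$2 * a (?D (axis 1 1)) (?D (axis 2 1))"
      unfolding rep by (simp add: bilinear_radd[OF a(1)] bilinear_rmul[OF a(1)] a(2))
    ultimately have "w$1 = 0 \<and> w$2 = 0"
      using nz' by (simp add: w bilinear_lzero[OF a(1)] bilinear_rzero[OF a(1)])
    then show "w = 0" by (simp add: vec_eq_iff forall_2)
  qed
  then have "dim (range ?D) = 2"
    using dim_image_eq[OF linD, of UNIV] by simp
  moreover have "(\<lambda>v. differential A B f x v d) ` tangent_space A x = range ?D"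
  proof (intro equalityI subsetI)
    fix y assume "y \<in> (\<lambda>v. differential A B f x v d) ` tangent_space A x"
    then show "y \<in> range ?D" using differential_coord[OF f c d'] by auto
  next
    fix y assume "y \<in> range ?D"
    then obtain w where "y = ?D w" by auto
    then have "y = differential A B f x (coord_vector A c x w) d"
      using differential_coord[OF f c d' M.coord_vector_in_tangent_space[OF c]] M.coord_vector_same[OF c] by simp
    then show "y \<in> (\<lambda>v. differential A B f x v d) ` tangent_space A x"
      using M.coord_vector_in_tangent_space[OF c] by blast
  qed
  ultimately have "differential_rank A B f x = 2"
    by (simp add: differential_rank_def d_def)
  \<comment> \<open>Rank 2 must equal the minimum of both dimensions. The target has dimension at
    least 2 because it contains a plane as the image.\<close>
  moreover have "2 \<le> DIM('f)"
    using \<open>dim (range ?D) = 2\<close> dim_subset_UNIV[of "range ?D"] by simp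
  ultimately show ?thesis by (simp add: critical_point_def)
qed

theorem proposition4p1:
  fixes X :: "'a topology" and A :: "('a, real^2) chart set" and g :: "('a, real^2) tensor2"
    and Y :: "'b topology" and B :: "('b, 'f::euclidean_space) chart set"
    and h :: "('b, 'f) tensor2" and J :: "'b \<Rightarrow> ('b, 'f) tangent \<Rightarrow> ('b, 'f) tangent"
    and \<phi> :: "'a \<Rightarrow> 'b"
  assumes "oriented_manifold X A" and "compact_space X" and "riemannian_metric X A g"
    and "kaehler_manifold Y B h J" and "compact_space Y"
    and "smooth_map X A Y B \<phi>"
  defines "\<omega> \<equiv> kaehler_form h J"
  shows "energy X A g B \<omega> \<phi> \<ge> energy_bound X A g B \<omega> \<phi>
    \<and> (\<forall>\<psi>. smooth_map X A Y B \<psi> \<longrightarrow> homotopic_with (\<lambda>_. True) X Y \<phi> \<psi> \<longrightarrow>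
         energy_bound X A g B \<omega> \<psi> = energy_bound X A g B \<omega> \<phi>)
    \<and> (energy X A g B \<omega> \<phi> = energy_bound X A g B \<omega> \<phi> \<longrightarrow>
         (isotropic X A B \<omega> \<phi> \<and> energy X A g B \<omega> \<phi> = 0)
         \<or> (\<forall>x\<in>topspace X. \<not> critical_point A B \<phi> x))"
proof -
  interpret M: compact_riemannian_surface X A g
    by unfold_locales (rule assms)+
  interpret N: manifold Y B
    using assms(4) unfolding kaehler_manifold_def by (intro smooth_manifold_imp_manifold) blast
  interpret compact_surface_to_manifold X A Y B ..
  note \<omega> = kaehler_form_closed_2form[OF assms(4), folded \<omega>_def]
  let ?\<alpha> = "pullback2 A B \<phi> \<omega>"
  note \<alpha> = pullback2_closed[OF assms(6) \<omega>]
  have cont: "M.continuous_2form ?\<alpha>"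
    by (rule M.continuous_2form_of_smooth[OF \<alpha>(1,2)])
  note dens = M.continuous_density[OF cont]
  have E: "energy X A g B \<omega> \<phi> = 1 / 2 * M.vol_integral (\<lambda>x. (M.density ?\<alpha> x)\<^sup>2)"
    by (simp only: energy_def M.integral_norm_eq[OF cont])
  have bound: "energy_bound X A g B \<omega> \<phi> = 1 / (2 * M.vol_integral (\<lambda>x. 1)) * (M.vol_integral (M.density ?\<alpha>))\<^sup>2"
    by (simp only: energy_bound_def M.total_volume_eq M.integral_2form_eq[OF cont])
  show ?thesis
  proof (intro conjI allI impI)
    show "energy_bound X A g B \<omega> \<phi> \<le> energy X A g B \<omega> \<phi>"
      unfolding E bound by (rule M.Cauchy_Schwarz(1)[OF dens])
  next
    fix \<psi> assume "smooth_map X A Y B \<psi>" "homotopic_with (\<lambda>_. True) X Y \<phi> \<psi>"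
    \<comment> \<open>The bound depends on the map only through the integral of the
      pullback.\<close>
    then show "energy_bound X A g B \<omega> \<psi> = energy_bound X A g B \<omega> \<phi>"
      by (simp only: energy_bound_def integral_pullback_homotopy_invariant[OF assms(6) _ _ \<omega>])
  next
    assume "energy X A g B \<omega> \<phi> = energy_bound X A g B \<omega> \<phi>"
    then have "\<exists>k. \<forall>x\<in>topspace X. M.density ?\<alpha> x = k"
      unfolding E bound by (intro M.Cauchy_Schwarz(2)[OF dens]) (rule sym)
    then obtain k where k: "\<And>x. x \<in> topspace X \<Longrightarrow> M.density ?\<alpha> x = k" by blast
    show "(isotropic X A B \<omega> \<phi> \<and> energy X A g B \<omega> \<phi> = 0) \<or> (\<forall>x\<in>topspace X. \<not> critical_point A B \<phi> x)"
    proof (cases "k = 0")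
      case True
      have "M.vol_integral (\<lambda>x. (M.density ?\<alpha> x)\<^sup>2) = M.vol_integral (\<lambda>x. 0)"
        by (rule M.vol_integral_cong) (simp add: k True)
      then have "energy X A g B \<omega> \<phi> = 0"
        unfolding E by (simp add: M.vol_integral_def)
      moreover have "isotropic X A B \<omega> \<phi>"
        unfolding isotropic_def using M.eq_0_of_density_eq_0[OF cont] k True by simp
      ultimately show ?thesis by blast
    next
      case False
      have "\<not> critical_point A B \<phi> x" if x: "x \<in> topspace X" for x
      proof -
        obtain c where c: "c \<in> A" "x \<in> chart_dom c" using M.chart_cover[of x] x by blast
        show ?thesis
          using M.density_nonzero_coord[OF cont x _ c] k[OF x] False
          by (intro not_critical_point[OF manifold_pair_axioms assms(6) \<omega>(1,2) c]) simp
      qed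
      then show ?thesis by blast
    qed
  qed
qed

end
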